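(* For a topological dynamical system $\Sigma=(X,\sigma)$, the following statements are equivalent. (i) $\Sigma$ is topologically free; (ii) $I\cap C(X)\neq\{0\}$ for every non-zero two-sided ideal $I$ (not necessarily closed or self-adjoint) of $C^*(\Sigma)$; (iii) $C(X)$ is a maximal abelian $C^*$-subalgebra of $C^*(\Sigma)$.
   Context: A topological dynamical system $\Sigma=(X,\sigma)$ consists of a compact Hausdorff space $X$ and a homeomorphism $\sigma$ of $X$; it is topologically free if the set of its non-periodic points is dense in $X$. $C^*(\Sigma)=C(X)\rtimes_\alpha\mathbb{Z}$ is the $C^*$-crossed product for the automorphism $\alpha(f)=f\circ\sigma^{-1}$ of $C(X)$; $C(X)$ is identified with its canonical copy in $C^*(\Sigma)$. *)

theory Defs
  imports "HOL-Analysis.Analysis" "HOL-Algebra.Ideal" "HOL-Algebra.Module"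
begin

definition top_dyn_sys :: "'x topology \<Rightarrow> ('x \<Rightarrow> 'x) \<Rightarrow> bool" where
  "top_dyn_sys X \<sigma> \<longleftrightarrow> compact_space X \<and> Hausdorff_space X \<and> homeomorphic_map X X \<sigma>"

definition non_periodic_points :: "'x topology \<Rightarrow> ('x \<Rightarrow> 'x) \<Rightarrow> 'x set" where
  "non_periodic_points X \<sigma> = {x \<in> topspace X. \<forall>n>0. (\<sigma> ^^ n) x \<noteq> x}"

definition topologically_free :: "'x topology \<Rightarrow> ('x \<Rightarrow> 'x) \<Rightarrow> bool" where
  "topologically_free X \<sigma> \<longleftrightarrow> X closure_of non_periodic_points X \<sigma> = topspace X"

text \<open>A function on the space is represented by its extension by zero to the whole type,
  so that equality of functions on the space is equality in HOL.\<close>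

definition cont_funs :: "'x topology \<Rightarrow> ('x \<Rightarrow> complex) set" where
  "cont_funs X = {f. continuous_map X euclidean f \<and> (\<forall>x. x \<notin> topspace X \<longrightarrow> f x = 0)}"

definition int_iterate :: "'x topology \<Rightarrow> ('x \<Rightarrow> 'x) \<Rightarrow> int \<Rightarrow> 'x \<Rightarrow> 'x" where
  "int_iterate X \<sigma> n =
     (if n \<ge> 0 then \<sigma> ^^ nat n else inv_into (topspace X) \<sigma> ^^ nat (- n))"

text \<open>The \<open>n\<close>-th power of the automorphism that sends \<open>f\<close> to \<open>f \<circ> \<sigma>\<inverse>\<close>.\<close>

definition \<alpha>_pow :: "'x topology \<Rightarrow> ('x \<Rightarrow> 'x) \<Rightarrow> int \<Rightarrow> ('x \<Rightarrow> complex) \<Rightarrow> 'x \<Rightarrow> complex" where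
  "\<alpha>_pow X \<sigma> n f = (\<lambda>x. if x \<in> topspace X then f (int_iterate X \<sigma> (- n) x) else 0)"

record 'a star_alg = "(complex, 'a) module" +
  star :: "'a \<Rightarrow> 'a"

record 'a normed_star_alg = "'a star_alg" +
  nrm :: "'a \<Rightarrow> real"

definition cstar_seminorm :: "('a, 'm) star_alg_scheme \<Rightarrow> ('a \<Rightarrow> real) \<Rightarrow> bool" where
  "cstar_seminorm A p \<longleftrightarrow>
     (\<forall>a \<in> carrier A. 0 \<le> p a) \<and>
     (\<forall>a \<in> carrier A. \<forall>b \<in> carrier A. p (a \<oplus>\<^bsub>A\<^esub> b) \<le> p a + p b) \<and>
     (\<forall>c. \<forall>a \<in> carrier A. p (c \<odot>\<^bsub>A\<^esub> a) = cmod c * p a) \<and>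
     (\<forall>a \<in> carrier A. \<forall>b \<in> carrier A. p (a \<otimes>\<^bsub>A\<^esub> b) \<le> p a * p b) \<and>
     (\<forall>a \<in> carrier A. p (star A a \<otimes>\<^bsub>A\<^esub> a) = (p a)\<^sup>2)"

text \<open>The enveloping C*-seminorm. C*-seminorms on a star-algebra are exactly the functions
  \<open>a \<mapsto> \<parallel>\<pi> a\<parallel>\<close> for a star-homomorphism \<open>\<pi>\<close> into a C*-algebra (the Hausdorff completion), so this
  is the supremum of \<open>\<parallel>\<pi> a\<parallel>\<close> over all star-representations \<open>\<pi>\<close>, stated without quantifying
  over the types of the representation spaces. The real supremum is only meaningful for
  star-algebras on which the C*-seminorms are pointwise bounded. This holds for the algebraic
  crossed product below: its C*-seminorms are at most the \<open>\<ell>\<^sup>1\<close>-norm.\<close>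

definition max_cstar_seminorm :: "('a, 'm) star_alg_scheme \<Rightarrow> 'a \<Rightarrow> real" where
  "max_cstar_seminorm A a = (SUP p \<in> {p. cstar_seminorm A p}. p a)"

text \<open>Hausdorff completion of a star-algebra in a seminorm: Cauchy sequences modulo null
  sequences, with the operations and the norm induced from representatives.\<close>

definition cauchy_seqs :: "('a, 'm) star_alg_scheme \<Rightarrow> ('a \<Rightarrow> real) \<Rightarrow> (nat \<Rightarrow> 'a) set" where
  "cauchy_seqs A p = {s. (\<forall>n. s n \<in> carrier A) \<and>
     (\<forall>e>0. \<exists>N. \<forall>m\<ge>N. \<forall>n\<ge>N. p (s m \<ominus>\<^bsub>A\<^esub> s n) < e)}"

definition null_rel :: "('a, 'm) star_alg_scheme \<Rightarrow> ('a \<Rightarrow> real) \<Rightarrow> (nat \<Rightarrow> 'a) rel" where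
  "null_rel A p = {(s, t). s \<in> cauchy_seqs A p \<and> t \<in> cauchy_seqs A p \<and>
     (\<lambda>n. p (s n \<ominus>\<^bsub>A\<^esub> t n)) \<longlonglongrightarrow> 0}"

definition seq_class :: "('a, 'm) star_alg_scheme \<Rightarrow> ('a \<Rightarrow> real) \<Rightarrow> (nat \<Rightarrow> 'a) \<Rightarrow> (nat \<Rightarrow> 'a) set"
  where "seq_class A p s = null_rel A p `` {s}"

definition completion ::
  "('a, 'm) star_alg_scheme \<Rightarrow> ('a \<Rightarrow> real) \<Rightarrow> (nat \<Rightarrow> 'a) set normed_star_alg" where
  "completion A p = \<lparr>
     carrier = cauchy_seqs A p // null_rel A p,
     monoid.mult = (\<lambda>S T. \<Union>s\<in>S. \<Union>t\<in>T. seq_class A p (\<lambda>n. s n \<otimes>\<^bsub>A\<^esub> t n)),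
     one = seq_class A p (\<lambda>n. \<one>\<^bsub>A\<^esub>),
     zero = seq_class A p (\<lambda>n. \<zero>\<^bsub>A\<^esub>),
     add = (\<lambda>S T. \<Union>s\<in>S. \<Union>t\<in>T. seq_class A p (\<lambda>n. s n \<oplus>\<^bsub>A\<^esub> t n)),
     smult = (\<lambda>c S. \<Union>s\<in>S. seq_class A p (\<lambda>n. c \<odot>\<^bsub>A\<^esub> s n)),
     star = (\<lambda>S. \<Union>s\<in>S. seq_class A p (\<lambda>n. star A (s n))),
     nrm = (\<lambda>S. lim (\<lambda>n. p ((SOME s. s \<in> S) n)))\<rparr>"

definition enveloping_cstar :: "('a, 'm) star_alg_scheme \<Rightarrow> (nat \<Rightarrow> 'a) set normed_star_alg" where
  "enveloping_cstar A = completion A (max_cstar_seminorm A)"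

definition to_enveloping :: "('a, 'm) star_alg_scheme \<Rightarrow> 'a \<Rightarrow> (nat \<Rightarrow> 'a) set" where
  "to_enveloping A a = seq_class A (max_cstar_seminorm A) (\<lambda>_. a)"

definition cstar_subalgebra :: "('a, 'm) normed_star_alg_scheme \<Rightarrow> 'a set \<Rightarrow> bool" where
  "cstar_subalgebra A B \<longleftrightarrow>
     B \<subseteq> carrier A \<and> \<zero>\<^bsub>A\<^esub> \<in> B \<and>
     (\<forall>a\<in>B. \<forall>b\<in>B. a \<oplus>\<^bsub>A\<^esub> b \<in> B) \<and>
     (\<forall>c. \<forall>a\<in>B. c \<odot>\<^bsub>A\<^esub> a \<in> B) \<and>
     (\<forall>a\<in>B. \<forall>b\<in>B. a \<otimes>\<^bsub>A\<^esub> b \<in> B) \<and>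
     (\<forall>a\<in>B. star A a \<in> B) \<and>
     (\<forall>s a. (\<forall>n. s n \<in> B) \<and> a \<in> carrier A \<and> (\<lambda>n::nat. nrm A (s n \<ominus>\<^bsub>A\<^esub> a)) \<longlonglongrightarrow> 0 \<longrightarrow> a \<in> B)"

definition abelian_cstar_subalgebra :: "('a, 'm) normed_star_alg_scheme \<Rightarrow> 'a set \<Rightarrow> bool" where
  "abelian_cstar_subalgebra A B \<longleftrightarrow>
     cstar_subalgebra A B \<and> (\<forall>a\<in>B. \<forall>b\<in>B. a \<otimes>\<^bsub>A\<^esub> b = b \<otimes>\<^bsub>A\<^esub> a)"

definition maximal_abelian_cstar_subalgebra :: "('a, 'm) normed_star_alg_scheme \<Rightarrow> 'a set \<Rightarrow> bool"
  where
  "maximal_abelian_cstar_subalgebra A B \<longleftrightarrow>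
     abelian_cstar_subalgebra A B \<and>
     (\<forall>B'. abelian_cstar_subalgebra A B' \<and> B \<subseteq> B' \<longrightarrow> B' = B)"

text \<open>The element \<open>f \<delta>\<^sup>n\<close>, where \<open>\<delta>\<close> is the canonical unitary.\<close>

definition monomial :: "('x \<Rightarrow> complex) \<Rightarrow> int \<Rightarrow> int \<Rightarrow> 'x \<Rightarrow> complex" where
  "monomial f n = (\<lambda>k. if k = n then f else (\<lambda>_. 0))"

text \<open>Finite sums \<open>\<Sum>\<^sub>n a\<^sub>n \<delta>\<^sup>n\<close> with \<open>a\<^sub>n\<close> continuous, encoded by their coefficients. The
  operations are determined by
  \<open>(f \<delta>\<^sup>m) (g \<delta>\<^sup>n) = f \<alpha>\<^sup>m(g) \<delta>\<^bsup>m+n\<^esup>\<close> and \<open>(f \<delta>\<^sup>n)\<^sup>* = \<delta>\<^bsup>-n\<^esup> (cnj f) = \<alpha>\<^bsup>-n\<^esup>(cnj f) \<delta>\<^bsup>-n\<^esup>\<close>.\<close>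

definition algebraic_crossed_product ::
  "'x topology \<Rightarrow> ('x \<Rightarrow> 'x) \<Rightarrow> (int \<Rightarrow> 'x \<Rightarrow> complex) star_alg" where
  "algebraic_crossed_product X \<sigma> = \<lparr>
     carrier = {a. (\<forall>n. a n \<in> cont_funs X) \<and> finite {n. a n \<noteq> (\<lambda>_. 0)}},
     monoid.mult = (\<lambda>a b n x. \<Sum>k\<in>{k. a k \<noteq> (\<lambda>_. 0)}. a k x * \<alpha>_pow X \<sigma> k (b (n - k)) x),
     one = monomial (\<lambda>x. if x \<in> topspace X then 1 else 0) 0,
     zero = (\<lambda>_ _. 0),
     add = (\<lambda>a b n x. a n x + b n x),
     smult = (\<lambda>c a n x. c * a n x),
     star = (\<lambda>a n. \<alpha>_pow X \<sigma> n (\<lambda>x. cnj (a (- n) x)))\<rparr>"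

definition crossed_product ::
  "'x topology \<Rightarrow> ('x \<Rightarrow> 'x) \<Rightarrow> (nat \<Rightarrow> int \<Rightarrow> 'x \<Rightarrow> complex) set normed_star_alg" where
  "crossed_product X \<sigma> = enveloping_cstar (algebraic_crossed_product X \<sigma>)"

definition canonical_copy ::
  "'x topology \<Rightarrow> ('x \<Rightarrow> 'x) \<Rightarrow> (nat \<Rightarrow> int \<Rightarrow> 'x \<Rightarrow> complex) set set" where
  "canonical_copy X \<sigma> =
     (\<lambda>f. to_enveloping (algebraic_crossed_product X \<sigma>) (monomial f 0)) ` cont_funs X"

end

theory Submission
  imports Defs
begin

text \<open>
  Write \<open>\<tau> n\<close> for the \<open>n\<close>-th power of \<open>\<sigma>\<close> on the space, \<open>A\<close> for the algebra of finite sums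
  \<open>\<Sum>\<^sub>n a\<^sub>n \<delta>\<^sup>n\<close> and \<open>P\<close> for its largest C*-seminorm, so that \<open>C*(\<Sigma>)\<close> is the completion of \<open>A\<close> in
  \<open>P\<close>. Everything rests on the fact that an element of \<open>C*(\<Sigma>)\<close> has continuous Fourier
  coefficients and is determined by them.

  For the coefficients, \<open>P\<close> must be bounded from above and from below. Above: a continuous
  function with values in \<open>[-1, 1]\<close> is the mean of two unitaries, so every C*-seminorm is at most
  the sup norm on functions and at most the l1-norm on \<open>A\<close> (\<open>seminorm_le_l1\<close>). Below: \<open>A\<close> acts on
  the finitely supported functions on the space by multiplications and translations, and the
  operator norm of this action is a C*-seminorm that is faithful on functions
  (\<open>cstar_seminorm_rep_norm\<close>, \<open>le_rep_norm_monomial\<close>). The gauge automorphisms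
  \<open>\<delta> \<mapsto> z \<delta>\<close> preserve \<open>P\<close>. Averaging them over roots of unity isolates one coefficient,
  whence \<open>\<bar>a\<^sub>n(x)\<bar> \<le> P a\<close> (\<open>coefficient_le_P\<close>). Averaging with Fejer weights gives contractions that
  keep only finitely many coefficients and converge to the identity, whence the coefficients determine the
  element (\<open>cls_eq_iff_coef\<close>).

  Let the system be topologically free. A nonzero ideal contains some \<open>b\<close> with
  \<open>b\<^sub>0(x) = 1\<close> at a non-periodic point \<open>x\<close>. If \<open>h\<close> is a bump function at \<open>x\<close> with small support, then
  the translates of the support that matter are disjoint from it, so \<open>h b h\<close> is close to the function
  \<open>h\<^sup>2\<close>. Hence \<open>y = 1 - h\<^sup>2 + h b h\<close> is at distance less than 1 from the unit and has a right inverse.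
  A function \<open>k\<close> with \<open>k h = k\<close> satisfies \<open>k y = k h b h\<close>, so \<open>k = k h b h z\<close> with \<open>y z = 1\<close> lies in the ideal
  itself and not merely in its closure (\<open>free_imp_ideals_meet\<close>). Moreover an element that
  commutes with all functions satisfies \<open>b\<^sub>n(x) (f(x) - f(\<tau>(-n) x)) = 0\<close>, so \<open>b\<^sub>n\<close> vanishes at all
  non-periodic points for \<open>n \<noteq> 0\<close>, hence everywhere, and \<open>b\<close> is a function
  (\<open>free_imp_maximal_abelian\<close>).

  If the system is not topologically free, then by the Baire category theorem some \<open>\<tau> n\<close> with
  \<open>n \<noteq> 0\<close> is the identity on a nonempty open set; let \<open>f \<noteq> 0\<close> be a function supported there
  (\<open>not_free_periodic_function\<close>). The action on functions on the space kills \<open>f - f \<delta>\<^sup>n\<close>, and its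
  kernel is a nonzero ideal that contains no nonzero function (\<open>ideals_meet_imp_free\<close>). The finite
  sums with \<open>a\<^sub>n\<close> supported on the fixed points of \<open>\<tau> n\<close> form a commutative subalgebra that
  contains all functions and also \<open>f \<delta>\<^sup>n\<close>, so its closure shows that \<open>C(X)\<close> is not maximal abelian
  (\<open>maximal_abelian_imp_free\<close>).
\<close>

section \<open>Completion of a star-ring in a C*-seminorm\<close>

lemma tendsto_0_D:
  fixes f :: "nat \<Rightarrow> real"
  shows "\<lbrakk>f \<longlonglongrightarrow> 0; 0 < e\<rbrakk> \<Longrightarrow> \<exists>N. \<forall>n\<ge>N. f n < e"
  using order_tendstoD(2)[of f 0 sequentially e] by (simp add: eventually_sequentially)

lemma tendsto_0_le:
  fixes f g :: "nat \<Rightarrow> real"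
  assumes "g \<longlonglongrightarrow> 0" "\<And>n. 0 \<le> f n" "\<And>n. f n \<le> g n"
  shows "f \<longlonglongrightarrow> 0"
  by (rule tendsto_sandwich[of "\<lambda>_. 0" f sequentially g]) (use assms in auto)

text \<open>The compatibilities of scalars and involution with subtraction are what make the operations
descend to classes of Cauchy sequences.\<close>

locale cstar_seminormed_ring = ring A for A :: "('a, 'm) star_alg_scheme" (structure) +
  fixes p :: "'a \<Rightarrow> real"
  assumes cstar_seminorm: "cstar_seminorm A p"
    and smult_closed [simp]: "a \<in> carrier A \<Longrightarrow> c \<odot> a \<in> carrier A"
    and smult_minus: "\<lbrakk>a \<in> carrier A; b \<in> carrier A\<rbrakk> \<Longrightarrow> c \<odot> (a \<ominus> b) = c \<odot> a \<ominus> c \<odot> b"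
    and smult_minus_one: "a \<in> carrier A \<Longrightarrow> (- 1) \<odot> a = \<ominus> a"
    and star_closed [simp]: "a \<in> carrier A \<Longrightarrow> star A a \<in> carrier A"
    and star_minus: "\<lbrakk>a \<in> carrier A; b \<in> carrier A\<rbrakk> \<Longrightarrow> star A (a \<ominus> b) = star A a \<ominus> star A b"
    and star_star [simp]: "a \<in> carrier A \<Longrightarrow> star A (star A a) = a"
begin

lemma p_nonneg [simp]: "a \<in> carrier A \<Longrightarrow> 0 \<le> p a"
  and p_add: "\<lbrakk>a \<in> carrier A; b \<in> carrier A\<rbrakk> \<Longrightarrow> p (a \<oplus> b) \<le> p a + p b"
  and p_smult: "a \<in> carrier A \<Longrightarrow> p (c \<odot> a) = cmod c * p a"
  and p_mult: "\<lbrakk>a \<in> carrier A; b \<in> carrier A\<rbrakk> \<Longrightarrow> p (a \<otimes> b) \<le> p a * p b"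
  and p_star_mult: "a \<in> carrier A \<Longrightarrow> p (star A a \<otimes> a) = (p a)\<^sup>2"
  using cstar_seminorm by (auto simp: cstar_seminorm_def)

lemma p_zero [simp]: "p \<zero> = 0"
proof -
  have "0 \<odot> (\<zero> \<ominus> \<zero>) = 0 \<odot> \<zero> \<ominus> 0 \<odot> \<zero>"
    by (rule smult_minus) auto
  then have "0 \<odot> \<zero> = \<zero>"
    by (simp add: minus_eq r_neg)
  then show ?thesis
    using p_smult[of \<zero> 0] by simp
qed

lemma p_neg: "a \<in> carrier A \<Longrightarrow> p (\<ominus> a) = p a"
  using p_smult[of a "-1"] by (simp add: smult_minus_one)

lemma p_minus_commute: "\<lbrakk>a \<in> carrier A; b \<in> carrier A\<rbrakk> \<Longrightarrow> p (a \<ominus> b) = p (b \<ominus> a)"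
  using p_neg[of "a \<ominus> b"] by (simp add: minus_eq minus_add a_comm)

lemma p_minus_le: "\<lbrakk>a \<in> carrier A; b \<in> carrier A\<rbrakk> \<Longrightarrow> p (a \<ominus> b) \<le> p a + p b"
  using p_add[of a "\<ominus> b"] by (simp add: minus_eq p_neg)

lemma diff_add_diff:
  "\<lbrakk>a \<in> carrier A; b \<in> carrier A; c \<in> carrier A\<rbrakk> \<Longrightarrow> (a \<ominus> b) \<oplus> (b \<ominus> c) = a \<ominus> c"
  by (simp add: minus_eq a_assoc) (simp add: a_assoc[symmetric] l_neg)

lemma p_triangle:
  "\<lbrakk>a \<in> carrier A; b \<in> carrier A; c \<in> carrier A\<rbrakk> \<Longrightarrow> p (a \<ominus> c) \<le> p (a \<ominus> b) + p (b \<ominus> c)"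
  using p_add[of "a \<ominus> b" "b \<ominus> c"] diff_add_diff[of a b c] by simp

lemma p_diff_le:
  assumes "a \<in> carrier A" "b \<in> carrier A"
  shows "\<bar>p a - p b\<bar> \<le> p (a \<ominus> b)"
proof -
  have "p x \<le> p (x \<ominus> y) + p y" if "x \<in> carrier A" "y \<in> carrier A" for x y
    using p_triangle[of x y \<zero>] that by (simp add: minus_eq)
  from this[OF assms] this[OF assms(2,1)] show ?thesis
    using p_minus_commute[OF assms] by linarith
qed

text \<open>From \<open>p(a)\<^sup>2 = p(a\<^sup>* a) \<le> p(a\<^sup>*) p(a)\<close>, applied to \<open>a\<close> and to \<open>a\<^sup>*\<close>.\<close>

lemma p_star:
  assumes "a \<in> carrier A"
  shows "p (star A a) = p a"
proof -
  have "p x \<le> p (star A x)" if "x \<in> carrier A" for x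
  proof (cases "p x = 0")
    case False
    then have "p x * p x \<le> p (star A x) * p x"
      using p_star_mult[OF that] p_mult[of "star A x" x] that by (simp add: power2_eq_square)
    then show ?thesis
      using False p_nonneg[OF that] by (simp add: mult_le_cancel_right)
  qed (use that in auto)
  from this[OF assms] this[of "star A a"] show ?thesis
    using assms by simp
qed

text \<open>The C*-identity at the unit reads \<open>p(1) = p(1)\<^sup>2\<close>, so \<open>p(1)\<close> is 0 or 1.\<close>

lemma p_one_le: "p \<one> \<le> 1"
proof -
  have "p \<one> = (p \<one>)\<^sup>2"
    using p_star_mult[of \<one>] by (simp add: p_star)
  then show ?thesis
    by (cases "p \<one> = 0") (auto simp: power2_eq_square)
qed

lemma add_diff_add:
  "\<lbrakk>a \<in> carrier A; b \<in> carrier A; c \<in> carrier A; d \<in> carrier A\<rbrakk>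
    \<Longrightarrow> (a \<oplus> b) \<ominus> (c \<oplus> d) = (a \<ominus> c) \<oplus> (b \<ominus> d)"
  by (simp add: minus_eq minus_add a_ac)

text \<open>The product rule that carries all continuity estimates for the multiplication.\<close>

lemma mult_diff_mult:
  "\<lbrakk>a \<in> carrier A; b \<in> carrier A; c \<in> carrier A; d \<in> carrier A\<rbrakk>
    \<Longrightarrow> (a \<otimes> b) \<ominus> (c \<otimes> d) = (a \<ominus> c) \<otimes> b \<oplus> c \<otimes> (b \<ominus> d)"
  by (simp add: minus_eq l_distr r_distr l_minus r_minus a_assoc)
    (simp add: a_assoc[symmetric] l_neg)

abbreviation "Cau \<equiv> cauchy_seqs A p"
abbreviation "cls \<equiv> seq_class A p"
abbreviation "C \<equiv> completion A p"

lemma cauchy_carrier: "s \<in> Cau \<Longrightarrow> s n \<in> carrier A"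
  by (simp add: cauchy_seqs_def)

lemma cauchyD:
  assumes "s \<in> Cau" "e > 0"
  obtains N where "\<And>m n. \<lbrakk>m \<ge> N; n \<ge> N\<rbrakk> \<Longrightarrow> p (s m \<ominus> s n) < e"
proof -
  from assms have "\<exists>N. \<forall>m\<ge>N. \<forall>n\<ge>N. p (s m \<ominus> s n) < e"
    unfolding cauchy_seqs_def by blast
  then show ?thesis using that by blast
qed

lemma const_cauchy [simp]: "a \<in> carrier A \<Longrightarrow> (\<lambda>_. a) \<in> Cau"
  by (auto simp: cauchy_seqs_def minus_eq r_neg)

lemma cauchy_bounded:
  assumes "s \<in> Cau"
  obtains K where "K > 0" "\<And>n. p (s n) \<le> K"
proof -
  note [simp] = cauchy_carrier[OF assms]
  obtain N where N: "\<And>m n. \<lbrakk>m \<ge> N; n \<ge> N\<rbrakk> \<Longrightarrow> p (s m \<ominus> s n) < 1"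
    using cauchyD[OF assms, of 1] by auto
  have "p (s n) \<le> Max ((\<lambda>i. p (s i)) ` {..N}) + 1" for n
  proof (cases "n \<le> N")
    case True
    then have "p (s n) \<le> Max ((\<lambda>i. p (s i)) ` {..N})"
      by (intro Max_ge) auto
    then show ?thesis by simp
  next
    case False
    then have "p (s n) \<le> p (s N) + 1"
      using N[of n N] p_diff_le[of "s n" "s N"] assms by auto
    moreover have "p (s N) \<le> Max ((\<lambda>i. p (s i)) ` {..N})"
      by (intro Max_ge) auto
    ultimately show ?thesis by linarith
  qed
  then have "p (s n) \<le> max 1 (Max ((\<lambda>i. p (s i)) ` {..N}) + 1)" for n
    using max.coboundedI2 by blast
  then show ?thesis
    by (intro that[of "max 1 (Max ((\<lambda>i. p (s i)) ` {..N}) + 1)"]) auto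
qed

lemma equiv_null_rel: "equiv Cau (null_rel A p)"
proof (rule equivI)
  show "null_rel A p \<subseteq> Cau \<times> Cau"
    by (auto simp: null_rel_def)
  show "refl_on Cau (null_rel A p)"
    by (auto simp: refl_on_def null_rel_def minus_eq r_neg cauchy_carrier)
  show "sym (null_rel A p)"
    by (auto simp: sym_def null_rel_def p_minus_commute cauchy_carrier)
  show "trans (null_rel A p)"
  proof (rule transI)
    fix s t u assume st: "(s, t) \<in> null_rel A p" and tu: "(t, u) \<in> null_rel A p"
    then have *: "s \<in> Cau" "t \<in> Cau" "u \<in> Cau"
      by (auto simp: null_rel_def)
    note [simp] = cauchy_carrier[OF *(1)] cauchy_carrier[OF *(2)] cauchy_carrier[OF *(3)]
    have "(\<lambda>n. p (s n \<ominus> u n)) \<longlonglongrightarrow> 0"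
    proof (rule tendsto_0_le)
      show "(\<lambda>n. p (s n \<ominus> t n) + p (t n \<ominus> u n)) \<longlonglongrightarrow> 0"
        using st tu by (auto simp: null_rel_def intro: tendsto_add_zero)
    qed (use * p_triangle in auto)
    then show "(s, u) \<in> null_rel A p"
      using * by (simp add: null_rel_def)
  qed
qed

lemma cls_eq_iff:
  "\<lbrakk>s \<in> Cau; t \<in> Cau\<rbrakk> \<Longrightarrow> cls s = cls t \<longleftrightarrow> (\<lambda>n. p (s n \<ominus> t n)) \<longlonglongrightarrow> 0"
  using eq_equiv_class_iff[OF equiv_null_rel, of s t]
  by (simp add: seq_class_def null_rel_def)

lemma cls_self: "s \<in> Cau \<Longrightarrow> s \<in> cls s"
  unfolding seq_class_def by (rule equiv_class_self[OF equiv_null_rel])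

lemma in_clsD: "t \<in> cls s \<Longrightarrow> s \<in> Cau \<and> t \<in> Cau \<and> cls t = cls s"
  unfolding seq_class_def
  using equiv_class_eq[OF equiv_null_rel, of s t] by (auto simp: null_rel_def)

lemma carrier_C: "carrier C = cls ` Cau"
  by (auto simp: completion_def quotient_def seq_class_def)

lemma cls_in_C [simp]: "s \<in> Cau \<Longrightarrow> cls s \<in> carrier C"
  by (auto simp: carrier_C)

lemma carrier_C_E:
  assumes "S \<in> carrier C"
  obtains s where "s \<in> Cau" "S = cls s"
  using assms by (auto simp: carrier_C)

lemma carrier_C_E':
  assumes "S \<in> carrier C"
  obtains s where "s \<in> Cau" "\<forall>n. s n \<in> carrier A" "S = cls s"
  using assms cauchy_carrier by (metis carrier_C_E)

lemma add_cauchy [simp]: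
  assumes s: "s \<in> Cau" and t: "t \<in> Cau"
  shows "(\<lambda>n. s n \<oplus> t n) \<in> Cau"
proof -
  note [simp] = cauchy_carrier[OF s] cauchy_carrier[OF t]
  have "\<exists>N. \<forall>m\<ge>N. \<forall>n\<ge>N. p ((s m \<oplus> t m) \<ominus> (s n \<oplus> t n)) < e" if "e > 0" for e
  proof -
    have "e / 2 > 0" using that by simp
    then obtain N1 where N1: "\<And>m n. \<lbrakk>m \<ge> N1; n \<ge> N1\<rbrakk> \<Longrightarrow> p (s m \<ominus> s n) < e / 2"
      by (rule cauchyD[OF s]) blast
    have "e / 2 > 0" using that by simp
    then obtain N2 where N2: "\<And>m n. \<lbrakk>m \<ge> N2; n \<ge> N2\<rbrakk> \<Longrightarrow> p (t m \<ominus> t n) < e / 2"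
      by (rule cauchyD[OF t]) blast
    have "p ((s m \<oplus> t m) \<ominus> (s n \<oplus> t n)) < e" if "m \<ge> max N1 N2" "n \<ge> max N1 N2" for m n
      using N1[of m n] N2[of m n] that s t p_add[of "s m \<ominus> s n" "t m \<ominus> t n"]
      by (auto simp: add_diff_add)
    then show ?thesis by blast
  qed
  then show ?thesis using s t by (auto simp: cauchy_seqs_def)
qed

lemma mult_cauchy [simp]:
  assumes s: "s \<in> Cau" and t: "t \<in> Cau"
  shows "(\<lambda>n. s n \<otimes> t n) \<in> Cau"
proof -
  note [simp] = cauchy_carrier[OF s] cauchy_carrier[OF t]
  obtain K where K: "K > 0" "\<And>n. p (s n) \<le> K" using cauchy_bounded[OF s] by auto
  obtain L where L: "L > 0" "\<And>n. p (t n) \<le> L" using cauchy_bounded[OF t] by auto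
  have "\<exists>N. \<forall>m\<ge>N. \<forall>n\<ge>N. p ((s m \<otimes> t m) \<ominus> (s n \<otimes> t n)) < e" if "e > 0" for e
  proof -
    have "e / (2 * L) > 0" using that L by simp
    then obtain N1 where N1: "\<And>m n. \<lbrakk>m \<ge> N1; n \<ge> N1\<rbrakk> \<Longrightarrow> p (s m \<ominus> s n) < e / (2 * L)"
      by (rule cauchyD[OF s]) blast
    have "e / (2 * K) > 0" using that K by simp
    then obtain N2 where N2: "\<And>m n. \<lbrakk>m \<ge> N2; n \<ge> N2\<rbrakk> \<Longrightarrow> p (t m \<ominus> t n) < e / (2 * K)"
      by (rule cauchyD[OF t]) blast
    have "p ((s m \<otimes> t m) \<ominus> (s n \<otimes> t n)) < e" if mn: "m \<ge> max N1 N2" "n \<ge> max N1 N2" for m n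
    proof -
      have "p ((s m \<otimes> t m) \<ominus> (s n \<otimes> t n)) \<le> p ((s m \<ominus> s n) \<otimes> t m) + p (s n \<otimes> (t m \<ominus> t n))"
        using s t by (simp add: mult_diff_mult p_add)
      also have "\<dots> \<le> p (s m \<ominus> s n) * p (t m) + p (s n) * p (t m \<ominus> t n)"
        using s t by (intro add_mono p_mult) auto
      also have "\<dots> \<le> p (s m \<ominus> s n) * L + K * p (t m \<ominus> t n)"
        using s t K L by (intro add_mono mult_mono) (auto simp: less_imp_le)
      also have "\<dots> < (e / (2 * L)) * L + K * (e / (2 * K))"
        using N1[of m n] N2[of m n] mn K L by (intro add_strict_mono mult_strict_right_mono mult_strict_left_mono) auto
      also have "\<dots> = e" using K L by (simp add: field_simps)
      finally show ?thesis .
    qed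
    then show ?thesis by blast
  qed
  then show ?thesis using s t by (auto simp: cauchy_seqs_def)
qed

lemma smult_cauchy [simp]:
  assumes s: "s \<in> Cau"
  shows "(\<lambda>n. c \<odot> s n) \<in> Cau"
proof -
  note [simp] = cauchy_carrier[OF s]
  have "\<exists>N. \<forall>m\<ge>N. \<forall>n\<ge>N. p (c \<odot> s m \<ominus> c \<odot> s n) < e" if "e > 0" for e
  proof -
    have "e / (cmod c + 1) > 0" using that by (simp add: add_nonneg_pos)
    then obtain N where N: "\<And>m n. \<lbrakk>m \<ge> N; n \<ge> N\<rbrakk> \<Longrightarrow> p (s m \<ominus> s n) < e / (cmod c + 1)"
      by (rule cauchyD[OF s]) blast
    have "p (c \<odot> s m \<ominus> c \<odot> s n) < e" if "m \<ge> N" "n \<ge> N" for m n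
    proof -
      have "p (c \<odot> s m \<ominus> c \<odot> s n) = cmod c * p (s m \<ominus> s n)"
        using s by (simp add: smult_minus[symmetric] p_smult)
      also have "\<dots> \<le> (cmod c + 1) * p (s m \<ominus> s n)"
        using s by (intro mult_right_mono) auto
      also have "\<dots> < (cmod c + 1) * (e / (cmod c + 1))"
        using N[OF that] by (intro mult_strict_left_mono) (auto simp: add_nonneg_pos)
      also have "\<dots> = e"
        by (simp add: add_nonneg_eq_0_iff)
      finally show ?thesis .
    qed
    then show ?thesis by blast
  qed
  then show ?thesis using s by (auto simp: cauchy_seqs_def)
qed

lemma star_cauchy [simp]: "s \<in> Cau \<Longrightarrow> (\<lambda>n. star A (s n)) \<in> Cau"
  by (auto simp: cauchy_seqs_def star_minus[symmetric] p_star)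

lemma add_cls:
  assumes "s \<in> Cau" "t \<in> Cau"
  shows "cls s \<oplus>\<^bsub>C\<^esub> cls t = cls (\<lambda>n. s n \<oplus> t n)"
proof -
  have "congruent2 (null_rel A p) (null_rel A p) (\<lambda>s t. cls (\<lambda>n. s n \<oplus> t n))"
  proof (rule congruent2I'[OF ])
    fix s s' t t' assume st: "(s, s') \<in> null_rel A p" "(t, t') \<in> null_rel A p"
    then have *: "s \<in> Cau" "s' \<in> Cau" "t \<in> Cau" "t' \<in> Cau"
      by (auto simp: null_rel_def)
    note [simp] = cauchy_carrier[OF *(1)] cauchy_carrier[OF *(2)] cauchy_carrier[OF *(3)] cauchy_carrier[OF *(4)]
    have "(\<lambda>n. p ((s n \<oplus> t n) \<ominus> (s' n \<oplus> t' n))) \<longlonglongrightarrow> 0"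
    proof (rule tendsto_0_le)
      show "(\<lambda>n. p (s n \<ominus> s' n) + p (t n \<ominus> t' n)) \<longlonglongrightarrow> 0"
        using st by (auto simp: null_rel_def intro: tendsto_add_zero)
    qed (use * in \<open>auto simp: add_diff_add p_add\<close>)
    then show "cls (\<lambda>n. s n \<oplus> t n) = cls (\<lambda>n. s' n \<oplus> t' n)"
      using * by (simp add: cls_eq_iff)
  qed
  from UN_equiv_class2[OF equiv_null_rel equiv_null_rel this assms] show ?thesis
    by (simp add: completion_def seq_class_def)
qed

lemma mult_cls:
  assumes "s \<in> Cau" "t \<in> Cau"
  shows "cls s \<otimes>\<^bsub>C\<^esub> cls t = cls (\<lambda>n. s n \<otimes> t n)"
proof -
  have "congruent2 (null_rel A p) (null_rel A p) (\<lambda>s t. cls (\<lambda>n. s n \<otimes> t n))"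
  proof (rule congruent2I'[OF ])
    fix s s' t t' assume st: "(s, s') \<in> null_rel A p" "(t, t') \<in> null_rel A p"
    then have *: "s \<in> Cau" "s' \<in> Cau" "t \<in> Cau" "t' \<in> Cau"
      by (auto simp: null_rel_def)
    note [simp] = cauchy_carrier[OF *(1)] cauchy_carrier[OF *(2)] cauchy_carrier[OF *(3)] cauchy_carrier[OF *(4)]
    obtain K where K: "K > 0" "\<And>n. p (s' n) \<le> K" using cauchy_bounded[OF *(2)] by auto
    obtain L where L: "L > 0" "\<And>n. p (t n) \<le> L" using cauchy_bounded[OF *(3)] by auto
    have "(\<lambda>n. p ((s n \<otimes> t n) \<ominus> (s' n \<otimes> t' n))) \<longlonglongrightarrow> 0"
    proof (rule tendsto_0_le)
      show "(\<lambda>n. p (s n \<ominus> s' n) * L + K * p (t n \<ominus> t' n)) \<longlonglongrightarrow> 0"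
        using st by (auto simp: null_rel_def intro!: tendsto_add_zero tendsto_mult_left_zero tendsto_mult_right_zero)
      fix n
      have "p ((s n \<otimes> t n) \<ominus> (s' n \<otimes> t' n)) \<le> p ((s n \<ominus> s' n) \<otimes> t n) + p (s' n \<otimes> (t n \<ominus> t' n))"
        using * by (simp add: mult_diff_mult p_add)
      also have "\<dots> \<le> p (s n \<ominus> s' n) * p (t n) + p (s' n) * p (t n \<ominus> t' n)"
        using * by (intro add_mono p_mult) auto
      also have "\<dots> \<le> p (s n \<ominus> s' n) * L + K * p (t n \<ominus> t' n)"
        using * K L by (intro add_mono mult_mono) (auto simp: less_imp_le)
      finally show "p ((s n \<otimes> t n) \<ominus> (s' n \<otimes> t' n)) \<le> p (s n \<ominus> s' n) * L + K * p (t n \<ominus> t' n)" .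
    qed (use * in auto)
    then show "cls (\<lambda>n. s n \<otimes> t n) = cls (\<lambda>n. s' n \<otimes> t' n)"
      using * by (simp add: cls_eq_iff)
  qed
  from UN_equiv_class2[OF equiv_null_rel equiv_null_rel this assms] show ?thesis
    by (simp add: completion_def seq_class_def)
qed

lemma smult_cls:
  assumes "s \<in> Cau"
  shows "c \<odot>\<^bsub>C\<^esub> cls s = cls (\<lambda>n. c \<odot> s n)"
proof -
  have "congruent (null_rel A p) (\<lambda>s. cls (\<lambda>n. c \<odot> s n))"
  proof (rule congruentI)
    fix s t assume st: "(s, t) \<in> null_rel A p"
    then have *: "s \<in> Cau" "t \<in> Cau" by (auto simp: null_rel_def)
    note [simp] = cauchy_carrier[OF *(1)] cauchy_carrier[OF *(2)]
    have "(\<lambda>n. cmod c * p (s n \<ominus> t n)) \<longlonglongrightarrow> 0"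
      using st by (auto simp: null_rel_def intro: tendsto_mult_right_zero)
    then have "(\<lambda>n. p (c \<odot> s n \<ominus> c \<odot> t n)) \<longlonglongrightarrow> 0"
      using * by (simp add: smult_minus[symmetric] p_smult)
    then show "cls (\<lambda>n. c \<odot> s n) = cls (\<lambda>n. c \<odot> t n)"
      using * by (simp add: cls_eq_iff)
  qed
  from UN_equiv_class[OF equiv_null_rel this assms] show ?thesis
    by (simp add: completion_def seq_class_def)
qed

lemma star_cls:
  assumes "s \<in> Cau"
  shows "star C (cls s) = cls (\<lambda>n. star A (s n))"
proof -
  have "congruent (null_rel A p) (\<lambda>s. cls (\<lambda>n. star A (s n)))"
  proof (rule congruentI)
    fix s t assume st: "(s, t) \<in> null_rel A p"
    then have *: "s \<in> Cau" "t \<in> Cau" by (auto simp: null_rel_def)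
    note [simp] = cauchy_carrier[OF *(1)] cauchy_carrier[OF *(2)]
    have "(\<lambda>n. p (star A (s n) \<ominus> star A (t n))) \<longlonglongrightarrow> 0"
      using st * by (simp add: star_minus[symmetric] p_star null_rel_def)
    then show "cls (\<lambda>n. star A (s n)) = cls (\<lambda>n. star A (t n))"
      using * by (simp add: cls_eq_iff)
  qed
  from UN_equiv_class[OF equiv_null_rel this assms] show ?thesis
    by (simp add: completion_def seq_class_def)
qed

lemma zero_C: "\<zero>\<^bsub>C\<^esub> = cls (\<lambda>_. \<zero>)"
  by (simp add: completion_def)

lemma one_C: "\<one>\<^bsub>C\<^esub> = cls (\<lambda>_. \<one>)"
  by (simp add: completion_def)

lemma neg_cauchy [simp]: "s \<in> Cau \<Longrightarrow> (\<lambda>n. \<ominus> s n) \<in> Cau"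
  using smult_cauchy[of s "-1"] by (simp add: smult_minus_one cauchy_carrier[of s])

lemma minus_cauchy [simp]: "\<lbrakk>s \<in> Cau; t \<in> Cau\<rbrakk> \<Longrightarrow> (\<lambda>n. s n \<ominus> t n) \<in> Cau"
  using add_cauchy[of s "\<lambda>n. \<ominus> t n"] by (simp add: minus_eq)

lemma ring_C: "ring C"
proof (intro ringI abelian_groupI monoidI)
  show "\<exists>y\<in>carrier C. y \<oplus>\<^bsub>C\<^esub> x = \<zero>\<^bsub>C\<^esub>" if x: "x \<in> carrier C" for x
  proof -
    obtain s where s: "s \<in> Cau" "x = cls s" using x by (rule carrier_C_E)
    note [simp] = cauchy_carrier[OF s(1)]
    have "cls (\<lambda>n. \<ominus> s n) \<oplus>\<^bsub>C\<^esub> x = \<zero>\<^bsub>C\<^esub>"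
      using s by (simp add: add_cls zero_C l_neg)
    then show ?thesis using s by (metis cls_in_C neg_cauchy)
  qed
qed (auto elim!: carrier_C_E' simp: add_cls mult_cls zero_C one_C a_assoc m_assoc l_distr r_distr,
      auto simp: a_comm)

sublocale C: ring C
  by (rule ring_C)

lemma neg_cls: "s \<in> Cau \<Longrightarrow> \<ominus>\<^bsub>C\<^esub> cls s = cls (\<lambda>n. \<ominus> s n)"
  by (rule C.minus_equality) (auto simp: add_cls zero_C l_neg cauchy_carrier[of s])

lemma minus_cls: "\<lbrakk>s \<in> Cau; t \<in> Cau\<rbrakk> \<Longrightarrow> cls s \<ominus>\<^bsub>C\<^esub> cls t = cls (\<lambda>n. s n \<ominus> t n)"
  by (simp add: C.minus_eq neg_cls add_cls minus_eq)

text \<open>The norm of a class is read off a representative chosen by Hilbert choice; every representative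
gives the same limit.\<close>

lemma nrm_cls:
  assumes "s \<in> Cau"
  shows "(\<lambda>n. p (s n)) \<longlonglongrightarrow> nrm C (cls s)"
proof -
  note [simp] = cauchy_carrier[OF assms]
  define t where "t = (SOME t. t \<in> cls s)"
  have "t \<in> cls s"
    unfolding t_def using cls_self[OF assms] by (rule someI[of "\<lambda>t. t \<in> cls s"])
  then have t: "t \<in> Cau" "(\<lambda>n. p (t n \<ominus> s n)) \<longlonglongrightarrow> 0"
    using in_clsD[of t s] by (auto simp: cls_eq_iff)
  note [simp] = cauchy_carrier[OF t(1)]
  have "Cauchy (\<lambda>n. p (t n))"
  proof (rule metric_CauchyI)
    fix e :: real assume "e > 0"
    then obtain N where N: "\<And>m n. \<lbrakk>m \<ge> N; n \<ge> N\<rbrakk> \<Longrightarrow> p (t m \<ominus> t n) < e"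
      by (rule cauchyD[OF t(1)]) blast
    have "dist (p (t m)) (p (t n)) < e" if "m \<ge> N" "n \<ge> N" for m n
      using N[OF that] p_diff_le[of "t m" "t n"] t(1) by (auto simp: dist_real_def)
    then show "\<exists>M. \<forall>m\<ge>M. \<forall>n\<ge>M. dist (p (t m)) (p (t n)) < e" by blast
  qed
  then have lim: "(\<lambda>n. p (t n)) \<longlonglongrightarrow> nrm C (cls s)"
    by (simp add: completion_def t_def[symmetric] Cauchy_convergent_iff convergent_LIMSEQ_iff)
  have "(\<lambda>n. p (t n) - p (s n)) \<longlonglongrightarrow> 0"
    by (rule Lim_null_comparison[OF _ t(2)]) (use t assms p_diff_le in auto)
  from tendsto_diff[OF lim this] show ?thesis by simp
qed

section \<open>Closures of subalgebras\<close>

text \<open>A class is a limit of elements of \<open>B\<close> exactly if it has a representative with all terms in \<open>B\<close>.\<close>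

definition closure_in_C :: "'a set \<Rightarrow> (nat \<Rightarrow> 'a) set set" where
  "closure_in_C B = cls ` {s \<in> Cau. \<forall>n. s n \<in> B}"

lemma closure_in_C_E:
  assumes "S \<in> closure_in_C B"
  obtains s where "s \<in> Cau" "\<And>n. s n \<in> B" "S = cls s"
  using assms by (auto simp: closure_in_C_def)

lemma closure_in_C_I: "\<lbrakk>s \<in> Cau; \<And>n. s n \<in> B\<rbrakk> \<Longrightarrow> cls s \<in> closure_in_C B"
  by (auto simp: closure_in_C_def)

lemma cauchy_if_null:
  assumes s: "s \<in> Cau" and t: "\<And>n. t n \<in> carrier A" and lim: "(\<lambda>n. p (t n \<ominus> s n)) \<longlonglongrightarrow> 0"
  shows "t \<in> Cau"
proof -
  note [simp] = cauchy_carrier[OF s]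
  have "\<exists>N. \<forall>m\<ge>N. \<forall>n\<ge>N. p (t m \<ominus> t n) < e" if "e > 0" for e
  proof -
    have "e / 3 > 0" using that by simp
    then obtain N1 where N1: "\<And>m n. \<lbrakk>m \<ge> N1; n \<ge> N1\<rbrakk> \<Longrightarrow> p (s m \<ominus> s n) < e / 3"
      by (rule cauchyD[OF s]) blast
    obtain N2 where N2: "\<And>n. n \<ge> N2 \<Longrightarrow> p (t n \<ominus> s n) < e / 3"
      using tendsto_0_D[OF lim \<open>e / 3 > 0\<close>] by blast
    have "p (t m \<ominus> t n) < e" if "m \<ge> max N1 N2" "n \<ge> max N1 N2" for m n
      using p_triangle[of "t m" "s m" "t n"] p_triangle[of "s m" "s n" "t n"] N1[of m n] N2[of m] N2[of n]
        p_minus_commute[of "s n" "t n"] that s t by auto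
    then show ?thesis by blast
  qed
  then show ?thesis using t by (auto simp: cauchy_seqs_def)
qed

text \<open>The algebraic closure conditions hold for representatives term by term. That the set is closed
under limits is a diagonal argument.\<close>

lemma cstar_subalgebra_closure:
  assumes B: "B \<subseteq> carrier A" "\<zero> \<in> B"
    and "\<And>a b. \<lbrakk>a \<in> B; b \<in> B\<rbrakk> \<Longrightarrow> a \<oplus> b \<in> B"
    and "\<And>c a. a \<in> B \<Longrightarrow> c \<odot> a \<in> B"
    and "\<And>a b. \<lbrakk>a \<in> B; b \<in> B\<rbrakk> \<Longrightarrow> a \<otimes> b \<in> B"
    and "\<And>a. a \<in> B \<Longrightarrow> star A a \<in> B"
  shows "cstar_subalgebra C (closure_in_C B)"
  unfolding cstar_subalgebra_def
proof (intro conjI allI ballI impI)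
  show "closure_in_C B \<subseteq> carrier C"
    by (auto elim: closure_in_C_E)
  show "\<zero>\<^bsub>C\<^esub> \<in> closure_in_C B"
    unfolding zero_C by (rule closure_in_C_I) (use B in auto)
next
  fix S T assume S: "S \<in> closure_in_C B" and T: "T \<in> closure_in_C B"
  obtain s where s: "s \<in> Cau" "\<And>n. s n \<in> B" "S = cls s" using S by (rule closure_in_C_E) blast
  note [simp] = cauchy_carrier[OF s(1)]
  obtain t where t: "t \<in> Cau" "\<And>n. t n \<in> B" "T = cls t" using T by (rule closure_in_C_E) blast
  note [simp] = cauchy_carrier[OF t(1)]
  show "S \<oplus>\<^bsub>C\<^esub> T \<in> closure_in_C B"
    using s t assms by (auto simp: add_cls intro!: closure_in_C_I)
  show "S \<otimes>\<^bsub>C\<^esub> T \<in> closure_in_C B"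
    using s t assms by (auto simp: mult_cls intro!: closure_in_C_I)
next
  fix S and c :: complex assume S: "S \<in> closure_in_C B"
  obtain s where s: "s \<in> Cau" "\<And>n. s n \<in> B" "S = cls s" using S by (rule closure_in_C_E) blast
  note [simp] = cauchy_carrier[OF s(1)]
  show "c \<odot>\<^bsub>C\<^esub> S \<in> closure_in_C B"
    using s assms by (auto simp: smult_cls intro!: closure_in_C_I)
next
  fix S assume S: "S \<in> closure_in_C B"
  obtain s where s: "s \<in> Cau" "\<And>n. s n \<in> B" "S = cls s" using S by (rule closure_in_C_E) blast
  note [simp] = cauchy_carrier[OF s(1)]
  show "star C S \<in> closure_in_C B"
    using s assms by (auto simp: star_cls intro!: closure_in_C_I)
next
  fix S U assume "(\<forall>n::nat. S n \<in> closure_in_C B) \<and> U \<in> carrier C \<and> (\<lambda>n. nrm C (S n \<ominus>\<^bsub>C\<^esub> U)) \<longlonglongrightarrow> 0"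
  then have S: "\<And>n. S n \<in> closure_in_C B" and U: "U \<in> carrier C"
    and lim: "(\<lambda>n. nrm C (S n \<ominus>\<^bsub>C\<^esub> U)) \<longlonglongrightarrow> 0"
    by auto
  obtain u where u: "u \<in> Cau" "U = cls u" using U by (rule carrier_C_E)
  note [simp] = cauchy_carrier[OF u(1)]
  have "\<exists>b\<in>B. \<exists>m\<ge>j. p (b \<ominus> u m) < 1 / real (Suc j)" for j
  proof -
    obtain k where k: "nrm C (S k \<ominus>\<^bsub>C\<^esub> U) < 1 / real (Suc j)"
      using tendsto_0_D[OF lim, of "1 / real (Suc j)"] by auto
    obtain s where s: "s \<in> Cau" "\<And>n. s n \<in> B" "S k = cls s" using S by (rule closure_in_C_E) blast
    note [simp] = cauchy_carrier[OF s(1)]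
    have "(\<lambda>n. p (s n \<ominus> u n)) \<longlonglongrightarrow> nrm C (S k \<ominus>\<^bsub>C\<^esub> U)"
      using nrm_cls[of "\<lambda>n. s n \<ominus> u n"] s u by (simp add: minus_cls)
    from order_tendstoD(2)[OF this k] obtain N where "\<And>n. n \<ge> N \<Longrightarrow> p (s n \<ominus> u n) < 1 / real (Suc j)"
      by (auto simp: eventually_sequentially)
    then show ?thesis using s(2) by (meson max.cobounded1 max.cobounded2)
  qed
  \<comment> \<open>\<open>b j\<close> approximates a late term of \<open>u\<close>, hence also \<open>u j\<close> because \<open>u\<close> is Cauchy\<close>
  then obtain b m where b: "\<And>j. b j \<in> B" "\<And>j. m j \<ge> j" "\<And>j. p (b j \<ominus> u (m j)) < 1 / real (Suc j)"
    by metis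
  have um: "(\<lambda>j. p (u (m j) \<ominus> u j)) \<longlonglongrightarrow> 0"
  proof (rule LIMSEQ_I)
    fix e :: real assume "e > 0"
    then obtain N where N: "\<And>m n. \<lbrakk>m \<ge> N; n \<ge> N\<rbrakk> \<Longrightarrow> p (u m \<ominus> u n) < e"
      by (rule cauchyD[OF u(1)]) blast
    have "norm (p (u (m j) \<ominus> u j) - 0) < e" if "j \<ge> N" for j
      using N[of "m j" j] that b(2)[of j] u by auto
    then show "\<exists>N. \<forall>n\<ge>N. norm (p (u (m n) \<ominus> u n) - 0) < e" by blast
  qed
  have bA: "b j \<in> carrier A" for j using b B by auto
  have bu: "(\<lambda>j. p (b j \<ominus> u j)) \<longlonglongrightarrow> 0"
  proof (rule tendsto_0_le)
    show "(\<lambda>j. 1 / real (Suc j) + p (u (m j) \<ominus> u j)) \<longlonglongrightarrow> 0"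
      by (intro tendsto_add_zero um) (rule LIMSEQ_Suc[OF lim_1_over_n])
    show "p (b j \<ominus> u j) \<le> 1 / real (Suc j) + p (u (m j) \<ominus> u j)" for j
      using p_triangle[of "b j" "u (m j)" "u j"] b(3)[of j] bA u by simp
  qed (use bA u in auto)
  have bC: "b \<in> Cau"
    by (rule cauchy_if_null[OF u(1) bA bu])
  then have "U = cls b"
    using bu u by (simp add: cls_eq_iff[symmetric])
  then show "U \<in> closure_in_C B"
    using closure_in_C_I[OF bC] b by auto
qed

section \<open>Ideals from smaller C*-seminorms\<close>

text \<open>A C*-seminorm \<open>q \<le> p\<close> extends to the completion; \<open>I\<close> is the kernel of the extension. It stands
for the kernel of a representation.\<close>

lemma kernel_ideal:
  assumes q: "cstar_seminorm A q" and le: "\<And>a. a \<in> carrier A \<Longrightarrow> q a \<le> p a"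
  defines "I \<equiv> cls ` {s \<in> Cau. (\<lambda>n. q (s n)) \<longlonglongrightarrow> 0}"
  shows "ideal I C" and "a \<in> carrier A \<Longrightarrow> cls (\<lambda>_. a) \<in> I \<longleftrightarrow> q a = 0"
proof -
  interpret q: cstar_seminormed_ring A q
    by unfold_locales (use q smult_minus smult_minus_one star_minus in auto)
  show "ideal I C"
  proof (rule idealI[OF ring_C])
    show "subgroup I (add_monoid C)"
    proof (rule C.add.subgroupI)
      show "I \<subseteq> carrier C" by (auto simp: I_def)
      have "cls (\<lambda>_. \<zero>) \<in> I" by (auto simp: I_def)
      then show "I \<noteq> {}" by auto
      fix x assume "x \<in> I"
      then obtain s where s: "s \<in> Cau" "(\<lambda>n. q (s n)) \<longlonglongrightarrow> 0" "x = cls s" by (auto simp: I_def)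
      note [simp] = cauchy_carrier[OF s(1)]
      from s have "(\<lambda>n. q (\<ominus> s n)) \<longlonglongrightarrow> 0" by (simp add: q.p_neg)
      then show "\<ominus>\<^bsub>C\<^esub> x \<in> I" using s by (auto simp: I_def neg_cls)
      fix y assume "y \<in> I"
      then obtain t where t: "t \<in> Cau" "(\<lambda>n. q (t n)) \<longlonglongrightarrow> 0" "y = cls t" by (auto simp: I_def)
      note [simp] = cauchy_carrier[OF t(1)]
      have "(\<lambda>n. q (s n \<oplus> t n)) \<longlonglongrightarrow> 0"
        by (rule tendsto_0_le[OF tendsto_add_zero[OF s(2) t(2)]]) (use s t q.p_add in auto)
      then show "x \<oplus>\<^bsub>C\<^esub> y \<in> I" using s t by (auto simp: I_def add_cls)
    qed
  next
    fix x y assume "x \<in> I" "y \<in> carrier C"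
    then obtain s where s: "s \<in> Cau" "(\<lambda>n. q (s n)) \<longlonglongrightarrow> 0" "x = cls s" by (auto simp: I_def)
    note [simp] = cauchy_carrier[OF s(1)]
    obtain t where t: "t \<in> Cau" "y = cls t" using \<open>y \<in> carrier C\<close> by (rule carrier_C_E)
    note [simp] = cauchy_carrier[OF t(1)]
    obtain K where K: "K > 0" "\<And>n. p (t n) \<le> K" using cauchy_bounded[OF t(1)] by auto
    have qK: "q (t n) \<le> K" for n using le[of "t n"] K(2)[of n] t by auto
    have "(\<lambda>n. q (t n \<otimes> s n)) \<longlonglongrightarrow> 0"
    proof (rule tendsto_0_le[OF tendsto_mult_right_zero[OF s(2), of K]])
      fix n
      have "q (t n \<otimes> s n) \<le> q (t n) * q (s n)" using s t by (simp add: q.p_mult)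
      also have "\<dots> \<le> K * q (s n)" using s qK by (intro mult_right_mono) auto
      finally show "q (t n \<otimes> s n) \<le> K * q (s n)" .
    qed (use s t in auto)
    then show "y \<otimes>\<^bsub>C\<^esub> x \<in> I" using s t by (auto simp: I_def mult_cls)
    have "(\<lambda>n. q (s n \<otimes> t n)) \<longlonglongrightarrow> 0"
    proof (rule tendsto_0_le[OF tendsto_mult_left_zero[OF s(2), of K]])
      fix n
      have "q (s n \<otimes> t n) \<le> q (s n) * q (t n)" using s t by (simp add: q.p_mult)
      also have "\<dots> \<le> q (s n) * K" using s qK by (intro mult_left_mono) auto
      finally show "q (s n \<otimes> t n) \<le> q (s n) * K" .
    qed (use s t in auto)
    then show "x \<otimes>\<^bsub>C\<^esub> y \<in> I" using s t by (auto simp: I_def mult_cls)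
  qed
  assume a: "a \<in> carrier A"
  show "cls (\<lambda>_. a) \<in> I \<longleftrightarrow> q a = 0"
  proof
    assume "cls (\<lambda>_. a) \<in> I"
    then obtain s where s: "s \<in> Cau" "(\<lambda>n. q (s n)) \<longlonglongrightarrow> 0" "cls (\<lambda>_. a) = cls s" by (auto simp: I_def)
    note [simp] = cauchy_carrier[OF s(1)]
    have "(\<lambda>n. p (a \<ominus> s n)) \<longlonglongrightarrow> 0" using a s by (simp add: cls_eq_iff)
    from tendsto_add_zero[OF this s(2)] have "(\<lambda>n. q a) \<longlonglongrightarrow> 0"
    proof (rule tendsto_0_le)
      show "q a \<le> p (a \<ominus> s n) + q (s n)" for n
        using q.p_diff_le[of a "s n"] le[of "a \<ominus> s n"] a s by auto
    qed (use a in auto)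
    then show "q a = 0" by (simp add: LIMSEQ_const_iff)
  qed (use a in \<open>auto simp: I_def\<close>)
qed

section \<open>Neumann series\<close>

text \<open>The partial sums \<open>1 + x + \<dots> + x\<^bsup>n-1\<^esup>\<close> of the Neumann series of \<open>1 - x\<close>.\<close>

primrec geom_sum :: "'a \<Rightarrow> nat \<Rightarrow> 'a" where
  "geom_sum x 0 = \<zero>"
| "geom_sum x (Suc n) = geom_sum x n \<otimes> x \<oplus> \<one>"

lemma geom_sum_closed [simp]: "x \<in> carrier A \<Longrightarrow> geom_sum x n \<in> carrier A"
  by (induction n) auto

lemma geom_sum_left:
  assumes x: "x \<in> carrier A"
  shows "(\<one> \<ominus> x) \<otimes> geom_sum x n = \<one> \<ominus> x [^] n"
proof (induction n)
  case 0
  then show ?case using x by (simp add: minus_eq r_neg)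
next
  case (Suc n)
  have "(\<one> \<ominus> x) \<otimes> geom_sum x (Suc n) = ((\<one> \<ominus> x) \<otimes> geom_sum x n) \<otimes> x \<oplus> (\<one> \<ominus> x)"
    using x by (simp add: r_distr m_assoc)
  also have "\<dots> = \<one> \<ominus> x [^] Suc n"
    using x by (simp only: Suc) (simp add: minus_eq l_distr l_minus a_ac, simp add: a_assoc[symmetric] l_neg r_neg a_comm)
  finally show ?case .
qed

lemma geom_sum_right:
  assumes x: "x \<in> carrier A"
  shows "geom_sum x n \<otimes> (\<one> \<ominus> x) = \<one> \<ominus> x [^] n"
proof (induction n)
  case 0
  then show ?case using x by (simp add: minus_eq r_neg)
next
  case (Suc n)
  have "x \<otimes> (\<one> \<ominus> x) = (\<one> \<ominus> x) \<otimes> x"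
    using x by (simp add: minus_eq l_distr r_distr l_minus r_minus)
  then have "geom_sum x (Suc n) \<otimes> (\<one> \<ominus> x) = (geom_sum x n \<otimes> (\<one> \<ominus> x)) \<otimes> x \<oplus> (\<one> \<ominus> x)"
    using x by (simp add: l_distr m_assoc)
  also have "\<dots> = \<one> \<ominus> x [^] Suc n"
    using x by (simp only: Suc) (simp add: minus_eq l_distr l_minus a_ac, simp add: a_assoc[symmetric] l_neg r_neg a_comm)
  finally show ?case .
qed

lemma p_pow_le: "x \<in> carrier A \<Longrightarrow> p x \<le> r \<Longrightarrow> p (x [^] (n::nat)) \<le> r ^ n"
proof (induction n)
  case 0
  then show ?case by (simp add: p_one_le)
next
  case (Suc n)
  have "p (x [^] Suc n) \<le> p (x [^] n) * p x" using Suc by (simp add: p_mult)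
  also have "\<dots> \<le> r ^ n * r"
    using Suc order_trans[OF p_nonneg, of x r] by (intro mult_mono) auto
  finally show ?case by (simp add: mult.commute)
qed

lemma p_geom_sum_le:
  assumes "x \<in> carrier A" "p x \<le> r" "r < 1"
  shows "p (geom_sum x n) \<le> 1 / (1 - r)"
proof (induction n)
  case 0
  then show ?case using assms by simp
next
  case (Suc n)
  have "p (geom_sum x (Suc n)) \<le> p (geom_sum x n \<otimes> x) + p \<one>"
    using assms by (simp add: p_add)
  also have "\<dots> \<le> p (geom_sum x n) * p x + 1"
    using assms by (intro add_mono p_mult p_one_le) auto
  also have "\<dots> \<le> 1 / (1 - r) * r + 1"
    using assms Suc by (intro add_mono mult_mono) auto
  also have "\<dots> = 1 / (1 - r)" using assms by (simp add: field_simps)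
  finally show ?case .
qed

text \<open>Inverting an element of the completion at distance less than 1 from the unit. Each term \<open>s n\<close> need
not be invertible in \<open>A\<close>, but the Neumann series of \<open>s n\<close> truncated after \<open>n\<close> terms inverts it up to
an error \<open>r\<^sup>n\<close>, and these approximate inverses form a Cauchy sequence.\<close>

lemma right_inverse_near_one:
  assumes s: "s \<in> Cau" and near: "\<And>n. n \<ge> J \<Longrightarrow> p (\<one> \<ominus> s n) \<le> r" and r: "r < 1"
  obtains t where "t \<in> Cau" "cls s \<otimes>\<^bsub>C\<^esub> cls t = \<one>\<^bsub>C\<^esub>"
proof -
  note [simp] = cauchy_carrier[OF s]
  define x where "x n = \<one> \<ominus> s n" for n
  have x [simp]: "x n \<in> carrier A" for n using s by (simp add: x_def)
  have sx: "s n = \<one> \<ominus> x n" for n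
    using s by (simp add: x_def minus_eq minus_add a_assoc[symmetric] r_neg)
  have r0: "0 \<le> r" using near[of J] order_trans[OF p_nonneg, of "\<one> \<ominus> s J" r] s by auto
  define t where "t n = geom_sum (x n) n" for n
  have t [simp]: "t n \<in> carrier A" for n by (simp add: t_def)
  define K where "K = 1 / (1 - r)"
  have K: "K > 0" using r by (simp add: K_def)
  have tK: "p (t n) \<le> K" if "n \<ge> J" for n
    unfolding t_def K_def by (rule p_geom_sum_le) (use near that r in \<open>auto simp: x_def s\<close>)
  have xr: "p (x n [^] n) \<le> r ^ n" if "n \<ge> J" for n
    using near that by (intro p_pow_le) (auto simp: x_def s)
  have st: "s n \<otimes> t n = \<one> \<ominus> x n [^] n" and ts: "t n \<otimes> s n = \<one> \<ominus> x n [^] n" for n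
    unfolding sx t_def using geom_sum_left geom_sum_right by auto
  have rlim: "(\<lambda>n. r ^ n) \<longlonglongrightarrow> 0" using r r0 by (intro LIMSEQ_realpow_zero) auto
  have "\<exists>N. \<forall>m\<ge>N. \<forall>n\<ge>N. p (t m \<ominus> t n) < e" if e: "e > 0" for e
  proof -
    have "e / (3 * K * K) > 0" using e K by simp
    then obtain N1 where N1: "\<And>m n. \<lbrakk>m \<ge> N1; n \<ge> N1\<rbrakk> \<Longrightarrow> p (s m \<ominus> s n) < e / (3 * K * K)"
      by (rule cauchyD[OF s]) blast
    have "e / (3 * K) > 0" using e K by simp
    then obtain N2 where N2: "\<And>n. n \<ge> N2 \<Longrightarrow> r ^ n < e / (3 * K)"
      using tendsto_0_D[OF rlim] by blast
    have "p (t m \<ominus> t n) < e" if mn: "m \<ge> max J (max N1 N2)" "n \<ge> max J (max N1 N2)" for m n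
    proof -
      have "s n \<otimes> t n \<oplus> x n [^] n = \<one>" "t m \<otimes> s m \<oplus> x m [^] m = \<one>"
        unfolding st ts by (simp_all add: minus_eq a_assoc l_neg)
      \<comment> \<open>inverses satisfy \<open>t m - t n = t m (s n - s m) t n\<close>; here up to the errors \<open>x n [^] n\<close>\<close>
      then have "t m \<ominus> t n = t m \<otimes> (s n \<otimes> t n \<oplus> x n [^] n) \<ominus> (t m \<otimes> s m \<oplus> x m [^] m) \<otimes> t n"
        by simp
      also have "\<dots> = (t m \<otimes> (s n \<ominus> s m)) \<otimes> t n \<oplus> (t m \<otimes> x n [^] n \<ominus> x m [^] m \<otimes> t n)"
        using s by (simp add: l_distr r_distr minus_eq minus_add l_minus r_minus m_assoc a_ac)
      finally have "p (t m \<ominus> t n) \<le> p ((t m \<otimes> (s n \<ominus> s m)) \<otimes> t n) + (p (t m \<otimes> x n [^] n) + p (x m [^] m \<otimes> t n))"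
        using s by (auto intro!: order_trans[OF p_add] p_minus_le)
      also have "\<dots> \<le> (p (t m) * p (s n \<ominus> s m)) * p (t n) + (p (t m) * p (x n [^] n) + p (x m [^] m) * p (t n))"
        using s by (intro add_mono p_mult order_trans[OF p_mult] mult_right_mono) auto
      also have "\<dots> \<le> (K * p (s n \<ominus> s m)) * K + (K * r ^ n + r ^ m * K)"
        using s mn tK xr K r0 by (intro add_mono mult_mono) auto
      also have "\<dots> < (K * (e / (3 * K * K))) * K + (K * (e / (3 * K)) + (e / (3 * K)) * K)"
        using mn N1[of n m] N2[of m] N2[of n] K
        by (intro add_strict_mono mult_strict_right_mono mult_strict_left_mono) auto
      also have "\<dots> = e" using K by (simp add: field_simps)
      finally show ?thesis .
    qed
    then show ?thesis by blast
  qed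
  then have tC: "t \<in> Cau" by (auto simp: cauchy_seqs_def)
  have "(\<lambda>n. p (s n \<otimes> t n \<ominus> \<one>)) \<longlonglongrightarrow> 0"
  proof (rule tendsto_sandwich[OF _ _ tendsto_const rlim])
    show "\<forall>\<^sub>F n in sequentially. 0 \<le> p (s n \<otimes> t n \<ominus> \<one>)" using s by simp
    have "p (s n \<otimes> t n \<ominus> \<one>) \<le> r ^ n" if "n \<ge> J" for n
    proof -
      have "p (s n \<otimes> t n \<ominus> \<one>) = p (\<ominus> (x n [^] n))"
        unfolding st by (simp add: minus_eq a_ac r_neg)
          (simp add: a_assoc[symmetric] r_neg l_neg)
      then show ?thesis using xr[OF that] by (simp add: p_neg)
    qed
    then show "\<forall>\<^sub>F n in sequentially. p (s n \<otimes> t n \<ominus> \<one>) \<le> r ^ n"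
      by (auto simp: eventually_sequentially)
  qed
  then have "cls s \<otimes>\<^bsub>C\<^esub> cls t = \<one>\<^bsub>C\<^esub>"
    using s tC by (simp add: mult_cls one_C cls_eq_iff)
  then show ?thesis using that tC by blast
qed

end

section \<open>The Fejer kernel over roots of unity\<close>

text \<open>The bound on \<open>n\<close> excludes the nonzero multiples of \<open>m\<close>.\<close>

lemma sum_roots_of_unity:
  fixes n :: int and m :: nat
  assumes "\<bar>n\<bar> < int m"
  shows "(\<Sum>j<m. cis (2 * pi * real j / real m * of_int n)) = (if n = 0 then of_nat m else 0)"
proof (cases "n = 0")
  case False
  have m: "m > 0" using assms by linarith
  define z where "z = cis (2 * pi * of_int n / real m)"
  have "z \<noteq> 1"
  proof
    assume "z = 1"
    then have "cos (2 * pi * of_int n / real m) = 1" by (simp add: z_def complex_eq_iff)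
    then obtain k :: int where "2 * pi * of_int n / real m = of_int k * 2 * pi"
      using cos_one_2pi_int by blast
    then have "real_of_int n = of_int (k * int m)" using m by (simp add: field_simps)
    then have "n = k * int m" by linarith
    then have "\<bar>n\<bar> = \<bar>k\<bar> * int m" by (simp add: abs_mult)
    moreover have "1 * int m \<le> \<bar>k\<bar> * int m" using False \<open>n = k * int m\<close> by (intro mult_right_mono) auto
    ultimately show False using assms by simp
  qed
  have zj: "cis (2 * pi * real j / real m * of_int n) = z ^ j" for j
    by (simp add: z_def Complex.DeMoivre mult_ac)
  have "z ^ m = 1"
    using m cis_multiple_2pi[of "of_int n"] by (simp add: z_def Complex.DeMoivre)
  then have "(\<Sum>j<m. z ^ j) = 0" using \<open>z \<noteq> 1\<close> by (simp add: geometric_sum)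
  then show ?thesis using False by (simp only: zj if_False)
qed simp

text \<open>The Fejer weight \<open>max 0 (1 - \<bar>n\<bar> / N)\<close>; the subtraction of naturals performs the truncation at 0.\<close>

definition fejer :: "nat \<Rightarrow> int \<Rightarrow> real" where
  "fejer N n = real (N - nat \<bar>n\<bar>) / real N"

text \<open>There are \<open>N - \<bar>n\<bar>\<close> ways to write \<open>n\<close> as a difference \<open>l - k\<close> of numbers below \<open>N\<close>: this is where the
Fejer weights come from.\<close>

lemma card_shift_pairs:
  fixes n :: int
  shows "(\<Sum>k<N. \<Sum>l<N. if int k - int l + n = 0 then 1 else 0 :: complex) = of_nat (N - nat \<bar>n\<bar>)"
proof -
  have "(\<Sum>l<N. if int k - int l + n = 0 then 1 else 0 :: complex) = (if 0 \<le> int k + n \<and> int k + n < int N then 1 else 0)" for k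
  proof (cases "0 \<le> int k + n \<and> int k + n < int N")
    case True
    have "(\<Sum>l<N. if int k - int l + n = 0 then 1 else 0 :: complex) = (\<Sum>l<N. if nat (int k + n) = l then 1 else 0)"
      using True by (intro sum.cong) auto
    also have "\<dots> = 1" using True by (auto simp: nat_less_iff)
    finally show ?thesis using True by simp
  next
    case False
    then show ?thesis by (auto intro!: sum.neutral)
  qed
  then have "(\<Sum>k<N. \<Sum>l<N. if int k - int l + n = 0 then 1 else 0 :: complex)
      = of_nat (card {k \<in> {..<N}. 0 \<le> int k + n \<and> int k + n < int N})"
    by (simp only: sum.inter_filter[symmetric] finite_lessThan sum_constant mult_1_right)
  also have "card {k \<in> {..<N}. 0 \<le> int k + n \<and> int k + n < int N} = N - nat \<bar>n\<bar>"
  proof (cases "n \<ge> 0")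
    case True
    then have "{k \<in> {..<N}. 0 \<le> int k + n \<and> int k + n < int N} = {..<N - nat \<bar>n\<bar>}" by auto
    then show ?thesis by simp
  next
    case False
    then have "{k \<in> {..<N}. 0 \<le> int k + n \<and> int k + n < int N} = {nat \<bar>n\<bar>..<N}" by auto
    then show ?thesis by simp
  qed
  finally show ?thesis .
qed

text \<open>Expanding the square of the Dirichlet sum gives the characters at \<open>k - l + n\<close>. For \<open>m\<close> larger than
\<open>2 N + \<bar>n\<bar>\<close> none of these wraps around modulo \<open>m\<close>, so the average over the \<open>m\<close>-th roots of unity
counts the pairs with \<open>k - l + n = 0\<close>. The coefficients of this average are nonnegative, which is
what makes the Fejer means contractive.\<close>

lemma fejer_as_average:
  fixes n :: int and m N :: nat
  assumes N: "N > 0" and m: "2 * int N + \<bar>n\<bar> < int m"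
  defines "\<theta> \<equiv> \<lambda>j. 2 * pi * real j / real m"
  shows "(\<Sum>j<m. complex_of_real ((cmod (\<Sum>k<N. cis (\<theta> j * real k)))\<^sup>2 / (real m * real N)) * cis (\<theta> j * of_int n))
    = complex_of_real (fejer N n)"
proof -
  have m0: "m > 0" using m N by linarith
  have D: "complex_of_real ((cmod (\<Sum>k<N. cis (\<theta> j * real k)))\<^sup>2) * cis (\<theta> j * of_int n)
      = (\<Sum>k<N. \<Sum>l<N. cis (\<theta> j * of_int (int k - int l + n)))" for j
    by (simp only: complex_norm_square cnj_sum sum_product)
      (simp only: sum_distrib_right, intro sum.cong refl, simp add: cis_cnj cis_mult algebra_simps)
  have "(\<Sum>j<m. complex_of_real ((cmod (\<Sum>k<N. cis (\<theta> j * real k)))\<^sup>2 / (real m * real N)) * cis (\<theta> j * of_int n))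
      = (\<Sum>j<m. complex_of_real ((cmod (\<Sum>k<N. cis (\<theta> j * real k)))\<^sup>2) * cis (\<theta> j * of_int n)) / (of_nat m * of_nat N)"
    by (simp add: sum_divide_distrib)
  also have "(\<Sum>j<m. complex_of_real ((cmod (\<Sum>k<N. cis (\<theta> j * real k)))\<^sup>2) * cis (\<theta> j * of_int n))
      = (\<Sum>k<N. \<Sum>l<N. \<Sum>j<m. cis (\<theta> j * of_int (int k - int l + n)))"
    unfolding D by (subst sum.swap) (intro sum.cong refl sum.swap)
  also have "\<dots> = (\<Sum>k<N. \<Sum>l<N. of_nat m * (if int k - int l + n = 0 then 1 else 0))"
  proof (intro sum.cong refl)
    fix k l assume "k \<in> {..<N}" "l \<in> {..<N}"
    then have "\<bar>int k - int l + n\<bar> < int m" using m by auto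
    from sum_roots_of_unity[OF this]
    show "(\<Sum>j<m. cis (\<theta> j * of_int (int k - int l + n))) = of_nat m * (if int k - int l + n = 0 then 1 else 0)"
      by (simp add: \<theta>_def)
  qed
  also have "\<dots> = of_nat m * of_nat (N - nat \<bar>n\<bar>)"
    unfolding sum_distrib_left[symmetric] card_shift_pairs ..
  finally show ?thesis using m0 N by (simp add: fejer_def)
qed

lemma fejer_zero: "int N \<le> \<bar>n\<bar> \<Longrightarrow> fejer N n = 0"
  by (simp add: fejer_def)

lemma fejer_0: "N > 0 \<Longrightarrow> fejer N 0 = 1"
  by (simp add: fejer_def)

lemma fejer_le_1: "0 \<le> fejer N n \<and> fejer N n \<le> 1"
  by (cases "N = 0") (auto simp: fejer_def divide_simps)

lemma fejer_tendsto: "(\<lambda>N. fejer N n) \<longlonglongrightarrow> 1"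
proof -
  have "(\<lambda>N. 1 - real (nat \<bar>n\<bar>) * (1 / real N)) \<longlonglongrightarrow> 1 - real (nat \<bar>n\<bar>) * 0"
    by (intro tendsto_intros lim_1_over_n)
  moreover have "\<forall>\<^sub>F N in sequentially. 1 - real (nat \<bar>n\<bar>) * (1 / real N) = fejer N n"
    using eventually_gt_at_top[of "nat \<bar>n\<bar>"]
    by eventually_elim (auto simp: fejer_def of_nat_diff field_simps)
  ultimately show ?thesis by (auto intro: Lim_transform_eventually)
qed

section \<open>The action of the integers\<close>

locale dynamical_system =
  fixes X :: "'x topology" and \<sigma> :: "'x \<Rightarrow> 'x"
  assumes sys: "top_dyn_sys X \<sigma>"
begin

abbreviation "S \<equiv> topspace X"
abbreviation "\<tau> \<equiv> int_iterate X \<sigma>"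
abbreviation "A \<equiv> algebraic_crossed_product X \<sigma>"
abbreviation "supp a \<equiv> {k::int. a k \<noteq> (\<lambda>_::'x. 0::complex)}"

lemma compact_X: "compact_space X" and Hausdorff_X: "Hausdorff_space X"
  and homeo: "homeomorphic_map X X \<sigma>"
  using sys by (auto simp: top_dyn_sys_def)

lemma normal_X: "normal_space X"
  using compact_X Hausdorff_X compact_Hausdorff_or_regular_imp_normal_space by blast

lemma \<sigma>_inj: "inj_on \<sigma> S" and \<sigma>_surj: "\<sigma> ` S = S"
  using homeo by (auto simp: homeomorphic_eq_everything_map)

abbreviation "\<sigma>i \<equiv> inv_into S \<sigma>"

lemma \<sigma>_in: "x \<in> S \<Longrightarrow> \<sigma> x \<in> S" and \<sigma>i_in: "x \<in> S \<Longrightarrow> \<sigma>i x \<in> S"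
  and \<sigma>_\<sigma>i: "x \<in> S \<Longrightarrow> \<sigma> (\<sigma>i x) = x" and \<sigma>i_\<sigma>: "x \<in> S \<Longrightarrow> \<sigma>i (\<sigma> x) = x"
  using \<sigma>_inj \<sigma>_surj by (auto simp: f_inv_into_f inv_into_into)

lemma \<tau>_in [simp]: "x \<in> S \<Longrightarrow> \<tau> n x \<in> S"
proof -
  have "(f ^^ k) x \<in> S" if "x \<in> S" "\<And>y. y \<in> S \<Longrightarrow> f y \<in> S" for f k
    using that by (induction k) auto
  then show "x \<in> S \<Longrightarrow> \<tau> n x \<in> S"
    using \<sigma>_in \<sigma>i_in by (simp add: int_iterate_def)
qed

lemma \<tau>_0 [simp]: "\<tau> 0 x = x"
  by (simp add: int_iterate_def)

lemma \<tau>_succ: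
  assumes x: "x \<in> S"
  shows "\<tau> (n + 1) x = \<sigma> (\<tau> n x)"
proof (cases "n \<ge> 0")
  case True
  then show ?thesis by (simp add: int_iterate_def nat_add_distrib)
next
  case False
  define m where "m = nat (- n - 1)"
  have n: "n = - int (Suc m)" using False by (simp add: m_def)
  have m: "(\<sigma>i ^^ m) x \<in> S" using x \<sigma>i_in by (induction m) auto
  have "\<tau> (n + 1) x = (\<sigma>i ^^ m) x"
    by (cases "m = 0") (simp_all add: n int_iterate_def)
  moreover have "\<sigma> (\<tau> n x) = (\<sigma>i ^^ m) x"
    using \<sigma>_\<sigma>i[OF m] by (simp add: n int_iterate_def nat_add_distrib)
  ultimately show ?thesis by simp
qed

lemma \<tau>_add:
  assumes x: "x \<in> S"
  shows "\<tau> m (\<tau> n x) = \<tau> (m + n) x"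
proof (induction m rule: int_induct[of _ 0])
  case base
  then show ?case by simp
next
  case (step1 i)
  have "\<tau> (i + 1) (\<tau> n x) = \<sigma> (\<tau> (i + n) x)"
    using x step1 by (simp add: \<tau>_succ)
  also have "\<dots> = \<tau> (i + 1 + n) x"
    using \<tau>_succ[OF x, of "i + n"] by (simp add: add_ac)
  finally show ?case .
next
  case (step2 i)
  have "\<sigma> (\<tau> (i - 1) (\<tau> n x)) = \<sigma> (\<tau> (i - 1 + n) x)"
    using x step2 \<tau>_succ[of "\<tau> n x" "i - 1"] \<tau>_succ[OF x, of "i - 1 + n"] by (simp add: algebra_simps)
  then show ?case
    using \<sigma>_inj x by (auto dest!: inj_onD)
qed

lemma \<tau>_cancel [simp]: "x \<in> S \<Longrightarrow> \<tau> (- n) (\<tau> n x) = x" "x \<in> S \<Longrightarrow> \<tau> n (\<tau> (- n) x) = x"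
  by (simp_all add: \<tau>_add)

lemma \<tau>_fixed_neg: "x \<in> S \<Longrightarrow> \<tau> (- n) x = x \<longleftrightarrow> \<tau> n x = x"
  by (metis \<tau>_cancel)

lemma \<tau>_continuous: "continuous_map X X (\<tau> n)"
proof -
  have "continuous_map X X (f ^^ k)" if "continuous_map X X f" for f and k :: nat
  proof (induction k)
    case (Suc k)
    then show ?case using continuous_map_compose[OF Suc that] by (simp add: o_def)
  qed simp
  moreover have "continuous_map X X \<sigma>i"
  proof -
    obtain g where g: "homeomorphic_maps X X \<sigma> g"
      using homeo homeomorphic_map_maps by blast
    have "g x = \<sigma>i x" if "x \<in> S" for x
      using g that \<sigma>_\<sigma>i[OF that] \<sigma>i_in[OF that] unfolding homeomorphic_maps_def by metis
    then show ?thesis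
      using g unfolding homeomorphic_maps_def by (meson continuous_map_eq)
  qed
  moreover have "continuous_map X X \<sigma>"
    using homeo homeomorphic_imp_continuous_map by blast
  ultimately show ?thesis by (simp add: int_iterate_def)
qed

text \<open>Non-periodicity speaks of positive powers only; a fixed point of a negative power is a fixed point
of the inverse power.\<close>

lemma \<tau>_nonperiodic:
  assumes "x \<in> non_periodic_points X \<sigma>" "n \<noteq> 0"
  shows "\<tau> n x \<noteq> x"
proof -
  have x: "x \<in> S" and np: "\<And>k. k > 0 \<Longrightarrow> \<tau> (int k) x \<noteq> x"
    using assms(1) by (auto simp: non_periodic_points_def int_iterate_def)
  show ?thesis
  proof (cases "n > 0")
    case True
    then show ?thesis using np[of "nat n"] by simp
  next
    case False
    then show ?thesis using np[of "nat (- n)"] \<tau>_fixed_neg[OF x, of n] assms(2) by simp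
  qed
qed

section \<open>Continuous functions on the space\<close>

lemma cont_funs_off: "f \<in> cont_funs X \<Longrightarrow> x \<notin> S \<Longrightarrow> f x = 0"
  by (simp add: cont_funs_def)

lemma cont_funs_cont: "f \<in> cont_funs X \<Longrightarrow> continuous_map X euclidean f"
  by (simp add: cont_funs_def)

lemma cont_funs_zero [simp]: "(\<lambda>_. 0) \<in> cont_funs X"
  by (simp add: cont_funs_def)

lemma cont_funs_add [simp]: "\<lbrakk>f \<in> cont_funs X; g \<in> cont_funs X\<rbrakk> \<Longrightarrow> (\<lambda>x. f x + g x) \<in> cont_funs X"
  by (auto simp: cont_funs_def intro: continuous_map_add)

lemma cont_funs_mult [simp]: "\<lbrakk>f \<in> cont_funs X; g \<in> cont_funs X\<rbrakk> \<Longrightarrow> (\<lambda>x. f x * g x) \<in> cont_funs X"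
  by (auto simp: cont_funs_def continuous_map_atin intro: tendsto_mult)

lemma cont_funs_cmult [simp]: "f \<in> cont_funs X \<Longrightarrow> (\<lambda>x. c * f x) \<in> cont_funs X"
  by (auto simp: cont_funs_def continuous_map_atin intro: tendsto_mult_left)

lemma cont_funs_minus [simp]: "\<lbrakk>f \<in> cont_funs X; g \<in> cont_funs X\<rbrakk> \<Longrightarrow> (\<lambda>x. f x - g x) \<in> cont_funs X"
  using cont_funs_add[OF _ cont_funs_cmult[of g "-1"], of f] by simp

lemma cont_funs_sum [simp]: "(\<And>i. i \<in> I \<Longrightarrow> f i \<in> cont_funs X) \<Longrightarrow> (\<lambda>x. \<Sum>i\<in>I. f i x) \<in> cont_funs X"
  by (induction I rule: infinite_finite_induct) auto

lemma cont_funs_cnj [simp]: "f \<in> cont_funs X \<Longrightarrow> (\<lambda>x. cnj (f x)) \<in> cont_funs X"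
  by (auto simp: cont_funs_def continuous_map_atin intro: tendsto_cnj)

lemma cont_funs_\<alpha> [simp]: "f \<in> cont_funs X \<Longrightarrow> \<alpha>_pow X \<sigma> n f \<in> cont_funs X"
  using continuous_map_compose[OF \<tau>_continuous[of "- n"], of euclidean f]
  by (auto simp: cont_funs_def \<alpha>_pow_def intro: continuous_map_eq)

definition unit_fun :: "'x \<Rightarrow> complex" where
  "unit_fun = (\<lambda>x. if x \<in> S then 1 else 0)"

lemma cont_funs_unit [simp]: "unit_fun \<in> cont_funs X"
  by (auto simp: cont_funs_def unit_fun_def intro: continuous_map_eq[of X euclidean "\<lambda>_. 1"])

lemma cont_funs_of_real:
  assumes "continuous_map X euclideanreal g"
  shows "(\<lambda>x. if x \<in> S then complex_of_real (g x) else 0) \<in> cont_funs X"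
proof -
  have "continuous_map X euclidean (\<lambda>x. complex_of_real (g x))"
    using assms by (auto simp: continuous_map_atin intro: tendsto_of_real)
  then show ?thesis
    by (auto simp: cont_funs_def intro: continuous_map_eq)
qed

lemma cont_funs_bounded:
  assumes "f \<in> cont_funs X"
  obtains M where "M > 0" "\<And>x. cmod (f x) \<le> M"
proof -
  have "compact (f ` S)"
    using image_compactin[of X S euclidean f] assms compact_X
    by (auto simp: compact_space_def cont_funs_def)
  then obtain M where M: "\<And>y. y \<in> f ` S \<Longrightarrow> cmod y \<le> M"
    using compact_imp_bounded bounded_iff by metis
  have "cmod (f x) \<le> max 1 M" for x
    using M[of "f x"] assms by (cases "x \<in> S") (auto simp: cont_funs_off max.coboundedI2)
  then show ?thesis by (intro that[of "max 1 M"]) auto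
qed

text \<open>Urysohn's lemma for a point and the complement of a neighbourhood.\<close>

lemma bump_function:
  assumes V: "openin X V" "x \<in> V"
  obtains g where "continuous_map X euclideanreal g" "g x = 1" "\<And>y. y \<in> S - V \<Longrightarrow> g y = 0"
    "\<And>y. y \<in> S \<Longrightarrow> 0 \<le> g y \<and> g y \<le> 1"
proof -
  have xS: "x \<in> S" using V openin_subset by blast
  have "closedin X {x}" using Hausdorff_X xS
    by (simp add: Hausdorff_imp_t1_space closedin_t1_singleton)
  moreover have "closedin X (S - V)" using V by blast
  ultimately obtain g where g: "continuous_map X (top_of_set {0..1::real}) g" "g ` (S - V) \<subseteq> {0}" "g ` {x} \<subseteq> {1}"
    using Urysohn_lemma[OF normal_X, of "S - V" "{x}" 0 1] V by (auto simp: disjnt_def)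
  then have "continuous_map X euclideanreal g" "g \<in> S \<rightarrow> {0..1}"
    by (auto simp: continuous_map_in_subtopology)
  then show ?thesis using g by (intro that[of g]) auto
qed

section \<open>The algebraic crossed product\<close>

text \<open>The product of \<open>A\<close> as a left action on arbitrary functions \<open>\<xi>\<close> on \<open>\<int> \<times> X\<close>. With \<open>\<xi>\<close> in \<open>A\<close> this is the
multiplication; with \<open>\<xi>\<close> constant in the first variable it is the action on functions on the space.\<close>

definition conv :: "(int \<Rightarrow> 'x \<Rightarrow> complex) \<Rightarrow> (int \<Rightarrow> 'x \<Rightarrow> complex) \<Rightarrow> int \<Rightarrow> 'x \<Rightarrow> complex" where
  "conv a \<xi> n x = (\<Sum>k\<in>supp a. a k x * \<xi> (n - k) (\<tau> (- k) x))"

lemma carrier_iff: "a \<in> carrier A \<longleftrightarrow> (\<forall>n. a n \<in> cont_funs X) \<and> finite (supp a)"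
  by (simp add: algebraic_crossed_product_def)

lemma carrierD: "a \<in> carrier A \<Longrightarrow> a n \<in> cont_funs X" "a \<in> carrier A \<Longrightarrow> finite (supp a)"
  by (auto simp: carrier_iff)

lemma carrierI: "\<lbrakk>\<And>n. a n \<in> cont_funs X; finite K; \<And>n. n \<notin> K \<Longrightarrow> a n = (\<lambda>_. 0)\<rbrakk> \<Longrightarrow> a \<in> carrier A"
  by (auto simp: carrier_iff intro: finite_subset[of _ K])

lemma carrier_off: "a \<in> carrier A \<Longrightarrow> x \<notin> S \<Longrightarrow> a n x = 0"
  using carrierD cont_funs_off by blast

lemma zero_A: "\<zero>\<^bsub>A\<^esub> = (\<lambda>_ _. 0)" and one_A: "\<one>\<^bsub>A\<^esub> = monomial unit_fun 0"
  and add_A: "a \<oplus>\<^bsub>A\<^esub> b = (\<lambda>n x. a n x + b n x)"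
  and smult_A: "c \<odot>\<^bsub>A\<^esub> a = (\<lambda>n x. c * a n x)"
  and star_A: "star A a = (\<lambda>n. \<alpha>_pow X \<sigma> n (\<lambda>x. cnj (a (- n) x)))"
  by (auto simp: algebraic_crossed_product_def unit_fun_def)

lemma mult_A:
  assumes "a \<in> carrier A"
  shows "a \<otimes>\<^bsub>A\<^esub> b = conv a b"
  using carrier_off[OF assms]
  by (auto simp: algebraic_crossed_product_def conv_def \<alpha>_pow_def fun_eq_iff intro!: sum.cong)

lemma star_A_apply: "star A a n x = (if x \<in> S then cnj (a (- n) (\<tau> (- n) x)) else 0)"
  by (simp add: star_A \<alpha>_pow_def)

lemma conv_superset:
  assumes "finite K" "\<And>k. k \<notin> K \<Longrightarrow> a k = (\<lambda>_. 0)"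
  shows "conv a \<xi> n x = (\<Sum>k\<in>K. a k x * \<xi> (n - k) (\<tau> (- k) x))"
  unfolding conv_def by (rule sum.mono_neutral_left) (use assms in auto)

lemma conv_add_left:
  assumes "a \<in> carrier A" "b \<in> carrier A"
  shows "conv (\<lambda>n x. a n x + b n x) \<xi> n x = conv a \<xi> n x + conv b \<xi> n x"
proof -
  have K: "finite (supp a \<union> supp b)" using assms by (auto simp: carrier_iff)
  have "conv c \<xi> n x = (\<Sum>k\<in>supp a \<union> supp b. c k x * \<xi> (n - k) (\<tau> (- k) x))"
    if "c \<in> {a, b, \<lambda>n x. a n x + b n x}" for c
    by (rule conv_superset[OF K]) (use that in auto)
  then show ?thesis
    by (simp add: sum.distrib distrib_right)
qed

lemma conv_add_right: "conv a (\<lambda>n x. \<xi> n x + \<eta> n x) n x = conv a \<xi> n x + conv a \<eta> n x"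
  by (simp add: conv_def distrib_left sum.distrib)

lemma conv_smult_left: "conv (\<lambda>n x. c * a n x) \<xi> n x = c * conv a \<xi> n x"
proof (cases "c = 0")
  case False
  then have "supp (\<lambda>n x. c * a n x) = supp a" by (auto simp: fun_eq_iff)
  then show ?thesis by (simp add: conv_def sum_distrib_left mult_ac)
qed (simp add: conv_def)

lemma conv_closed:
  assumes a: "a \<in> carrier A" and b: "b \<in> carrier A"
  shows "conv a b \<in> carrier A"
proof (rule carrierI)
  show "finite ((\<lambda>(i, j). i + j) ` (supp a \<times> supp b))"
    using a b by (auto simp: carrier_iff)
  fix n
  have "conv a b n = (\<lambda>x. \<Sum>k\<in>supp a. a k x * \<alpha>_pow X \<sigma> k (b (n - k)) x)"
    using carrier_off[OF a] by (auto simp: conv_def fun_eq_iff \<alpha>_pow_def intro!: sum.cong)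
  then show "conv a b n \<in> cont_funs X"
    using carrierD(1)[OF a] carrierD(1)[OF b] by simp
  assume n: "n \<notin> (\<lambda>(i, j). i + j) ` (supp a \<times> supp b)"
  have "b (n - k) = (\<lambda>_. 0)" if "k \<in> supp a" for k
  proof (rule ccontr)
    assume "b (n - k) \<noteq> (\<lambda>_. 0)"
    with that have "(k, n - k) \<in> supp a \<times> supp b" by simp
    with n show False by force
  qed
  then show "conv a b n = (\<lambda>_. 0)"
    by (auto simp: conv_def[abs_def] fun_eq_iff intro!: sum.neutral)
qed

text \<open>Leaving \<open>\<xi>\<close> arbitrary yields both the associativity of the multiplication and the multiplicativity of
the action on functions on the space. The sums match under the substitution \<open>l = k + j\<close>.\<close>

lemma conv_assoc:
  assumes a: "a \<in> carrier A" and b: "b \<in> carrier A"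
  shows "conv (conv a b) \<xi> = conv a (conv b \<xi>)"
proof (intro ext)
  fix n x
  show "conv (conv a b) \<xi> n x = conv a (conv b \<xi>) n x"
  proof (cases "x \<in> S")
    case False
    then show ?thesis
      using carrier_off[OF a] carrier_off[OF conv_closed[OF a b]] by (simp add: conv_def)
  next
    case x: True
    define L where "L = (\<lambda>(i, j). i + j) ` (supp a \<times> supp b)"
    have fin: "finite (supp a)" "finite (supp b)" using a b by (auto simp: carrier_iff)
    then have L: "finite L" by (simp add: L_def)
    have "conv a b l = (\<lambda>_. 0)" if "l \<notin> L" for l
    proof -
      have "b (l - k) = (\<lambda>_. 0)" if "k \<in> supp a" for k
      proof (rule ccontr)
        assume "b (l - k) \<noteq> (\<lambda>_. 0)"
        with that have "(k, l - k) \<in> supp a \<times> supp b" by simp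
        with \<open>l \<notin> L\<close> show False unfolding L_def by force
      qed
      then show ?thesis by (auto simp: conv_def[abs_def] fun_eq_iff intro!: sum.neutral)
    qed
    then have "conv (conv a b) \<xi> n x = (\<Sum>l\<in>L. conv a b l x * \<xi> (n - l) (\<tau> (- l) x))"
      by (rule conv_superset[OF L])
    also have "\<dots> = (\<Sum>k\<in>supp a. \<Sum>l\<in>L. a k x * b (l - k) (\<tau> (- k) x) * \<xi> (n - l) (\<tau> (- l) x))"
      unfolding conv_def sum_distrib_right by (rule sum.swap)
    also have "\<dots> = (\<Sum>k\<in>supp a. a k x * conv b \<xi> (n - k) (\<tau> (- k) x))"
    proof (rule sum.cong[OF refl])
      fix k assume k: "k \<in> supp a"
      have "(\<Sum>l\<in>L. a k x * b (l - k) (\<tau> (- k) x) * \<xi> (n - l) (\<tau> (- l) x))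
          = (\<Sum>l\<in>(\<lambda>j. k + j) ` supp b. a k x * b (l - k) (\<tau> (- k) x) * \<xi> (n - l) (\<tau> (- l) x))"
      proof (rule sum.mono_neutral_right[OF L])
        show "(+) k ` supp b \<subseteq> L" using k unfolding L_def by force
        show "\<forall>l\<in>L - (+) k ` supp b. a k x * b (l - k) (\<tau> (- k) x) * \<xi> (n - l) (\<tau> (- l) x) = 0"
        proof
          fix l assume l: "l \<in> L - (+) k ` supp b"
          have "l - k \<notin> supp b"
          proof
            assume "l - k \<in> supp b"
            then have "k + (l - k) \<in> (+) k ` supp b" by (rule imageI)
            with l show False by simp
          qed
          then show "a k x * b (l - k) (\<tau> (- k) x) * \<xi> (n - l) (\<tau> (- l) x) = 0" by simp
        qed
      qed
      also have "\<dots> = (\<Sum>j\<in>supp b. a k x * b j (\<tau> (- k) x) * \<xi> (n - (k + j)) (\<tau> (- (k + j)) x))"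
        by (subst sum.reindex) auto
      also have "\<dots> = a k x * conv b \<xi> (n - k) (\<tau> (- k) x)"
        using x by (simp add: conv_def sum_distrib_left mult.assoc \<tau>_add algebra_simps)
      finally show "(\<Sum>l\<in>L. a k x * b (l - k) (\<tau> (- k) x) * \<xi> (n - l) (\<tau> (- l) x))
          = a k x * conv b \<xi> (n - k) (\<tau> (- k) x)" .
    qed
    finally show ?thesis by (simp add: conv_def)
  qed
qed

lemma monomial_closed [simp]: "f \<in> cont_funs X \<Longrightarrow> monomial f n \<in> carrier A"
  by (rule carrierI[of _ "{n}"]) (auto simp: monomial_def)

lemma conv_monomial_left: "conv (monomial f m) \<xi> n x = f x * \<xi> (n - m) (\<tau> (- m) x)"
  by (subst conv_superset[of "{m}"]) (auto simp: monomial_def)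

lemma conv_monomial_right:
  assumes "a \<in> carrier A"
  shows "conv a (monomial g m) n x = a (n - m) x * g (\<tau> (m - n) x)"
proof -
  have "conv a (monomial g m) n x = (\<Sum>k\<in>insert (n - m) (supp a). a k x * monomial g m (n - k) (\<tau> (- k) x))"
    by (rule conv_superset) (use assms in \<open>auto simp: carrier_iff\<close>)
  also have "\<dots> = (\<Sum>k\<in>{n - m}. a k x * monomial g m (n - k) (\<tau> (- k) x))"
    by (rule sum.mono_neutral_right) (use assms in \<open>auto simp: carrier_iff monomial_def\<close>)
  finally show ?thesis by (simp add: monomial_def)
qed

lemma add_closed: "\<lbrakk>a \<in> carrier A; b \<in> carrier A\<rbrakk> \<Longrightarrow> a \<oplus>\<^bsub>A\<^esub> b \<in> carrier A"
  by (rule carrierI[of _ "supp a \<union> supp b"]) (auto simp: add_A carrier_iff)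

lemma smult_closed_A: "a \<in> carrier A \<Longrightarrow> c \<odot>\<^bsub>A\<^esub> a \<in> carrier A"
  by (rule carrierI[of _ "supp a"]) (auto simp: smult_A carrier_iff)

lemma star_closed_A:
  assumes "a \<in> carrier A"
  shows "star A a \<in> carrier A"
proof (rule carrierI[of _ "uminus ` supp a"])
  show "finite (uminus ` supp a)" using assms by (simp add: carrier_iff)
  show "star A a n \<in> cont_funs X" for n
    using assms by (simp add: star_A carrier_iff)
  fix n assume n: "n \<notin> uminus ` supp a"
  have "- n \<notin> supp a"
  proof
    assume "- n \<in> supp a"
    then have "- (- n) \<in> uminus ` supp a" by (rule imageI)
    with n show False by simp
  qed
  then show "star A a n = (\<lambda>_. 0)"
    by (auto simp: fun_eq_iff star_A_apply)
qed

lemma abelian_group_A: "abelian_group A"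
proof (rule abelian_groupI)
  fix a assume a: "a \<in> carrier A"
  have "(-1) \<odot>\<^bsub>A\<^esub> a \<in> carrier A" by (rule smult_closed_A[OF a])
  moreover have "((-1) \<odot>\<^bsub>A\<^esub> a) \<oplus>\<^bsub>A\<^esub> a = \<zero>\<^bsub>A\<^esub>"
    by (auto simp: smult_A add_A zero_A)
  ultimately
  show "\<exists>b\<in>carrier A. b \<oplus>\<^bsub>A\<^esub> a = \<zero>\<^bsub>A\<^esub>" by blast
qed (use add_closed in \<open>auto simp: add_A zero_A carrier_iff add_ac\<close>)

lemma ring_A: "ring A"
proof (rule ringI[OF abelian_group_A])
  show "monoid A"
  proof (rule monoidI)
    show "a \<otimes>\<^bsub>A\<^esub> b \<otimes>\<^bsub>A\<^esub> c = a \<otimes>\<^bsub>A\<^esub> (b \<otimes>\<^bsub>A\<^esub> c)"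
      if "a \<in> carrier A" "b \<in> carrier A" "c \<in> carrier A" for a b c
      using that by (simp add: mult_A conv_closed conv_assoc)
    show "\<one>\<^bsub>A\<^esub> \<otimes>\<^bsub>A\<^esub> a = a" if "a \<in> carrier A" for a
    proof (intro ext)
      fix n x
      show "(\<one>\<^bsub>A\<^esub> \<otimes>\<^bsub>A\<^esub> a) n x = a n x"
        using carrier_off[OF that]
        by (cases "x \<in> S") (simp_all add: one_A mult_A conv_monomial_left, simp_all add: unit_fun_def)
    qed
    show "a \<otimes>\<^bsub>A\<^esub> \<one>\<^bsub>A\<^esub> = a" if "a \<in> carrier A" for a
    proof (intro ext)
      fix n x
      show "(a \<otimes>\<^bsub>A\<^esub> \<one>\<^bsub>A\<^esub>) n x = a n x"
        using carrier_off[OF that] that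
        by (cases "x \<in> S") (auto simp: one_A mult_A conv_monomial_right unit_fun_def)
    qed
  qed (auto simp: mult_A conv_closed one_A)
qed (auto simp: mult_A add_closed fun_eq_iff, auto simp: add_A conv_add_left conv_add_right)

lemma neg_A:
  assumes a: "a \<in> carrier A"
  shows "\<ominus>\<^bsub>A\<^esub> a = (\<lambda>n x. - a n x)"
proof -
  interpret ring A by (rule ring_A)
  have "\<ominus>\<^bsub>A\<^esub> a = (-1) \<odot>\<^bsub>A\<^esub> a"
  proof (rule minus_equality)
    show "((-1) \<odot>\<^bsub>A\<^esub> a) \<oplus>\<^bsub>A\<^esub> a = \<zero>\<^bsub>A\<^esub>" by (auto simp: smult_A add_A zero_A)
  qed (rule a smult_closed_A[OF a])+
  then show ?thesis by (simp add: smult_A)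
qed

lemma minus_A: "b \<in> carrier A \<Longrightarrow> a \<ominus>\<^bsub>A\<^esub> b = (\<lambda>n x. a n x - b n x)"
  by (simp add: a_minus_def neg_A add_A)

lemma seminormed_A:
  assumes "cstar_seminorm A p"
  shows "cstar_seminormed_ring A p"
proof -
  interpret ring A by (rule ring_A)
  show ?thesis
  proof
    fix a b :: "int \<Rightarrow> 'x \<Rightarrow> complex" and c :: complex
    assume a: "a \<in> carrier A"
    show "c \<odot>\<^bsub>A\<^esub> a \<in> carrier A" "star A a \<in> carrier A"
      using a smult_closed_A star_closed_A by auto
    show "(- 1) \<odot>\<^bsub>A\<^esub> a = \<ominus>\<^bsub>A\<^esub> a"
      using a by (simp add: smult_A neg_A)
    show "star A (star A a) = a"
      using carrier_off[OF a] by (auto simp: fun_eq_iff star_A_apply \<tau>_add)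
    assume b: "b \<in> carrier A"
    show "c \<odot>\<^bsub>A\<^esub> (a \<ominus>\<^bsub>A\<^esub> b) = c \<odot>\<^bsub>A\<^esub> a \<ominus>\<^bsub>A\<^esub> c \<odot>\<^bsub>A\<^esub> b"
      using a b smult_closed_A[OF b, of c] by (simp add: minus_A) (simp add: smult_A right_diff_distrib)
    show "star A (a \<ominus>\<^bsub>A\<^esub> b) = star A a \<ominus>\<^bsub>A\<^esub> star A b"
      using a b star_closed_A[OF b] by (auto simp: minus_A star_A_apply fun_eq_iff)
  qed (rule assms)
qed

section \<open>Every C*-seminorm is bounded by the l1-norm\<close>

lemma cstar_seminorm_zero: "cstar_seminorm A (\<lambda>_. 0)"
  by (simp add: cstar_seminorm_def)

text \<open>Apply the inequality to \<open>1 / c\<close> and \<open>c \<odot> a\<close>.\<close>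

lemma homogeneous_if_subhomogeneous:
  assumes nonneg: "\<And>a. a \<in> carrier A \<Longrightarrow> 0 \<le> q a"
    and le: "\<And>c a. a \<in> carrier A \<Longrightarrow> q (c \<odot>\<^bsub>A\<^esub> a) \<le> cmod c * q a"
    and a: "a \<in> carrier A"
  shows "q (c \<odot>\<^bsub>A\<^esub> a) = cmod c * q a"
proof (cases "c = 0")
  case True
  then show ?thesis using le[OF a, of c] nonneg[OF smult_closed_A[OF a, of c]] by simp
next
  case False
  have "q ((1 / c) \<odot>\<^bsub>A\<^esub> (c \<odot>\<^bsub>A\<^esub> a)) \<le> cmod (1 / c) * q (c \<odot>\<^bsub>A\<^esub> a)"
    by (rule le) (rule smult_closed_A[OF a])
  moreover have "(1 / c) \<odot>\<^bsub>A\<^esub> (c \<odot>\<^bsub>A\<^esub> a) = a" using False by (simp add: smult_A)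
  ultimately have "cmod c * q a \<le> q (c \<odot>\<^bsub>A\<^esub> a)"
    using False by (simp add: norm_divide field_simps)
  then show ?thesis using le[OF a, of c] by linarith
qed

lemma star_monomial: "star A (monomial f n) = monomial (\<alpha>_pow X \<sigma> (- n) (\<lambda>x. cnj (f x))) (- n)"
  by (auto simp: fun_eq_iff star_A_apply monomial_def \<alpha>_pow_def)

lemma monomial_mult:
  assumes "f \<in> cont_funs X"
  shows "monomial f m \<otimes>\<^bsub>A\<^esub> monomial g n = monomial (\<lambda>x. f x * g (\<tau> (- m) x)) (m + n)"
  using assms by (auto simp: mult_A conv_monomial_left fun_eq_iff) (auto simp: monomial_def)

text \<open>The C*-identity reduces the monomials \<open>f \<delta>\<^sup>n\<close> to nonnegative functions.\<close>

lemma star_monomial_mult: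
  assumes "f \<in> cont_funs X"
  shows "star A (monomial f n) \<otimes>\<^bsub>A\<^esub> monomial f n
    = monomial (\<lambda>x. complex_of_real ((cmod (\<alpha>_pow X \<sigma> (- n) f x))\<^sup>2)) 0"
proof -
  have "star A (monomial f n) \<otimes>\<^bsub>A\<^esub> monomial f n
    = monomial (\<lambda>x. \<alpha>_pow X \<sigma> (- n) (\<lambda>x. cnj (f x)) x * f (\<tau> (- (- n)) x)) (- n + n)"
    unfolding star_monomial by (rule monomial_mult) (use assms in simp)
  also have "\<dots> = monomial (\<lambda>x. complex_of_real ((cmod (\<alpha>_pow X \<sigma> (- n) f x))\<^sup>2)) 0"
  proof -
    have "\<alpha>_pow X \<sigma> (- n) (\<lambda>x. cnj (f x)) x * f (\<tau> (- (- n)) x)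
        = complex_of_real ((cmod (\<alpha>_pow X \<sigma> (- n) f x))\<^sup>2)" for x
      unfolding complex_norm_square by (simp add: \<alpha>_pow_def mult.commute)
    then show ?thesis by simp
  qed
  finally show ?thesis .
qed

lemma seminorm_unitary_le:
  assumes p: "cstar_seminorm A p" and u: "u \<in> cont_funs X" "\<And>x. x \<in> S \<Longrightarrow> cmod (u x) = 1"
  shows "p (monomial u 0) \<le> 1"
proof -
  interpret cp: cstar_seminormed_ring A p by (rule seminormed_A[OF p])
  have "(\<lambda>x. complex_of_real ((cmod (\<alpha>_pow X \<sigma> (- 0) u x))\<^sup>2)) = unit_fun"
    using u by (auto simp: unit_fun_def \<alpha>_pow_def)
  then have "star A (monomial u 0) \<otimes>\<^bsub>A\<^esub> monomial u 0 = \<one>\<^bsub>A\<^esub>"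
    unfolding star_monomial_mult[OF u(1)] one_A by simp
  then have "(p (monomial u 0))\<^sup>2 \<le> 1\<^sup>2"
    using cp.p_star_mult[of "monomial u 0"] cp.p_one_le u by simp
  then show ?thesis by (rule power2_le_imp_le) simp
qed

text \<open>A function with values in \<open>[-1, 1]\<close> is the mean of the two unitaries \<open>h \<plusminus> \<i> sqrt (1 - h\<^sup>2)\<close>. This
elementary device takes the place of the spectral radius formula.\<close>

lemma seminorm_real_le:
  assumes p: "cstar_seminorm A p" and h: "continuous_map X euclideanreal h" "\<And>x. x \<in> S \<Longrightarrow> \<bar>h x\<bar> \<le> 1"
  shows "p (monomial (\<lambda>x. if x \<in> S then complex_of_real (h x) else 0) 0) \<le> 1"
proof -
  interpret cp: cstar_seminormed_ring A p by (rule seminormed_A[OF p])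
  define h' where "h' = (\<lambda>x. if x \<in> S then complex_of_real (h x) else 0)"
  define k' where "k' = (\<lambda>x. if x \<in> S then complex_of_real (sqrt (1 - (h x)\<^sup>2)) else 0)"
  have "continuous_map X euclideanreal (\<lambda>x. sqrt (1 - (h x)\<^sup>2))"
    using h(1) by (auto simp: continuous_map_atin intro!: tendsto_intros)
  then have hk: "h' \<in> cont_funs X" "k' \<in> cont_funs X"
    unfolding h'_def k'_def using h(1) by (auto intro: cont_funs_of_real)
  define u v where "u = (\<lambda>x. h' x + \<i> * k' x)" and "v = (\<lambda>x. h' x + (- \<i>) * k' x)"
  have uv: "u \<in> cont_funs X" "v \<in> cont_funs X"
    using hk cont_funs_add[OF hk(1) cont_funs_cmult[OF hk(2)]] by (auto simp: u_def v_def)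
  have sq: "(h x)\<^sup>2 \<le> 1" if "x \<in> S" for x
    using h(2)[OF that] abs_square_le_1 by blast
  have "cmod (u x) = 1" "cmod (v x) = 1" if "x \<in> S" for x
    using that sq[OF that] by (auto simp: u_def v_def h'_def k'_def cmod_def)
  then have "p (monomial u 0) \<le> 1" "p (monomial v 0) \<le> 1"
    using seminorm_unitary_le[OF p] uv by auto
  moreover have "monomial h' 0 = (1 / 2) \<odot>\<^bsub>A\<^esub> (monomial u 0 \<oplus>\<^bsub>A\<^esub> monomial v 0)"
    by (auto simp: smult_A add_A monomial_def u_def v_def fun_eq_iff)
  moreover have "p ((1 / 2) \<odot>\<^bsub>A\<^esub> (monomial u 0 \<oplus>\<^bsub>A\<^esub> monomial v 0)) = 1 / 2 * p (monomial u 0 \<oplus>\<^bsub>A\<^esub> monomial v 0)"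
    using uv by (subst cp.p_smult) auto
  moreover have "p (monomial u 0 \<oplus>\<^bsub>A\<^esub> monomial v 0) \<le> p (monomial u 0) + p (monomial v 0)"
    using uv by (intro cp.p_add) auto
  ultimately show ?thesis by (simp add: h'_def)
qed

lemma seminorm_monomial_le_1:
  assumes p: "cstar_seminorm A p" and f: "f \<in> cont_funs X" "\<And>x. cmod (f x) \<le> 1"
  shows "p (monomial f n) \<le> 1"
proof -
  interpret cp: cstar_seminormed_ring A p by (rule seminormed_A[OF p])
  define g where "g = \<alpha>_pow X \<sigma> (- n) f"
  have g: "g \<in> cont_funs X" using f by (simp add: g_def)
  then have "continuous_map X euclideanreal (\<lambda>x. (cmod (g x))\<^sup>2)"
    by (auto simp: continuous_map_atin cont_funs_def intro!: tendsto_intros)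
  moreover have "cmod (g x) \<le> 1" for x using f by (simp add: g_def \<alpha>_pow_def)
  ultimately have "p (monomial (\<lambda>x. if x \<in> S then complex_of_real ((cmod (g x))\<^sup>2) else 0) 0) \<le> 1"
    by (intro seminorm_real_le[OF p]) (auto simp: abs_square_le_1)
  also have "(\<lambda>x. if x \<in> S then complex_of_real ((cmod (g x))\<^sup>2) else 0) = (\<lambda>x. complex_of_real ((cmod (g x))\<^sup>2))"
    using cont_funs_off[OF g] by auto
  also have "p (monomial (\<lambda>x. complex_of_real ((cmod (g x))\<^sup>2)) 0) = (p (monomial f n))\<^sup>2"
    using cp.p_star_mult[of "monomial f n"] f by (simp add: star_monomial_mult g_def)
  finally have "(p (monomial f n))\<^sup>2 \<le> 1\<^sup>2" by simp
  then show ?thesis by (rule power2_le_imp_le) simp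
qed

lemma seminorm_monomial_le:
  assumes p: "cstar_seminorm A p" and f: "f \<in> cont_funs X" "\<And>x. cmod (f x) \<le> M"
  shows "p (monomial f n) \<le> M"
proof -
  interpret cp: cstar_seminormed_ring A p by (rule seminormed_A[OF p])
  have "M \<ge> 0" using order_trans[OF norm_ge_zero f(2)] by blast
  show ?thesis
  proof (cases "M = 0")
    case True
    then have "f = (\<lambda>_. 0)" using f(2) by auto
    then have "monomial f n = \<zero>\<^bsub>A\<^esub>" by (auto simp: zero_A monomial_def fun_eq_iff)
    then show ?thesis using True by simp
  next
    case False
    then have M: "M > 0" using \<open>M \<ge> 0\<close> by simp
    define g where "g = (\<lambda>x. complex_of_real (1 / M) * f x)"
    have g: "g \<in> cont_funs X" unfolding g_def by (rule cont_funs_cmult[OF f(1)])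
    have "p (monomial g n) \<le> 1"
      by (rule seminorm_monomial_le_1[OF p g]) (use f M in \<open>auto simp: g_def norm_mult norm_divide divide_simps\<close>)
    moreover have "monomial f n = complex_of_real M \<odot>\<^bsub>A\<^esub> monomial g n"
      using M by (auto simp: smult_A monomial_def g_def fun_eq_iff)
    moreover have "p (complex_of_real M \<odot>\<^bsub>A\<^esub> monomial g n) = M * p (monomial g n)"
      using g M by (subst cp.p_smult) auto
    ultimately show ?thesis using M by simp
  qed
qed

text \<open>Hence the supremum that defines the maximal C*-seminorm is finite.\<close>

lemma seminorm_le_l1:
  assumes p: "cstar_seminorm A p" and "finite K" and "a \<in> carrier A" and "\<And>k. k \<notin> K \<Longrightarrow> a k = (\<lambda>_. 0)"
    and "\<And>k x. k \<in> K \<Longrightarrow> cmod (a k x) \<le> M k"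
  shows "p a \<le> (\<Sum>k\<in>K. M k)"
  using assms(2-)
proof (induction K arbitrary: a rule: finite_induct)
  case empty
  interpret cp: cstar_seminormed_ring A p by (rule seminormed_A[OF p])
  have "a = \<zero>\<^bsub>A\<^esub>" using empty by (auto simp: zero_A)
  then show ?case by simp
next
  case (insert k K)
  interpret cp: cstar_seminormed_ring A p by (rule seminormed_A[OF p])
  define b where "b = a(k := (\<lambda>_. 0))"
  have b: "b \<in> carrier A"
    by (rule carrierI[of _ K]) (use insert carrierD in \<open>auto simp: b_def\<close>)
  have ak: "a k \<in> cont_funs X" using insert carrierD by auto
  have "a = monomial (a k) k \<oplus>\<^bsub>A\<^esub> b" by (auto simp: add_A b_def monomial_def fun_eq_iff)
  then have "p a \<le> p (monomial (a k) k) + p b"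
    using cp.p_add[of "monomial (a k) k" b] b ak by simp
  also have "p (monomial (a k) k) \<le> M k"
    by (rule seminorm_monomial_le[OF p ak]) (use insert in auto)
  also have "p b \<le> (\<Sum>k\<in>K. M k)"
  proof (rule insert.IH[OF b])
    show "b j = (\<lambda>_. 0)" if "j \<notin> K" for j
      using insert.prems(2)[of j] that by (simp add: b_def)
    show "cmod (b j x) \<le> M j" if "j \<in> K" for j x
      using insert.prems(3)[of j x] insert.hyps that by (auto simp: b_def)
  qed
  finally show ?case using insert by simp
qed

lemma carrier_bounded:
  assumes "a \<in> carrier A"
  obtains M where "M \<ge> 0" "\<And>k x. cmod (a k x) \<le> M"
proof -
  have "\<exists>M>0. \<forall>x. cmod (a k x) \<le> M" for k
    using cont_funs_bounded[OF carrierD(1)[OF assms, of k]] by metis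
  then obtain M where M: "\<And>k. M k > 0" "\<And>k x. cmod (a k x) \<le> M k" by metis
  have fin: "finite (supp a)" using assms carrierD by auto
  have "cmod (a k x) \<le> (\<Sum>k\<in>supp a. M k)" for k x
  proof (cases "k \<in> supp a")
    case True
    then have "M k \<le> (\<Sum>k\<in>supp a. M k)"
      using fin M(1) by (intro member_le_sum) (auto intro: less_imp_le)
    then show ?thesis using M(2)[of k x] by linarith
  next
    case False
    moreover have "0 \<le> (\<Sum>k\<in>supp a. M k)" by (intro sum_nonneg less_imp_le M(1))
    ultimately show ?thesis by simp
  qed
  then show ?thesis using that[of "\<Sum>k\<in>supp a. M k"] sum_nonneg[of "supp a" M] less_imp_le[OF M(1)] by blast
qed

lemma seminorms_bounded:
  assumes "a \<in> carrier A"
  shows "bdd_above ((\<lambda>p. p a) ` {p. cstar_seminorm A p})"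
proof -
  obtain M where M: "M \<ge> 0" "\<And>k x. cmod (a k x) \<le> M" using carrier_bounded[OF assms] by metis
  have "p a \<le> (\<Sum>k\<in>supp a. M)" if "cstar_seminorm A p" for p
    by (rule seminorm_le_l1[OF that]) (use assms carrierD M in auto)
  then show ?thesis by (auto intro!: bdd_aboveI)
qed

section \<open>The maximal C*-seminorm\<close>

abbreviation "P \<equiv> max_cstar_seminorm A"

lemma le_P: "\<lbrakk>cstar_seminorm A p; a \<in> carrier A\<rbrakk> \<Longrightarrow> p a \<le> P a"
  unfolding max_cstar_seminorm_def by (rule cSUP_upper[OF _ seminorms_bounded]) auto

lemma P_le: "(\<And>p. cstar_seminorm A p \<Longrightarrow> p a \<le> B) \<Longrightarrow> P a \<le> B"
  unfolding max_cstar_seminorm_def by (rule cSUP_least) (use cstar_seminorm_zero in auto)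

lemma P_nonneg: "a \<in> carrier A \<Longrightarrow> 0 \<le> P a"
  using le_P[OF cstar_seminorm_zero] by simp

text \<open>All conditions pass to a finite-valued pointwise supremum; for the C*-identity because squaring is
monotone on nonnegative numbers.\<close>

lemma cstar_seminorm_P: "cstar_seminorm A P"
proof -
  interpret ring A by (rule ring_A)
  have smult_le: "P (c \<odot>\<^bsub>A\<^esub> a) \<le> cmod c * P a" if "a \<in> carrier A" for c a
  proof (rule P_le)
    fix p assume p: "cstar_seminorm A p"
    then have "p (c \<odot>\<^bsub>A\<^esub> a) = cmod c * p a" using that by (auto simp: cstar_seminorm_def)
    then show "p (c \<odot>\<^bsub>A\<^esub> a) \<le> cmod c * P a"
      using le_P[OF p that] by (simp add: mult_left_mono)
  qed
  show ?thesis
    unfolding cstar_seminorm_def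
  proof (intro conjI ballI allI)
    fix a assume a: "a \<in> carrier A"
    show "0 \<le> P a" by (rule P_nonneg[OF a])
    show "P (c \<odot>\<^bsub>A\<^esub> a) = cmod c * P a" for c
      by (rule homogeneous_if_subhomogeneous[OF P_nonneg smult_le a])
    have sa: "star A a \<otimes>\<^bsub>A\<^esub> a \<in> carrier A" using a star_closed_A by simp
    have star: "p (star A a \<otimes>\<^bsub>A\<^esub> a) = (p a)\<^sup>2" if "cstar_seminorm A p" for p
      using a that by (auto simp: cstar_seminorm_def)
    show "P (star A a \<otimes>\<^bsub>A\<^esub> a) = (P a)\<^sup>2"
    proof (rule antisym)
      show "P (star A a \<otimes>\<^bsub>A\<^esub> a) \<le> (P a)\<^sup>2"
      proof (rule P_le)
        fix p assume p: "cstar_seminorm A p"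
        then have "0 \<le> p a" using a by (auto simp: cstar_seminorm_def)
        then show "p (star A a \<otimes>\<^bsub>A\<^esub> a) \<le> (P a)\<^sup>2"
          using star[OF p] le_P[OF p a] by (simp add: power_mono)
      qed
      have "P a \<le> sqrt (P (star A a \<otimes>\<^bsub>A\<^esub> a))"
      proof (rule P_le)
        fix p assume p: "cstar_seminorm A p"
        have "(p a)\<^sup>2 \<le> P (star A a \<otimes>\<^bsub>A\<^esub> a)"
          using star[OF p] le_P[OF p sa] by simp
        then show "p a \<le> sqrt (P (star A a \<otimes>\<^bsub>A\<^esub> a))" by (rule real_le_rsqrt)
      qed
      then have "(P a)\<^sup>2 \<le> (sqrt (P (star A a \<otimes>\<^bsub>A\<^esub> a)))\<^sup>2"
        using P_nonneg[OF a] by (rule power_mono)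
      then show "(P a)\<^sup>2 \<le> P (star A a \<otimes>\<^bsub>A\<^esub> a)"
        using P_nonneg[OF sa] by simp
    qed
    fix b assume b: "b \<in> carrier A"
    show "P (a \<oplus>\<^bsub>A\<^esub> b) \<le> P a + P b"
    proof (rule P_le)
      fix p assume p: "cstar_seminorm A p"
      then have "p (a \<oplus>\<^bsub>A\<^esub> b) \<le> p a + p b" using a b by (auto simp: cstar_seminorm_def)
      then show "p (a \<oplus>\<^bsub>A\<^esub> b) \<le> P a + P b"
        using le_P[OF p a] le_P[OF p b] by linarith
    qed
    show "P (a \<otimes>\<^bsub>A\<^esub> b) \<le> P a * P b"
    proof (rule P_le)
      fix p assume p: "cstar_seminorm A p"
      then have "p (a \<otimes>\<^bsub>A\<^esub> b) \<le> p a * p b" "0 \<le> p a" "0 \<le> p b" using a b by (auto simp: cstar_seminorm_def)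
      moreover have "p a * p b \<le> P a * P b"
        using le_P[OF p a] le_P[OF p b] P_nonneg[OF a] \<open>0 \<le> p b\<close> by (intro mult_mono) auto
      ultimately show "p (a \<otimes>\<^bsub>A\<^esub> b) \<le> P a * P b" by linarith
    qed
  qed
qed

sublocale cp: cstar_seminormed_ring A P
  by (rule seminormed_A[OF cstar_seminorm_P])

section \<open>The representation on finitely supported functions on the space\<close>

text \<open>The finitely supported functions on the space form a pre-Hilbert space on which \<open>A\<close> acts; its
completion is the Hilbert space of square-summable functions. Finite supports keep all sums finite.\<close>

definition fin_supp :: "('x \<Rightarrow> complex) set" where
  "fin_supp = {\<xi>. finite {x. \<xi> x \<noteq> 0} \<and> {x. \<xi> x \<noteq> 0} \<subseteq> S}"

definition l2 :: "('x \<Rightarrow> complex) \<Rightarrow> real" where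
  "l2 \<xi> = L2_set (\<lambda>x. cmod (\<xi> x)) {x. \<xi> x \<noteq> 0}"

definition inner2 :: "('x \<Rightarrow> complex) \<Rightarrow> ('x \<Rightarrow> complex) \<Rightarrow> complex" where
  "inner2 \<xi> \<eta> = (\<Sum>x | \<xi> x \<noteq> 0. \<xi> x * cnj (\<eta> x))"

text \<open>\<open>f\<close> acts as multiplication by \<open>f\<close>, and \<open>\<delta>\<close> as translation by \<open>\<sigma>\<close>. The index 0 is arbitrary because
the function acted upon is constant in the integer variable.\<close>

definition rep :: "(int \<Rightarrow> 'x \<Rightarrow> complex) \<Rightarrow> ('x \<Rightarrow> complex) \<Rightarrow> 'x \<Rightarrow> complex" where
  "rep a \<xi> = conv a (\<lambda>_. \<xi>) 0"

lemma l2_superset: "finite F \<Longrightarrow> {x. \<xi> x \<noteq> 0} \<subseteq> F \<Longrightarrow> l2 \<xi> = L2_set (\<lambda>x. cmod (\<xi> x)) F"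
  unfolding l2_def L2_set_def by (intro arg_cong[of _ _ sqrt] sum.mono_neutral_left) auto

lemma inner2_superset: "finite F \<Longrightarrow> {x. \<xi> x \<noteq> 0} \<subseteq> F \<Longrightarrow> inner2 \<xi> \<eta> = (\<Sum>x\<in>F. \<xi> x * cnj (\<eta> x))"
  unfolding inner2_def by (intro sum.mono_neutral_left) auto

lemma fin_suppI: "finite F \<Longrightarrow> F \<subseteq> S \<Longrightarrow> (\<And>x. x \<notin> F \<Longrightarrow> \<xi> x = 0) \<Longrightarrow> \<xi> \<in> fin_supp"
  unfolding fin_supp_def by (auto intro: finite_subset[of _ F])

lemma l2_nonneg [simp]: "0 \<le> l2 \<xi>" by (simp add: l2_def)

lemma fin_supp_add: "\<xi> \<in> fin_supp \<Longrightarrow> \<eta> \<in> fin_supp \<Longrightarrow> (\<lambda>x. \<xi> x + \<eta> x) \<in> fin_supp"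
  by (rule fin_suppI[of "{x. \<xi> x \<noteq> 0} \<union> {x. \<eta> x \<noteq> 0}"]) (auto simp: fin_supp_def)

lemma l2_add:
  assumes "\<xi> \<in> fin_supp" "\<eta> \<in> fin_supp"
  shows "l2 (\<lambda>x. \<xi> x + \<eta> x) \<le> l2 \<xi> + l2 \<eta>"
proof -
  define F where "F = {x. \<xi> x \<noteq> 0} \<union> {x. \<eta> x \<noteq> 0}"
  have F: "finite F" using assms by (auto simp: F_def fin_supp_def)
  have "l2 (\<lambda>x. \<xi> x + \<eta> x) = L2_set (\<lambda>x. cmod (\<xi> x + \<eta> x)) F"
    by (rule l2_superset[OF F]) (auto simp: F_def)
  also have "\<dots> \<le> L2_set (\<lambda>x. cmod (\<xi> x) + cmod (\<eta> x)) F"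
    by (intro L2_set_mono norm_triangle_ineq) auto
  also have "\<dots> \<le> L2_set (\<lambda>x. cmod (\<xi> x)) F + L2_set (\<lambda>x. cmod (\<eta> x)) F"
    by (rule L2_set_triangle_ineq)
  also have "\<dots> = l2 \<xi> + l2 \<eta>"
    using l2_superset[OF F, of \<xi>] l2_superset[OF F, of \<eta>] by (auto simp: F_def)
  finally show ?thesis .
qed

lemma l2_smult: "\<xi> \<in> fin_supp \<Longrightarrow> l2 (\<lambda>x. c * \<xi> x) = cmod c * l2 \<xi>"
  using l2_superset[of "{x. \<xi> x \<noteq> 0}" "\<lambda>x. c * \<xi> x"]
  by (auto simp: fin_supp_def norm_mult L2_set_right_distrib l2_def)

lemma fin_supp_smult: "\<xi> \<in> fin_supp \<Longrightarrow> (\<lambda>x. c * \<xi> x) \<in> fin_supp"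
  by (rule fin_suppI[of "{x. \<xi> x \<noteq> 0}"]) (auto simp: fin_supp_def)

lemma l2_zero [simp]: "l2 (\<lambda>_. 0) = 0" by (simp add: l2_def)

lemma fin_supp_zero [simp]: "(\<lambda>_. 0) \<in> fin_supp" by (simp add: fin_supp_def)

lemma fin_supp_sum:
  assumes "finite K" "\<And>k. k \<in> K \<Longrightarrow> \<xi> k \<in> fin_supp"
  shows "(\<lambda>x. \<Sum>k\<in>K. \<xi> k x) \<in> fin_supp \<and> l2 (\<lambda>x. \<Sum>k\<in>K. \<xi> k x) \<le> (\<Sum>k\<in>K. l2 (\<xi> k))"
  using assms
proof (induction K rule: finite_induct)
  case (insert k K)
  then have "l2 (\<lambda>x. \<xi> k x + (\<Sum>k\<in>K. \<xi> k x)) \<le> l2 (\<xi> k) + l2 (\<lambda>x. \<Sum>k\<in>K. \<xi> k x)"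
    by (intro l2_add) auto
  with insert show ?case by (auto intro: fin_supp_add)
qed simp

text \<open>Translations permute the points of the space and so preserve the norm.\<close>

lemma weighted_shift:
  assumes f: "f \<in> cont_funs X" "\<And>x. cmod (f x) \<le> M" and \<xi>: "\<xi> \<in> fin_supp"
  shows "(\<lambda>x. f x * \<xi> (\<tau> (- k) x)) \<in> fin_supp" and "l2 (\<lambda>x. f x * \<xi> (\<tau> (- k) x)) \<le> M * l2 \<xi>"
proof -
  define F where "F = \<tau> k ` {x. \<xi> x \<noteq> 0}"
  have fin: "finite {x. \<xi> x \<noteq> 0}" and sub: "{x. \<xi> x \<noteq> 0} \<subseteq> S" using \<xi> by (auto simp: fin_supp_def)
  have F: "finite F" "F \<subseteq> S" using fin sub by (auto simp: F_def)
  have z: "f x * \<xi> (\<tau> (- k) x) = 0" if "x \<notin> F" for x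
  proof (rule ccontr)
    assume "f x * \<xi> (\<tau> (- k) x) \<noteq> 0"
    then have "x \<in> S" "\<xi> (\<tau> (- k) x) \<noteq> 0" using cont_funs_off[OF f(1)] by auto
    then have "\<tau> k (\<tau> (- k) x) \<in> F" unfolding F_def by blast
    then show False using \<open>x \<in> S\<close> that by simp
  qed
  show "(\<lambda>x. f x * \<xi> (\<tau> (- k) x)) \<in> fin_supp"
    by (rule fin_suppI[OF F z])
  have inj: "inj_on (\<tau> k) {x. \<xi> x \<noteq> 0}"
    by (rule inj_on_inverseI[of _ "\<tau> (- k)"]) (use sub in auto)
  have "M \<ge> 0" using order_trans[OF norm_ge_zero f(2)] by blast
  have "l2 (\<lambda>x. f x * \<xi> (\<tau> (- k) x)) = L2_set (\<lambda>x. cmod (f x * \<xi> (\<tau> (- k) x))) F"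
    by (rule l2_superset[OF F(1)]) (use z in blast)
  also have "\<dots> \<le> L2_set (\<lambda>x. M * cmod (\<xi> (\<tau> (- k) x))) F"
    by (intro L2_set_mono) (auto simp: norm_mult f mult_right_mono)
  also have "\<dots> = M * L2_set (\<lambda>x. cmod (\<xi> (\<tau> (- k) x))) F"
    using \<open>M \<ge> 0\<close> by (simp add: L2_set_right_distrib)
  also have "L2_set (\<lambda>x. cmod (\<xi> (\<tau> (- k) x))) F = l2 \<xi>"
    unfolding L2_set_def l2_def F_def
    by (subst sum.reindex[OF inj]) (use sub in \<open>auto intro!: sum.cong arg_cong[of _ _ sqrt]\<close>)
  finally show "l2 (\<lambda>x. f x * \<xi> (\<tau> (- k) x)) \<le> M * l2 \<xi>" .
qed

lemma rep_eq: "rep a \<xi> x = (\<Sum>k\<in>supp a. a k x * \<xi> (\<tau> (- k) x))"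
  by (simp add: rep_def conv_def)

lemma conv_const: "conv a (\<lambda>_. \<xi>) = (\<lambda>_. rep a \<xi>)"
  by (simp add: rep_eq fun_eq_iff conv_def)

lemma rep_mult:
  assumes a: "a \<in> carrier A" and b: "b \<in> carrier A"
  shows "rep (a \<otimes>\<^bsub>A\<^esub> b) \<xi> = rep a (rep b \<xi>)"
proof -
  have "(\<lambda>_. rep (a \<otimes>\<^bsub>A\<^esub> b) \<xi>) = conv (a \<otimes>\<^bsub>A\<^esub> b) (\<lambda>_. \<xi>)"
    by (simp only: conv_const)
  also have "\<dots> = conv a (conv b (\<lambda>_. \<xi>))"
    by (simp only: mult_A[OF a] conv_assoc[OF a b])
  also have "\<dots> = (\<lambda>_. rep a (rep b \<xi>))"
    by (simp only: conv_const)
  finally show ?thesis by (rule fun_cong)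
qed

lemma rep_add:
  assumes a: "a \<in> carrier A" and b: "b \<in> carrier A"
  shows "rep (a \<oplus>\<^bsub>A\<^esub> b) \<xi> x = rep a \<xi> x + rep b \<xi> x"
  using a b by (simp add: rep_def add_A conv_add_left)

lemma rep_minus:
  assumes a: "a \<in> carrier A" and b: "b \<in> carrier A"
  shows "rep (a \<ominus>\<^bsub>A\<^esub> b) \<xi> x = rep a \<xi> x - rep b \<xi> x"
proof -
  have "(a \<ominus>\<^bsub>A\<^esub> b) \<oplus>\<^bsub>A\<^esub> b = a"
    using b by (simp add: minus_A add_A)
  then show ?thesis
    using rep_add[OF cp.minus_closed[OF a b] b, of \<xi> x] by simp
qed

lemma rep_bounded:
  assumes a: "a \<in> carrier A"
  obtains B where "B \<ge> 0" "\<And>\<xi>. \<xi> \<in> fin_supp \<Longrightarrow> rep a \<xi> \<in> fin_supp \<and> l2 (rep a \<xi>) \<le> B * l2 \<xi>"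
proof -
  obtain M where M: "M \<ge> 0" "\<And>k x. cmod (a k x) \<le> M" using carrier_bounded[OF a] by metis
  have fin: "finite (supp a)" using a carrierD by auto
  show ?thesis
  proof (rule that[of "real (card (supp a)) * M"])
    fix \<xi> assume \<xi>: "\<xi> \<in> fin_supp"
    have w: "(\<lambda>x. a k x * \<xi> (\<tau> (- k) x)) \<in> fin_supp" "l2 (\<lambda>x. a k x * \<xi> (\<tau> (- k) x)) \<le> M * l2 \<xi>" for k
      using weighted_shift[OF carrierD(1)[OF a] M(2) \<xi>] by auto
    have eq: "rep a \<xi> = (\<lambda>x. \<Sum>k\<in>supp a. a k x * \<xi> (\<tau> (- k) x))" by (simp add: fun_eq_iff rep_eq)
    have "(\<Sum>k\<in>supp a. l2 (\<lambda>x. a k x * \<xi> (\<tau> (- k) x))) \<le> (\<Sum>k\<in>supp a. M * l2 \<xi>)"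
      by (intro sum_mono w)
    then show "rep a \<xi> \<in> fin_supp \<and> l2 (rep a \<xi>) \<le> real (card (supp a)) * M * l2 \<xi>"
      using fin_supp_sum[OF fin, of "\<lambda>k x. a k x * \<xi> (\<tau> (- k) x)"] w(1) unfolding eq by (auto simp: mult.assoc)
  qed (use M in auto)
qed

lemma rep_closed: "a \<in> carrier A \<Longrightarrow> \<xi> \<in> fin_supp \<Longrightarrow> rep a \<xi> \<in> fin_supp"
  using rep_bounded by metis

lemma inner2_cauchy_schwarz:
  assumes "\<xi> \<in> fin_supp" "\<eta> \<in> fin_supp"
  shows "cmod (inner2 \<xi> \<eta>) \<le> l2 \<xi> * l2 \<eta>"
proof -
  define F where "F = {x. \<xi> x \<noteq> 0} \<union> {x. \<eta> x \<noteq> 0}"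
  have F: "finite F" using assms by (auto simp: F_def fin_supp_def)
  have "cmod (inner2 \<xi> \<eta>) = cmod (\<Sum>x\<in>F. \<xi> x * cnj (\<eta> x))"
    using inner2_superset[OF F, of \<xi>] by (auto simp: F_def)
  also have "\<dots> \<le> (\<Sum>x\<in>F. \<bar>cmod (\<xi> x)\<bar> * \<bar>cmod (\<eta> x)\<bar>)"
    by (rule order_trans[OF norm_sum]) (simp add: norm_mult)
  also have "\<dots> \<le> L2_set (\<lambda>x. cmod (\<xi> x)) F * L2_set (\<lambda>x. cmod (\<eta> x)) F"
    by (rule L2_set_mult_ineq)
  also have "\<dots> = l2 \<xi> * l2 \<eta>"
    using l2_superset[OF F, of \<xi>] l2_superset[OF F, of \<eta>] by (auto simp: F_def)
  finally show ?thesis .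
qed

lemma inner2_self: "inner2 \<xi> \<xi> = complex_of_real ((l2 \<xi>)\<^sup>2)"
  by (simp add: inner2_def l2_def L2_set_def sum_nonneg complex_norm_square[symmetric])

text \<open>For each \<open>k\<close> the substitution \<open>x = \<tau> k y\<close> moves the translation to the other argument.\<close>

lemma rep_adjoint:
  assumes a: "a \<in> carrier A" and \<xi>: "\<xi> \<in> fin_supp" and \<eta>: "\<eta> \<in> fin_supp"
  shows "inner2 (rep a \<xi>) \<eta> = inner2 \<xi> (rep (star A a) \<eta>)"
proof -
  define Z where "Z = {x. \<xi> x \<noteq> 0}"
  have Z: "finite Z" "Z \<subseteq> S" using \<xi> by (auto simp: Z_def fin_supp_def)
  have fin: "finite (supp a)" using a carrierD by auto
  define F where "F = (\<Union>k\<in>supp a. \<tau> k ` Z)"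
  have F: "finite F" using Z fin by (simp add: F_def)
  have off: "a k x * \<xi> (\<tau> (- k) x) = 0" if "x \<notin> \<tau> k ` Z" for x k
  proof (rule ccontr)
    assume "a k x * \<xi> (\<tau> (- k) x) \<noteq> 0"
    then have "x \<in> S" "\<xi> (\<tau> (- k) x) \<noteq> 0" using carrier_off[OF a] by auto
    then have "\<tau> k (\<tau> (- k) x) \<in> \<tau> k ` Z" unfolding Z_def by blast
    then show False using \<open>x \<in> S\<close> that by simp
  qed
  have "rep a \<xi> x = 0" if "x \<notin> F" for x
    unfolding rep_eq by (intro sum.neutral ballI off) (use that in \<open>auto simp: F_def\<close>)
  then have "inner2 (rep a \<xi>) \<eta> = (\<Sum>x\<in>F. rep a \<xi> x * cnj (\<eta> x))"
    by (intro inner2_superset[OF F]) auto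
  also have "\<dots> = (\<Sum>k\<in>supp a. \<Sum>x\<in>F. a k x * \<xi> (\<tau> (- k) x) * cnj (\<eta> x))"
    unfolding rep_eq sum_distrib_right by (rule sum.swap)
  also have "\<dots> = (\<Sum>k\<in>supp a. \<Sum>y\<in>Z. \<xi> y * (a k (\<tau> k y) * cnj (\<eta> (\<tau> k y))))"
  proof (rule sum.cong[OF refl])
    fix k assume k: "k \<in> supp a"
    have inj: "inj_on (\<tau> k) Z"
      by (rule inj_on_inverseI[of _ "\<tau> (- k)"]) (use Z in auto)
    have "(\<Sum>x\<in>F. a k x * \<xi> (\<tau> (- k) x) * cnj (\<eta> x)) = (\<Sum>x\<in>\<tau> k ` Z. a k x * \<xi> (\<tau> (- k) x) * cnj (\<eta> x))"
      by (rule sum.mono_neutral_right[OF F]) (use k off in \<open>auto simp: F_def\<close>)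
    also have "\<dots> = (\<Sum>y\<in>Z. a k (\<tau> k y) * \<xi> (\<tau> (- k) (\<tau> k y)) * cnj (\<eta> (\<tau> k y)))"
      by (subst sum.reindex[OF inj]) simp
    also have "\<dots> = (\<Sum>y\<in>Z. \<xi> y * (a k (\<tau> k y) * cnj (\<eta> (\<tau> k y))))"
      by (rule sum.cong) (use Z in auto)
    finally show "(\<Sum>x\<in>F. a k x * \<xi> (\<tau> (- k) x) * cnj (\<eta> x))
      = (\<Sum>y\<in>Z. \<xi> y * (a k (\<tau> k y) * cnj (\<eta> (\<tau> k y))))" .
  qed
  also have "\<dots> = (\<Sum>y\<in>Z. \<xi> y * cnj (rep (star A a) \<eta> y))"
  proof (subst sum.swap, rule sum.cong[OF refl])
    fix y assume "y \<in> Z"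
    then have y: "y \<in> S" using Z by auto
    have "rep (star A a) \<eta> y = (\<Sum>k\<in>uminus ` supp a. star A a k y * \<eta> (\<tau> (- k) y))"
      unfolding rep_def
    proof (subst conv_superset[of "uminus ` supp a"])
      fix k assume k: "k \<notin> uminus ` supp a"
      have "- k \<notin> supp a"
      proof
        assume "- k \<in> supp a"
        then have "- (- k) \<in> uminus ` supp a" by (rule imageI)
        with k show False by simp
      qed
      then show "star A a k = (\<lambda>_. 0)" by (auto simp: fun_eq_iff star_A_apply)
    qed (use fin in simp_all)
    also have "\<dots> = (\<Sum>k\<in>supp a. cnj (a k (\<tau> k y)) * \<eta> (\<tau> k y))"
      by (subst sum.reindex) (use y in \<open>auto simp: star_A_apply\<close>)
    finally show "(\<Sum>k\<in>supp a. \<xi> y * (a k (\<tau> k y) * cnj (\<eta> (\<tau> k y)))) = \<xi> y * cnj (rep (star A a) \<eta> y)"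
      by (simp add: sum_distrib_left)
  qed
  also have "\<dots> = inner2 \<xi> (rep (star A a) \<eta>)"
    by (simp add: inner2_def Z_def)
  finally show ?thesis .
qed

definition rep_norm :: "(int \<Rightarrow> 'x \<Rightarrow> complex) \<Rightarrow> real" where
  "rep_norm a = (SUP \<xi>\<in>{\<xi> \<in> fin_supp. l2 \<xi> \<le> 1}. l2 (rep a \<xi>))"

lemma rep_norm_le: "(\<And>\<xi>. \<xi> \<in> fin_supp \<Longrightarrow> l2 \<xi> \<le> 1 \<Longrightarrow> l2 (rep a \<xi>) \<le> B) \<Longrightarrow> rep_norm a \<le> B"
  unfolding rep_norm_def by (rule cSUP_least) (auto intro!: exI[of _ "\<lambda>_. 0"])

lemma rep_le_rep_norm_unit:
  assumes a: "a \<in> carrier A" and "\<xi> \<in> fin_supp" "l2 \<xi> \<le> 1"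
  shows "l2 (rep a \<xi>) \<le> rep_norm a"
proof -
  obtain B where B: "B \<ge> 0" "\<And>\<xi>. \<xi> \<in> fin_supp \<Longrightarrow> rep a \<xi> \<in> fin_supp \<and> l2 (rep a \<xi>) \<le> B * l2 \<xi>"
    using rep_bounded[OF a] by metis
  have "l2 (rep a \<eta>) \<le> B" if "\<eta> \<in> fin_supp" "l2 \<eta> \<le> 1" for \<eta>
    using B(2)[OF that(1)] mult_left_mono[OF that(2) B(1)] by simp
  then have "bdd_above ((\<lambda>\<xi>. l2 (rep a \<xi>)) ` {\<xi> \<in> fin_supp. l2 \<xi> \<le> 1})"
    by (auto intro!: bdd_aboveI)
  then show ?thesis unfolding rep_norm_def using assms by (intro cSUP_upper) auto
qed

lemma rep_smult: "rep a (\<lambda>x. c * \<xi> x) = (\<lambda>x. c * rep a \<xi> x)"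
  by (simp add: rep_eq fun_eq_iff sum_distrib_left mult_ac)

lemma rep_le_rep_norm:
  assumes a: "a \<in> carrier A" and \<xi>: "\<xi> \<in> fin_supp"
  shows "l2 (rep a \<xi>) \<le> rep_norm a * l2 \<xi>"
proof (cases "l2 \<xi> = 0")
  case True
  obtain B where "l2 (rep a \<xi>) \<le> B * l2 \<xi>"
    using rep_bounded[OF a] \<xi> by metis
  then show ?thesis using True by simp
next
  case False
  then have pos: "l2 \<xi> > 0" using l2_nonneg[of \<xi>] by linarith
  define c where "c = complex_of_real (1 / l2 \<xi>)"
  have "cmod c = 1 / l2 \<xi>" using pos by (simp add: c_def norm_divide)
  then have "l2 (\<lambda>x. c * \<xi> x) \<le> 1" using l2_smult[OF \<xi>, of c] pos by simp
  then have "l2 (rep a (\<lambda>x. c * \<xi> x)) \<le> rep_norm a"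
    by (rule rep_le_rep_norm_unit[OF a fin_supp_smult[OF \<xi>]])
  then have "cmod c * l2 (rep a \<xi>) \<le> rep_norm a"
    using rep_closed[OF a \<xi>] by (simp add: rep_smult l2_smult)
  then show ?thesis using pos by (simp add: c_def norm_divide field_simps)
qed

lemma rep_norm_nonneg: "a \<in> carrier A \<Longrightarrow> 0 \<le> rep_norm a"
  using order_trans[OF l2_nonneg rep_le_rep_norm_unit[of a "\<lambda>_. 0"]] by simp

text \<open>The usual argument for operator norms on a Hilbert space: the adjoint relation and the
Cauchy-Schwarz inequality give \<open>\<parallel>a \<xi>\<parallel>\<^sup>2 = \<langle>\<xi>, a\<^sup>* a \<xi>\<rangle> \<le> \<parallel>a\<^sup>* a\<parallel>\<close>, hence first \<open>\<parallel>a\<parallel> \<le> \<parallel>a\<^sup>*\<parallel>\<close> and then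
the C*-identity.\<close>

lemma cstar_seminorm_rep_norm: "cstar_seminorm A rep_norm"
proof -
  interpret ring A by (rule ring_A)
  have smult_le: "rep_norm (c \<odot>\<^bsub>A\<^esub> a) \<le> cmod c * rep_norm a" if a: "a \<in> carrier A" for c a
  proof (rule rep_norm_le)
    fix \<xi> assume \<xi>: "\<xi> \<in> fin_supp" "l2 \<xi> \<le> 1"
    have "rep (c \<odot>\<^bsub>A\<^esub> a) \<xi> = (\<lambda>x. c * rep a \<xi> x)"
      by (simp add: rep_def smult_A conv_smult_left fun_eq_iff)
    then show "l2 (rep (c \<odot>\<^bsub>A\<^esub> a) \<xi>) \<le> cmod c * rep_norm a"
      using rep_closed[OF a] rep_le_rep_norm_unit[OF a] \<xi> by (simp add: l2_smult mult_left_mono)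
  qed
  have mult_le: "rep_norm (a \<otimes>\<^bsub>A\<^esub> b) \<le> rep_norm a * rep_norm b" if a: "a \<in> carrier A" and b: "b \<in> carrier A" for a b
  proof (rule rep_norm_le)
    fix \<xi> assume \<xi>: "\<xi> \<in> fin_supp" "l2 \<xi> \<le> 1"
    have "l2 (rep a (rep b \<xi>)) \<le> rep_norm a * l2 (rep b \<xi>)"
      by (rule rep_le_rep_norm[OF a rep_closed[OF b \<xi>(1)]])
    also have "\<dots> \<le> rep_norm a * rep_norm b"
      by (intro mult_left_mono rep_le_rep_norm_unit[OF b] \<xi> rep_norm_nonneg[OF a])
    finally show "l2 (rep (a \<otimes>\<^bsub>A\<^esub> b) \<xi>) \<le> rep_norm a * rep_norm b"
      using a b by (simp add: rep_mult)
  qed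
  have sq: "(l2 (rep a \<xi>))\<^sup>2 \<le> rep_norm (star A a \<otimes>\<^bsub>A\<^esub> a)" if a: "a \<in> carrier A" and \<xi>: "\<xi> \<in> fin_supp" "l2 \<xi> \<le> 1" for a \<xi>
  proof -
    note sa = star_closed_A[OF a]
    have "complex_of_real ((l2 (rep a \<xi>))\<^sup>2) = inner2 \<xi> (rep (star A a) (rep a \<xi>))"
      unfolding inner2_self[symmetric] by (rule rep_adjoint[OF a \<xi>(1) rep_closed[OF a \<xi>(1)]])
    then have "(l2 (rep a \<xi>))\<^sup>2 = cmod (inner2 \<xi> (rep (star A a) (rep a \<xi>)))"
      by (metis abs_of_nonneg norm_of_real zero_le_power2)
    also have "\<dots> \<le> l2 \<xi> * l2 (rep (star A a) (rep a \<xi>))"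
      by (intro inner2_cauchy_schwarz rep_closed a sa \<xi>)
    also have "\<dots> \<le> 1 * l2 (rep (star A a) (rep a \<xi>))"
      by (intro mult_right_mono \<xi>) simp
    also have "\<dots> \<le> rep_norm (star A a \<otimes>\<^bsub>A\<^esub> a)"
      using rep_le_rep_norm_unit[of "star A a \<otimes>\<^bsub>A\<^esub> a" \<xi>] a sa \<xi> by (simp add: rep_mult)
    finally show ?thesis .
  qed
  have le_star: "rep_norm a \<le> sqrt (rep_norm (star A a \<otimes>\<^bsub>A\<^esub> a))" if "a \<in> carrier A" for a
    by (rule rep_norm_le, rule real_le_rsqrt, rule sq[OF that])
  have sq_le: "(rep_norm a)\<^sup>2 \<le> rep_norm (star A a \<otimes>\<^bsub>A\<^esub> a)" if a: "a \<in> carrier A" for a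
  proof -
    have "(rep_norm a)\<^sup>2 \<le> (sqrt (rep_norm (star A a \<otimes>\<^bsub>A\<^esub> a)))\<^sup>2"
      using le_star[OF a] rep_norm_nonneg[OF a] by (rule power_mono)
    then show ?thesis using rep_norm_nonneg[of "star A a \<otimes>\<^bsub>A\<^esub> a"] a star_closed_A[OF a] by simp
  qed
  have star_ge: "rep_norm a \<le> rep_norm (star A a)" if a: "a \<in> carrier A" for a
  proof (cases "rep_norm a = 0")
    case True
    then show ?thesis using rep_norm_nonneg[OF star_closed_A[OF a]] by simp
  next
    case False
    have "rep_norm a * rep_norm a \<le> rep_norm (star A a) * rep_norm a"
      using sq_le[OF a] mult_le[OF star_closed_A[OF a] a] by (simp add: power2_eq_square)
    then show ?thesis using False rep_norm_nonneg[OF a] by (simp add: mult_le_cancel_right)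
  qed
  show ?thesis
    unfolding cstar_seminorm_def
  proof (intro conjI ballI allI)
    fix a assume a: "a \<in> carrier A"
    show "0 \<le> rep_norm a" by (rule rep_norm_nonneg[OF a])
    show "rep_norm (c \<odot>\<^bsub>A\<^esub> a) = cmod c * rep_norm a" for c
      by (rule homogeneous_if_subhomogeneous[OF rep_norm_nonneg smult_le a])
    have "star A (star A a) = a" using a by simp
    then have "rep_norm (star A a) \<le> rep_norm a"
      using star_ge[OF star_closed_A[OF a]] by simp
    then have "rep_norm (star A a) * rep_norm a \<le> rep_norm a * rep_norm a"
      using rep_norm_nonneg[OF a] by (rule mult_right_mono)
    then show "rep_norm (star A a \<otimes>\<^bsub>A\<^esub> a) = (rep_norm a)\<^sup>2"
      using sq_le[OF a] mult_le[OF star_closed_A[OF a] a] by (simp add: power2_eq_square)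
    fix b assume b: "b \<in> carrier A"
    show "rep_norm (a \<otimes>\<^bsub>A\<^esub> b) \<le> rep_norm a * rep_norm b" by (rule mult_le[OF a b])
    show "rep_norm (a \<oplus>\<^bsub>A\<^esub> b) \<le> rep_norm a + rep_norm b"
    proof (rule rep_norm_le)
      fix \<xi> assume \<xi>: "\<xi> \<in> fin_supp" "l2 \<xi> \<le> 1"
      have "rep (a \<oplus>\<^bsub>A\<^esub> b) \<xi> = (\<lambda>x. rep a \<xi> x + rep b \<xi> x)"
        using a b by (simp add: rep_add fun_eq_iff)
      then have "l2 (rep (a \<oplus>\<^bsub>A\<^esub> b) \<xi>) \<le> l2 (rep a \<xi>) + l2 (rep b \<xi>)"
        using l2_add[OF rep_closed[OF a \<xi>(1)] rep_closed[OF b \<xi>(1)]] by simp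
      then show "l2 (rep (a \<oplus>\<^bsub>A\<^esub> b) \<xi>) \<le> rep_norm a + rep_norm b"
        using rep_le_rep_norm_unit[OF a \<xi>] rep_le_rep_norm_unit[OF b \<xi>] by linarith
    qed
  qed
qed

lemma rep_monomial: "rep (monomial f n) \<xi> x = f x * \<xi> (\<tau> (- n) x)"
  by (simp add: rep_def conv_monomial_left)

text \<open>Evaluate at the indicator function of \<open>\<tau> (- n) x\<close>, which \<open>f \<delta>\<^sup>n\<close> sends to \<open>f(x)\<close> times the indicator
function of \<open>x\<close>.\<close>

lemma le_rep_norm_monomial:
  assumes f: "f \<in> cont_funs X"
  shows "cmod (f x) \<le> rep_norm (monomial f n)"
proof (cases "x \<in> S")
  case False
  then show ?thesis using cont_funs_off[OF f] rep_norm_nonneg[of "monomial f n"] f by simp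
next
  case x: True
  define \<xi> where "\<xi> = (\<lambda>y. if y = \<tau> (- n) x then 1 else 0 :: complex)"
  have \<xi>: "\<xi> \<in> fin_supp"
    by (rule fin_suppI[of "{\<tau> (- n) x}"]) (use x in \<open>auto simp: \<xi>_def\<close>)
  have "{y. \<xi> y \<noteq> 0} = {\<tau> (- n) x}" by (auto simp: \<xi>_def)
  then have l: "l2 \<xi> = 1" by (simp add: l2_def L2_set_def \<xi>_def)
  define \<eta> where "\<eta> = rep (monomial f n) \<xi>"
  have \<eta>: "\<eta> \<in> fin_supp" unfolding \<eta>_def using f \<xi> by (intro rep_closed) auto
  have fin: "finite (insert x {y. \<eta> y \<noteq> 0})" using \<eta> by (simp add: fin_supp_def)
  have "cmod (f x) = cmod (\<eta> x)" by (simp add: \<eta>_def rep_monomial \<xi>_def)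
  also have "\<dots> \<le> L2_set (\<lambda>y. cmod (\<eta> y)) (insert x {y. \<eta> y \<noteq> 0})"
    by (rule member_le_L2_set[OF fin]) simp
  also have "\<dots> = l2 \<eta>" by (rule l2_superset[OF fin, symmetric]) auto
  also have "\<dots> \<le> rep_norm (monomial f n)"
    unfolding \<eta>_def using rep_le_rep_norm_unit[of "monomial f n" \<xi>] f \<xi> l by simp
  finally show ?thesis .
qed

text \<open>The action on the space cannot distinguish \<open>\<delta>\<^sup>n\<close> from the unit where \<open>\<tau> n\<close> is the identity. This
produces the nonzero kernel in the case of a system that is not topologically free.\<close>

lemma rep_norm_fixed:
  assumes f: "f \<in> cont_funs X" and fixed: "\<And>x. f x \<noteq> 0 \<Longrightarrow> \<tau> n x = x"
  shows "rep_norm (monomial f 0 \<ominus>\<^bsub>A\<^esub> monomial f n) = 0"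
proof (rule antisym)
  show "rep_norm (monomial f 0 \<ominus>\<^bsub>A\<^esub> monomial f n) \<le> 0"
  proof (rule rep_norm_le)
    fix \<xi>
    have "rep (monomial f 0 \<ominus>\<^bsub>A\<^esub> monomial f n) \<xi> x = f x * \<xi> x - f x * \<xi> (\<tau> (- n) x)" for x
      using f by (simp add: rep_minus rep_monomial)
    moreover have "f x * \<xi> x = f x * \<xi> (\<tau> (- n) x)" for x
      using fixed[of x] \<tau>_fixed_neg[of x n] cont_funs_off[OF f, of x] by (cases "f x = 0"; cases "x \<in> S") simp_all
    ultimately have "rep (monomial f 0 \<ominus>\<^bsub>A\<^esub> monomial f n) \<xi> = (\<lambda>_. 0)" by auto
    then show "l2 (rep (monomial f 0 \<ominus>\<^bsub>A\<^esub> monomial f n) \<xi>) \<le> 0" by simp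
  qed
  show "0 \<le> rep_norm (monomial f 0 \<ominus>\<^bsub>A\<^esub> monomial f n)"
    using f by (intro rep_norm_nonneg cp.minus_closed) auto
qed

section \<open>The gauge action\<close>

text \<open>The automorphism that sends \<open>\<delta>\<close> to \<open>cis \<theta> \<delta>\<close> and fixes the functions.\<close>

definition gauge_action :: "real \<Rightarrow> (int \<Rightarrow> 'x \<Rightarrow> complex) \<Rightarrow> int \<Rightarrow> 'x \<Rightarrow> complex" where
  "gauge_action \<theta> a = (\<lambda>n x. cis (\<theta> * of_int n) * a n x)"

lemma multiplier_closed: "a \<in> carrier A \<Longrightarrow> (\<lambda>n x. m n * a n x) \<in> carrier A"
  by (rule carrierI[of _ "supp a"]) (auto simp: carrier_iff)

lemma gauge_closed: "a \<in> carrier A \<Longrightarrow> gauge_action \<theta> a \<in> carrier A"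
  unfolding gauge_action_def by (rule multiplier_closed)

lemma gauge_mult:
  assumes a: "a \<in> carrier A"
  shows "gauge_action \<theta> (a \<otimes>\<^bsub>A\<^esub> b) = gauge_action \<theta> a \<otimes>\<^bsub>A\<^esub> gauge_action \<theta> b"
proof -
  have supp: "supp (gauge_action \<theta> a) = supp a" by (auto simp: gauge_action_def fun_eq_iff)
  have e: "cis (\<theta> * of_int n) = cis (\<theta> * of_int k) * cis (\<theta> * of_int (n - k))" for n k
    by (simp add: cis_mult right_diff_distrib)
  have "gauge_action \<theta> (conv a b) n x = conv (gauge_action \<theta> a) (gauge_action \<theta> b) n x" for n x
    unfolding conv_def[of "gauge_action \<theta> a"] supp unfolding gauge_action_def conv_def sum_distrib_left
  proof (rule sum.cong[OF refl])
    fix k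
    show "cis (\<theta> * of_int n) * (a k x * b (n - k) (\<tau> (- k) x))
      = cis (\<theta> * of_int k) * a k x * (cis (\<theta> * of_int (n - k)) * b (n - k) (\<tau> (- k) x))"
      by (subst e[of n k]) (simp only: mult_ac)
  qed
  then have "gauge_action \<theta> (conv a b) = conv (gauge_action \<theta> a) (gauge_action \<theta> b)" by (simp add: fun_eq_iff)
  then show ?thesis using a gauge_closed[OF a] by (simp add: mult_A)
qed

lemma gauge_star: "gauge_action \<theta> (star A a) = star A (gauge_action \<theta> a)"
  by (simp add: gauge_action_def fun_eq_iff star_A_apply cis_cnj)

text \<open>Composing a C*-seminorm with a star-endomorphism gives a C*-seminorm, and \<open>P\<close> is the largest one.\<close>

lemma P_gauge:
  assumes a: "a \<in> carrier A"
  shows "P (gauge_action \<theta> a) \<le> P a"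
proof (rule P_le)
  fix p assume p: "cstar_seminorm A p"
  have "gauge_action \<theta> (b \<oplus>\<^bsub>A\<^esub> c) = gauge_action \<theta> b \<oplus>\<^bsub>A\<^esub> gauge_action \<theta> c" for b c
    by (simp add: gauge_action_def add_A distrib_left)
  moreover have "gauge_action \<theta> (z \<odot>\<^bsub>A\<^esub> b) = z \<odot>\<^bsub>A\<^esub> gauge_action \<theta> b" for z b
    by (simp add: gauge_action_def smult_A mult_ac)
  ultimately have "cstar_seminorm A (\<lambda>b. p (gauge_action \<theta> b))"
    using p by (simp add: cstar_seminorm_def gauge_closed gauge_mult gauge_star star_closed_A)
  then show "p (gauge_action \<theta> a) \<le> P a" using le_P a by blast
qed

lemma P_average_gauge:
  assumes "finite J" and a: "a \<in> carrier A"
  shows "P (\<lambda>n x. (\<Sum>j\<in>J. c j * cis (\<theta> j * of_int n)) * a n x) \<le> (\<Sum>j\<in>J. cmod (c j)) * P a"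
  using assms(1)
proof (induction J rule: finite_induct)
  case empty
  have "(\<lambda>n x. (\<Sum>j\<in>{}. c j * cis (\<theta> j * of_int n)) * a n x) = \<zero>\<^bsub>A\<^esub>" by (simp add: zero_A)
  then show ?case using cp.p_zero by simp
next
  case (insert j J)
  let ?b = "\<lambda>n x. (\<Sum>j\<in>J. c j * cis (\<theta> j * of_int n)) * a n x"
  have b: "?b \<in> carrier A" by (rule multiplier_closed[OF a])
  have eq: "(\<lambda>n x. (\<Sum>j\<in>insert j J. c j * cis (\<theta> j * of_int n)) * a n x) = (c j \<odot>\<^bsub>A\<^esub> gauge_action (\<theta> j) a) \<oplus>\<^bsub>A\<^esub> ?b"
    using insert by (simp add: add_A smult_A gauge_action_def algebra_simps)
  have "P ((c j \<odot>\<^bsub>A\<^esub> gauge_action (\<theta> j) a) \<oplus>\<^bsub>A\<^esub> ?b) \<le> P (c j \<odot>\<^bsub>A\<^esub> gauge_action (\<theta> j) a) + P ?b"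
    by (intro cp.p_add smult_closed_A gauge_closed a b)
  moreover have "P (c j \<odot>\<^bsub>A\<^esub> gauge_action (\<theta> j) a) = cmod (c j) * P (gauge_action (\<theta> j) a)"
    by (intro cp.p_smult gauge_closed a)
  moreover have "cmod (c j) * P (gauge_action (\<theta> j) a) \<le> cmod (c j) * P a"
    by (intro mult_left_mono P_gauge a) simp
  moreover have "(\<Sum>j\<in>insert j J. cmod (c j)) * P a = cmod (c j) * P a + (\<Sum>j\<in>J. cmod (c j)) * P a"
    using insert.hyps by (simp add: distrib_right)
  ultimately show ?case unfolding eq using insert.IH by linarith
qed

text \<open>Averaging \<open>z\<^bsup>-n\<^esup>\<close> times the gauge automorphism of \<open>z\<close> over all \<open>m\<close>-th roots of unity \<open>z\<close> leaves only the
coefficient at \<open>n\<close>, provided that no other index in the support is congruent to \<open>n\<close> modulo \<open>m\<close>.\<close>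

lemma P_coefficient:
  assumes a: "a \<in> carrier A"
  shows "P (monomial (a n) n) \<le> P a"
proof -
  have "finite ((\<lambda>k. nat \<bar>k - n\<bar>) ` supp a)" using carrierD[OF a] by simp
  then obtain m0 where m0: "\<forall>i\<in>(\<lambda>k. nat \<bar>k - n\<bar>) ` supp a. i < m0"
    using finite_nat_set_iff_bounded by blast
  define m where "m = Suc m0"
  have m: "\<bar>k - n\<bar> < int m" if "k \<in> supp a" for k using m0 that by (auto simp: m_def)
  have m_pos: "m > 0" by (simp add: m_def)
  define \<theta> where "\<theta> = (\<lambda>j. 2 * pi * real j / real m)"
  define c where "c = (\<lambda>j. cis (- \<theta> j * of_int n) / of_nat m)"
  have "(\<Sum>j<m. c j * cis (\<theta> j * of_int k)) * a k x = monomial (a n) n k x" for k x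
  proof (cases "k \<in> supp a")
    case True
    have "(\<Sum>j<m. c j * cis (\<theta> j * of_int k)) = (\<Sum>j<m. cis (\<theta> j * of_int (k - n))) / of_nat m"
      by (simp add: c_def sum_divide_distrib cis_mult algebra_simps)
    also have "\<dots> = (if k = n then 1 else 0)"
      using sum_roots_of_unity[OF m[OF True]] m_pos by (simp add: \<theta>_def)
    finally show ?thesis by (simp add: monomial_def)
  next
    case False
    then show ?thesis by (auto simp: monomial_def)
  qed
  then have "monomial (a n) n = (\<lambda>k x. (\<Sum>j<m. c j * cis (\<theta> j * of_int k)) * a k x)"
    by (simp add: fun_eq_iff)
  moreover have "P (\<lambda>k x. (\<Sum>j<m. c j * cis (\<theta> j * of_int k)) * a k x) \<le> (\<Sum>j<m. cmod (c j)) * P a"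
    by (rule P_average_gauge) (simp_all add: a)
  moreover have "(\<Sum>j<m. cmod (c j)) = 1" using m_pos by (simp add: c_def norm_divide)
  ultimately show ?thesis by simp
qed

lemma coefficient_le_P:
  assumes a: "a \<in> carrier A"
  shows "cmod (a n x) \<le> P a"
proof -
  have an: "a n \<in> cont_funs X" using carrierD[OF a] by simp
  have "cmod (a n x) \<le> rep_norm (monomial (a n) n)" by (rule le_rep_norm_monomial[OF an])
  also have "\<dots> \<le> P (monomial (a n) n)" by (rule le_P[OF cstar_seminorm_rep_norm]) (simp add: an)
  also have "\<dots> \<le> P a" by (rule P_coefficient[OF a])
  finally show ?thesis .
qed

text \<open>The average with Fejer weights is a convex combination of gauge automorphisms.\<close>

lemma P_fejer:
  assumes a: "a \<in> carrier A" and N: "N > 0"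
  shows "P (\<lambda>n x. complex_of_real (fejer N n) * a n x) \<le> P a"
proof -
  have "finite ((\<lambda>k. nat \<bar>k\<bar>) ` supp a)" using carrierD[OF a] by simp
  then obtain m0 where m0: "\<forall>i\<in>(\<lambda>k. nat \<bar>k\<bar>) ` supp a. i < m0"
    using finite_nat_set_iff_bounded by blast
  define m where "m = 2 * N + m0 + 1"
  have m: "2 * int N + \<bar>k\<bar> < int m" if "k \<in> supp a" for k using m0 that by (auto simp: m_def)
  have m': "2 * int N + \<bar>0\<bar> < int m" by (simp add: m_def)
  define \<theta> where "\<theta> = (\<lambda>j. 2 * pi * real j / real m)"
  define r where "r = (\<lambda>j. (cmod (\<Sum>k<N. cis (\<theta> j * real k)))\<^sup>2 / (real m * real N))"
  have r_nonneg: "r j \<ge> 0" for j by (simp add: r_def)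
  have "complex_of_real (fejer N k) * a k x = (\<Sum>j<m. complex_of_real (r j) * cis (\<theta> j * of_int k)) * a k x" for k x
    using fejer_as_average[OF N m, of k] by (cases "k \<in> supp a") (simp_all add: r_def \<theta>_def)
  then have "(\<lambda>n x. complex_of_real (fejer N n) * a n x) = (\<lambda>k x. (\<Sum>j<m. complex_of_real (r j) * cis (\<theta> j * of_int k)) * a k x)"
    by (simp add: fun_eq_iff)
  moreover have "P (\<lambda>k x. (\<Sum>j<m. complex_of_real (r j) * cis (\<theta> j * of_int k)) * a k x)
      \<le> (\<Sum>j<m. cmod (complex_of_real (r j))) * P a"
    by (rule P_average_gauge) (simp_all add: a)
  moreover have "(\<Sum>j<m. cmod (complex_of_real (r j))) = (\<Sum>j<m. r j)"
    by (simp add: r_nonneg)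
  moreover have "complex_of_real (\<Sum>j<m. r j) = 1"
    using fejer_as_average[OF N m'] fejer_0[OF N] by (simp add: r_def \<theta>_def)
  then have "(\<Sum>j<m. r j) = 1" by (metis of_real_eq_1_iff)
  ultimately show ?thesis by simp
qed

section \<open>Fourier coefficients on the completion\<close>

text \<open>The heart of the injectivity of the Fourier transform. Compare \<open>s j\<close> with a fixed late term \<open>a\<close> and
with the Fejer means of \<open>a\<close> and of \<open>s j\<close>: the mean of \<open>a\<close> is close to \<open>a\<close> for large \<open>N\<close>, the means are
contractive, and the mean of \<open>s j\<close> has only finitely many coefficients, all of them small.\<close>

lemma null_if_coefficients_null:
  assumes s: "s \<in> cp.Cau"
    and coef: "\<And>n e. e > 0 \<Longrightarrow> \<exists>J. \<forall>j\<ge>J. \<forall>x. cmod (s j n x) \<le> e"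
  shows "(\<lambda>j. P (s j)) \<longlonglongrightarrow> 0"
proof (rule LIMSEQ_I)
  fix e :: real assume e: "e > 0"
  note sA [simp] = cp.cauchy_carrier[OF s]
  have "e / 5 > 0" using e by simp
  then obtain J where J: "\<And>i j. \<lbrakk>i \<ge> J; j \<ge> J\<rbrakk> \<Longrightarrow> P (s i \<ominus>\<^bsub>A\<^esub> s j) < e / 5"
    by (rule cp.cauchyD[OF s]) blast
  define a where "a = s J"
  have a: "a \<in> carrier A" by (simp add: a_def)
  obtain M where M: "M \<ge> 0" "\<And>k x. cmod (a k x) \<le> M" using carrier_bounded[OF a] by metis
  have "(\<lambda>N. \<Sum>k\<in>supp a. (1 - fejer N k) * M) \<longlonglongrightarrow> (\<Sum>k\<in>supp a. (1 - 1) * M)"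
    by (intro tendsto_intros fejer_tendsto)
  then have "(\<lambda>N. \<Sum>k\<in>supp a. (1 - fejer N k) * M) \<longlonglongrightarrow> 0" by simp
  from tendsto_0_D[OF this \<open>e / 5 > 0\<close>]
  obtain N0 where N0: "\<And>N. N \<ge> N0 \<Longrightarrow> (\<Sum>k\<in>supp a. (1 - fejer N k) * M) < e / 5" by blast
  define N where "N = Suc N0"
  have N: "N > 0" "(\<Sum>k\<in>supp a. (1 - fejer N k) * M) < e / 5" using N0 by (auto simp: N_def)
  define F where "F b = (\<lambda>n x. complex_of_real (fejer N n) * b n x)" for b :: "int \<Rightarrow> 'x \<Rightarrow> complex"
  have F [simp]: "F b \<in> carrier A" if "b \<in> carrier A" for b
    unfolding F_def by (rule multiplier_closed[OF that])
  have Fa: "P (a \<ominus>\<^bsub>A\<^esub> F a) < e / 5"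
  proof -
    have "P (a \<ominus>\<^bsub>A\<^esub> F a) \<le> (\<Sum>k\<in>supp a. (1 - fejer N k) * M)"
    proof (rule seminorm_le_l1[OF cstar_seminorm_P])
      show "finite (supp a)" using a carrierD by auto
      show "a \<ominus>\<^bsub>A\<^esub> F a \<in> carrier A" using a F by simp
      show "(a \<ominus>\<^bsub>A\<^esub> F a) k = (\<lambda>_. 0)" if "k \<notin> supp a" for k
        using that F[OF a] by (simp add: minus_A) (simp add: F_def)
      have eq: "(a \<ominus>\<^bsub>A\<^esub> F a) k x = complex_of_real (1 - fejer N k) * a k x" for k x
        using F[OF a] by (simp add: minus_A) (simp add: F_def algebra_simps)
      show "cmod ((a \<ominus>\<^bsub>A\<^esub> F a) k x) \<le> (1 - fejer N k) * M" for k x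
        unfolding eq norm_mult norm_of_real using fejer_le_1[of N k] M by (intro mult_mono) auto
    qed
    then show ?thesis using N by simp
  qed
  define L where "L = {- int N..int N}"
  define e' where "e' = e / (5 * real (card L))"
  have cL: "real (card L) > 0" by (simp add: L_def)
  then have "e' > 0" using e by (simp add: e'_def)
  have "\<forall>n. \<exists>J. \<forall>j\<ge>J. \<forall>x. cmod (s j n x) \<le> e'" using coef[OF \<open>e' > 0\<close>] by blast
  then obtain J' where J': "\<And>n j x. j \<ge> J' n \<Longrightarrow> cmod (s j n x) \<le> e'" by metis
  define J1 where "J1 = Max (J' ` L)"
  have J1: "J' n \<le> J1" if "n \<in> L" for n
    unfolding J1_def using that by (intro Max_ge) (auto simp: L_def)
  have "norm (P (s j) - 0) < e" if j: "j \<ge> max J J1" for j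
  proof -
    have "P (F (s j)) \<le> (\<Sum>k\<in>L. e')"
    proof (rule seminorm_le_l1[OF cstar_seminorm_P])
      show "F (s j) k = (\<lambda>_. 0)" if "k \<notin> L" for k
        using that fejer_zero[of N k] by (auto simp: F_def L_def)
      show "cmod (F (s j) k x) \<le> e'" if "k \<in> L" for k x
      proof -
        have "cmod (F (s j) k x) = fejer N k * cmod (s j k x)"
          using fejer_le_1[of N k] by (simp add: F_def norm_mult)
        also have "\<dots> \<le> 1 * e'"
          using fejer_le_1[of N k] J'[of k j x] J1[OF that] j by (intro mult_mono) auto
        finally show ?thesis by simp
      qed
    qed (simp_all add: L_def)
    also have "\<dots> = e / 5" using cL by (simp add: e'_def)
    finally have 1: "P (F (s j)) \<le> e / 5" .
    have "F a \<ominus>\<^bsub>A\<^esub> F (s j) = F (a \<ominus>\<^bsub>A\<^esub> s j)"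
      by (simp add: minus_A) (simp add: F_def algebra_simps)
    then have "P (F a \<ominus>\<^bsub>A\<^esub> F (s j)) \<le> P (a \<ominus>\<^bsub>A\<^esub> s j)"
      using P_fejer[of "a \<ominus>\<^bsub>A\<^esub> s j" N] a N by (simp add: F_def)
    also have "\<dots> < e / 5" unfolding a_def by (rule J) (use j in auto)
    finally have 2: "P (F a \<ominus>\<^bsub>A\<^esub> F (s j)) < e / 5" .
    have 3: "P (s j \<ominus>\<^bsub>A\<^esub> a) < e / 5" unfolding a_def by (rule J) (use j in auto)
    have z: "\<zero>\<^bsub>A\<^esub> \<in> carrier A" by simp
    have "x \<ominus>\<^bsub>A\<^esub> \<zero>\<^bsub>A\<^esub> = x" if "x \<in> carrier A" for x
      using that by (simp add: minus_A) (simp add: zero_A)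
    then have "P (s j) = P (s j \<ominus>\<^bsub>A\<^esub> \<zero>\<^bsub>A\<^esub>)" "P (F (s j)) = P (F (s j) \<ominus>\<^bsub>A\<^esub> \<zero>\<^bsub>A\<^esub>)" by simp_all
    then have "P (s j) \<le> P (s j \<ominus>\<^bsub>A\<^esub> a) + (P (a \<ominus>\<^bsub>A\<^esub> F a) + (P (F a \<ominus>\<^bsub>A\<^esub> F (s j)) + P (F (s j))))"
      using cp.p_triangle[of "s j" a "\<zero>\<^bsub>A\<^esub>"] cp.p_triangle[of a "F a" "\<zero>\<^bsub>A\<^esub>"]
        cp.p_triangle[of "F a" "F (s j)" "\<zero>\<^bsub>A\<^esub>"] a by simp
    then have "P (s j) < e" using 1 2 3 Fa e by linarith
    then show ?thesis using P_nonneg[of "s j"] by simp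
  qed
  then show "\<exists>no. \<forall>j\<ge>no. norm (P (s j) - 0) < e" by blast
qed

text \<open>The coefficients of a Cauchy sequence, which depend on its class only. The limit exists because
coefficients are bounded by \<open>P\<close>.\<close>

definition coef :: "(nat \<Rightarrow> int \<Rightarrow> 'x \<Rightarrow> complex) \<Rightarrow> int \<Rightarrow> 'x \<Rightarrow> complex" where
  "coef s n x = lim (\<lambda>j. s j n x)"

lemma coefficient_diff_le:
  assumes "a \<in> carrier A" "b \<in> carrier A"
  shows "cmod (a n x - b n x) \<le> P (a \<ominus>\<^bsub>A\<^esub> b)"
  using coefficient_le_P[OF cp.minus_closed[OF assms], of n x] by (simp add: minus_A[OF assms(2)])

lemma coef_tendsto:
  assumes s: "s \<in> cp.Cau"
  shows "(\<lambda>j. s j n x) \<longlonglongrightarrow> coef s n x"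
proof -
  have "Cauchy (\<lambda>j. s j n x)"
  proof (rule metric_CauchyI)
    fix e :: real assume "e > 0"
    then obtain N where N: "\<And>i j. \<lbrakk>i \<ge> N; j \<ge> N\<rbrakk> \<Longrightarrow> P (s i \<ominus>\<^bsub>A\<^esub> s j) < e"
      by (rule cp.cauchyD[OF s]) blast
    have "dist (s i n x) (s j n x) < e" if "i \<ge> N" "j \<ge> N" for i j
      using N[OF that] coefficient_diff_le[of "s i" "s j" n x] cp.cauchy_carrier[OF s]
      by (simp add: dist_norm)
    then show "\<exists>M. \<forall>i\<ge>M. \<forall>j\<ge>M. dist (s i n x) (s j n x) < e" by blast
  qed
  then show ?thesis by (simp add: coef_def Cauchy_convergent_iff convergent_LIMSEQ_iff)
qed

lemma coef_uniform:
  assumes s: "s \<in> cp.Cau" and e: "e > 0"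
  obtains J where "\<And>j n x. j \<ge> J \<Longrightarrow> cmod (s j n x - coef s n x) \<le> e"
proof -
  obtain J where J: "\<And>i j. \<lbrakk>i \<ge> J; j \<ge> J\<rbrakk> \<Longrightarrow> P (s i \<ominus>\<^bsub>A\<^esub> s j) < e"
    using e by (rule cp.cauchyD[OF s]) blast
  have "cmod (s j n x - coef s n x) \<le> e" if "j \<ge> J" for j n x
  proof (rule tendsto_upperbound)
    show "(\<lambda>i. cmod (s j n x - s i n x)) \<longlonglongrightarrow> cmod (s j n x - coef s n x)"
      by (intro tendsto_intros coef_tendsto s)
    have "cmod (s j n x - s i n x) \<le> e" if "i \<ge> J" for i
      using J[OF \<open>j \<ge> J\<close> that] coefficient_diff_le[of "s j" "s i" n x] cp.cauchy_carrier[OF s] by simp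
    then show "\<forall>\<^sub>F i in sequentially. cmod (s j n x - s i n x) \<le> e"
      by (auto simp: eventually_sequentially)
  qed simp
  then show ?thesis using that by blast
qed

text \<open>A uniform limit of continuous functions.\<close>

lemma coef_cont:
  assumes s: "s \<in> cp.Cau"
  shows "coef s n \<in> cont_funs X"
proof -
  have sn: "s j n \<in> cont_funs X" for j using cp.cauchy_carrier[OF s] carrierD by blast
  have "continuous_map X euclidean (coef s n)"
  proof -
    have "\<forall>\<^sub>F j in sequentially. \<forall>x\<in>S. coef s n x \<in> UNIV \<and> dist (s j n x) (coef s n x) < e" if "e > 0" for e
    proof -
      have "e / 2 > 0" using that by simp
      then obtain J where "\<And>j n x. j \<ge> J \<Longrightarrow> cmod (s j n x - coef s n x) \<le> e / 2"
        by (rule coef_uniform[OF s]) blast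
      then have "dist (s j n x) (coef s n x) < e" if "j \<ge> J" for j x
        using that \<open>e / 2 > 0\<close> unfolding dist_norm by (smt (verit) field_sum_of_halves)
      then show ?thesis by (auto simp: eventually_sequentially)
    qed
    moreover have "\<forall>\<^sub>F j in sequentially. continuous_map X euclidean (s j n)"
      using sn by (simp add: cont_funs_def)
    ultimately show ?thesis
      using Met_TC.continuous_map_uniform_limit[where F = sequentially and X = X and f = "\<lambda>j. s j n" and g = "coef s n"]
      by simp
  qed
  moreover have "coef s n x = 0" if "x \<notin> S" for x
    using coef_tendsto[OF s, of n x] cont_funs_off[OF sn that] by (simp add: LIMSEQ_const_iff)
  ultimately show ?thesis by (simp add: cont_funs_def)
qed

lemma coef_const: "coef (\<lambda>_. a) = a"
  by (simp add: coef_def fun_eq_iff)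

lemma coef_eqI:
  assumes "s \<in> cp.Cau" and "\<And>n x. (\<lambda>j. s j n x) \<longlonglongrightarrow> f n x"
  shows "coef s n x = f n x"
  using LIMSEQ_unique[OF coef_tendsto[OF assms(1)] assms(2)] .

lemma cls_eq_iff_coef:
  assumes s: "s \<in> cp.Cau" and t: "t \<in> cp.Cau"
  shows "cp.cls s = cp.cls t \<longleftrightarrow> coef s = coef t"
proof
  assume "cp.cls s = cp.cls t"
  then have lim: "(\<lambda>j. P (s j \<ominus>\<^bsub>A\<^esub> t j)) \<longlonglongrightarrow> 0" using s t by (simp add: cp.cls_eq_iff)
  show "coef s = coef t"
  proof (intro ext)
    fix n x
    have "(\<lambda>j. s j n x - t j n x) \<longlonglongrightarrow> 0"
      by (rule Lim_null_comparison[OF _ lim])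
        (use coefficient_diff_le cp.cauchy_carrier[OF s] cp.cauchy_carrier[OF t] in auto)
    moreover have "(\<lambda>j. s j n x - t j n x) \<longlonglongrightarrow> coef s n x - coef t n x"
      by (intro tendsto_intros coef_tendsto s t)
    ultimately show "coef s n x = coef t n x"
      using LIMSEQ_unique by fastforce
  qed
next
  assume eq: "coef s = coef t"
  have "(\<lambda>j. P (s j \<ominus>\<^bsub>A\<^esub> t j)) \<longlonglongrightarrow> 0"
  proof (rule null_if_coefficients_null)
    show "(\<lambda>j. s j \<ominus>\<^bsub>A\<^esub> t j) \<in> cp.Cau" using s t by (rule cp.minus_cauchy)
    fix n :: int and e :: real assume "e > 0"
    then have e: "e / 2 > 0" by simp
    obtain J1 where J1: "\<And>j n x. j \<ge> J1 \<Longrightarrow> cmod (s j n x - coef s n x) \<le> e / 2"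
      using coef_uniform[OF s e] by metis
    obtain J2 where J2: "\<And>j n x. j \<ge> J2 \<Longrightarrow> cmod (t j n x - coef t n x) \<le> e / 2"
      using coef_uniform[OF t e] by metis
    have "cmod ((s j \<ominus>\<^bsub>A\<^esub> t j) n x) \<le> e" if "j \<ge> max J1 J2" for j x
    proof -
      have "(s j \<ominus>\<^bsub>A\<^esub> t j) n x = (s j n x - coef s n x) - (t j n x - coef t n x)"
        using cp.cauchy_carrier[OF t] eq by (simp add: minus_A)
      also have "cmod \<dots> \<le> e / 2 + e / 2"
        by (rule order_trans[OF norm_triangle_ineq4]) (intro add_mono J1 J2; use that in simp)
      finally show ?thesis by simp
    qed
    then show "\<exists>J. \<forall>j\<ge>J. \<forall>x. cmod ((s j \<ominus>\<^bsub>A\<^esub> t j) n x) \<le> e" by blast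
  qed
  then show "cp.cls s = cp.cls t" using s t by (simp add: cp.cls_eq_iff)
qed

section \<open>Coefficients of products with monomials\<close>

lemma crossed_product_eq: "crossed_product X \<sigma> = cp.C"
  by (simp add: crossed_product_def enveloping_cstar_def)

lemma canonical_copy_eq: "canonical_copy X \<sigma> = (\<lambda>f. cp.cls (\<lambda>_. monomial f 0)) ` cont_funs X"
  by (simp add: canonical_copy_def to_enveloping_def)

lemma monomial_mult_left: "f \<in> cont_funs X \<Longrightarrow> (monomial f m \<otimes>\<^bsub>A\<^esub> a) n x = f x * a (n - m) (\<tau> (- m) x)"
  by (simp add: mult_A conv_monomial_left)

lemma monomial_mult_right: "a \<in> carrier A \<Longrightarrow> (a \<otimes>\<^bsub>A\<^esub> monomial g m) n x = a (n - m) x * g (\<tau> (m - n) x)"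
  by (simp add: mult_A conv_monomial_right)

lemma coef_mult_left:
  assumes f: "f \<in> cont_funs X" and s: "s \<in> cp.Cau"
  shows "coef (\<lambda>j. monomial f m \<otimes>\<^bsub>A\<^esub> s j) n x = f x * coef s (n - m) (\<tau> (- m) x)"
proof (rule coef_eqI)
  show "(\<lambda>j. monomial f m \<otimes>\<^bsub>A\<^esub> s j) \<in> cp.Cau" using f s by (intro cp.mult_cauchy) auto
  show "(\<lambda>j. (monomial f m \<otimes>\<^bsub>A\<^esub> s j) n x) \<longlonglongrightarrow> f x * coef s (n - m) (\<tau> (- m) x)" for n x
    unfolding monomial_mult_left[OF f] by (intro tendsto_intros coef_tendsto s)
qed

lemma coef_mult_right:
  assumes g: "g \<in> cont_funs X" and s: "s \<in> cp.Cau"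
  shows "coef (\<lambda>j. s j \<otimes>\<^bsub>A\<^esub> monomial g m) n x = coef s (n - m) x * g (\<tau> (m - n) x)"
proof (rule coef_eqI)
  show "(\<lambda>j. s j \<otimes>\<^bsub>A\<^esub> monomial g m) \<in> cp.Cau" using g s by (intro cp.mult_cauchy) auto
  show "(\<lambda>j. (s j \<otimes>\<^bsub>A\<^esub> monomial g m) n x) \<longlonglongrightarrow> coef s (n - m) x * g (\<tau> (m - n) x)" for n x
    unfolding monomial_mult_right[OF cp.cauchy_carrier[OF s]] by (intro tendsto_intros coef_tendsto s)
qed

lemma cls_nonzero_iff:
  assumes "s \<in> cp.Cau"
  shows "cp.cls s \<noteq> \<zero>\<^bsub>cp.C\<^esub> \<longleftrightarrow> (\<exists>n x. coef s n x \<noteq> 0)"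
proof -
  have "(\<lambda>_. \<zero>\<^bsub>A\<^esub>) \<in> cp.Cau" by simp
  from cls_eq_iff_coef[OF assms this] show ?thesis
    by (simp add: cp.zero_C coef_const) (simp add: zero_A fun_eq_iff)
qed

lemma cls_const_monomial_nonzero:
  assumes "f \<in> cont_funs X" "f x \<noteq> 0"
  shows "cp.cls (\<lambda>_. monomial f n) \<noteq> \<zero>\<^bsub>cp.C\<^esub>"
proof -
  have "coef (\<lambda>_. monomial f n) n x \<noteq> 0" using assms by (simp add: coef_const monomial_def)
  then show ?thesis using assms(1) cls_nonzero_iff[of "\<lambda>_. monomial f n"] by auto
qed

section \<open>Ideals of a topologically free system\<close>

lemma displaced_neighbourhood:
  assumes x: "x \<in> S" and ne: "\<tau> n x \<noteq> x"
  obtains V where "openin X V" "x \<in> V" "\<And>y. y \<in> V \<Longrightarrow> \<tau> n y \<notin> V"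
proof -
  obtain U W where U: "openin X U" "openin X W" "x \<in> U" "\<tau> n x \<in> W" "disjnt U W"
    using Hausdorff_X x ne \<tau>_in[OF x, of n] unfolding Hausdorff_space_def by metis
  define V where "V = U \<inter> {y \<in> S. \<tau> n y \<in> W}"
  have "openin X V" unfolding V_def
    by (intro openin_Int U openin_continuous_map_preimage[OF \<tau>_continuous])
  moreover have "x \<in> V" using U x by (simp add: V_def)
  moreover have "\<tau> n y \<notin> V" if "y \<in> V" for y
    using that U by (auto simp: V_def disjnt_def)
  ultimately show ?thesis using that by blast
qed

text \<open>Only the finitely many powers that occur in the support of an element of \<open>A\<close> can be displaced at
once.\<close>

lemma displaced_neighbourhood_finite:
  assumes x: "x \<in> non_periodic_points X \<sigma>" and K: "finite K" "0 \<notin> K"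
  obtains V where "openin X V" "x \<in> V" "\<And>n y. n \<in> K \<Longrightarrow> y \<in> V \<Longrightarrow> \<tau> n y \<notin> V"
proof -
  have xS: "x \<in> S" using x by (simp add: non_periodic_points_def)
  have "\<exists>V. openin X V \<and> x \<in> V \<and> (\<forall>y\<in>V. \<tau> n y \<notin> V)" if "n \<in> K" for n
    using displaced_neighbourhood[OF xS \<tau>_nonperiodic[OF x, of n]] that K(2) by metis
  then obtain W where W: "\<And>n. n \<in> K \<Longrightarrow> openin X (W n) \<and> x \<in> W n \<and> (\<forall>y\<in>W n. \<tau> n y \<notin> W n)" by metis
  show ?thesis
  proof (rule that[of "(\<Inter>n\<in>K. W n) \<inter> S"])
    show "openin X ((\<Inter>n\<in>K. W n) \<inter> S)" using K W by (intro openin_INT) auto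
  qed (use W xS in auto)
qed

text \<open>From a Urysohn function \<open>g\<close> take \<open>h = min 1 (2 g)\<close> and \<open>k = max 0 (2 g - 1)\<close>: where \<open>k\<close> does not
vanish, \<open>g\<close> exceeds one half and \<open>h\<close> equals 1.\<close>

lemma bump_pair:
  assumes V: "openin X V" "x \<in> V"
  obtains h k where "h \<in> cont_funs X" "k \<in> cont_funs X" "\<And>y. y \<notin> V \<Longrightarrow> h y = 0"
    "\<And>y. cmod (h y) \<le> 1" "k x \<noteq> 0" "\<And>y. k y * h y = k y"
proof -
  obtain g where g: "continuous_map X euclideanreal g" "g x = 1" "\<And>y. y \<in> S - V \<Longrightarrow> g y = 0"
    "\<And>y. y \<in> S \<Longrightarrow> 0 \<le> g y \<and> g y \<le> 1"
    using bump_function[OF V] by metis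
  define h where "h = (\<lambda>y. if y \<in> S then complex_of_real (min 1 (2 * g y)) else 0)"
  define k where "k = (\<lambda>y. if y \<in> S then complex_of_real (max 0 (2 * g y - 1)) else 0)"
  have "continuous_map X euclideanreal (\<lambda>y. min 1 (2 * g y))"
    "continuous_map X euclideanreal (\<lambda>y. max 0 (2 * g y - 1))"
    using g(1) by (auto simp: continuous_map_atin intro!: tendsto_min tendsto_max tendsto_intros)
  then have hk: "h \<in> cont_funs X" "k \<in> cont_funs X"
    unfolding h_def k_def by (auto intro: cont_funs_of_real)
  have xS: "x \<in> S" using V openin_subset by blast
  have mult: "k y * h y = k y" for y by (auto simp: k_def h_def min_def max_def)
  have supp: "h y = 0" if "y \<notin> V" for y using g(3)[of y] that by (auto simp: h_def)
  have bound: "cmod (h y) \<le> 1" for y using g(4)[of y] by (auto simp: h_def)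
  have "k x \<noteq> 0" using g(2) xS by (simp add: k_def)
  from that[OF hk supp bound this mult] show ?thesis .
qed

text \<open>A nonzero element of the ideal has a coefficient that does not vanish on some nonempty open set,
which contains a non-periodic point. Multiplying from the right by a multiple of \<open>\<delta>\<^bsup>-n\<^esup>\<close> stays in the
ideal, moves the coefficient to index 0 and normalises it.\<close>

lemma normalised_element_of_ideal:
  assumes free: "topologically_free X \<sigma>" and I: "ideal I cp.C" and ne: "I \<noteq> {\<zero>\<^bsub>cp.C\<^esub>}"
  obtains s x where "s \<in> cp.Cau" "cp.cls s \<in> I" "x \<in> non_periodic_points X \<sigma>" "coef s 0 x = 1"
proof -
  interpret I: ideal I cp.C by (rule I)
  have "\<zero>\<^bsub>cp.C\<^esub> \<in> I" by (rule I.zero_closed)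
  then obtain b where b: "b \<in> I" "b \<noteq> \<zero>\<^bsub>cp.C\<^esub>" using ne by blast
  then have "b \<in> carrier cp.C" using I.a_subset by blast
  then obtain s where s: "s \<in> cp.Cau" "b = cp.cls s" by (rule cp.carrier_C_E)
  then obtain n x0 where nx0: "coef s n x0 \<noteq> 0" using b(2) cls_nonzero_iff by blast
  define W where "W = {y \<in> S. coef s n y \<in> - {0}}"
  have "openin X W" unfolding W_def
    by (rule openin_continuous_map_preimage[OF cont_funs_cont[OF coef_cont[OF s(1)]]]) (simp add: open_Compl)
  moreover have "x0 \<in> W" using nx0 cont_funs_off[OF coef_cont[OF s(1)]] by (auto simp: W_def)
  ultimately obtain x where x: "x \<in> non_periodic_points X \<sigma>" "coef s n x \<noteq> 0"
    using free unfolding topologically_free_def dense_intersects_open W_def by blast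
  have xS: "x \<in> S" using x(1) by (simp add: non_periodic_points_def)
  define u where "u = (\<lambda>y. 1 / coef s n x * unit_fun y)"
  have u: "u \<in> cont_funs X" unfolding u_def by (rule cont_funs_cmult) simp
  define t where "t = (\<lambda>j. s j \<otimes>\<^bsub>A\<^esub> monomial u (- n))"
  have t: "t \<in> cp.Cau" unfolding t_def using s u by (intro cp.mult_cauchy) auto
  have "cp.cls t = b \<otimes>\<^bsub>cp.C\<^esub> cp.cls (\<lambda>_. monomial u (- n))"
    unfolding s(2) t_def using s u by (intro cp.mult_cls[symmetric]) auto
  also have "\<dots> \<in> I" using u by (intro I.I_r_closed b) auto
  finally have "cp.cls t \<in> I" .
  moreover have "coef t 0 x = 1"
    unfolding t_def coef_mult_right[OF u s(1)] using x(2) xS by (simp add: u_def unit_fun_def)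
  ultimately show ?thesis using that t x(1) by blast
qed

text \<open>The coefficient of \<open>h a h\<close> at \<open>n\<close> is \<open>h(x) a\<^sub>n(x) h(\<tau>(-n) x)\<close>, and for \<open>n \<noteq> 0\<close> one of the three factors
vanishes.\<close>

lemma cut_down_to_diagonal:
  assumes a: "a \<in> carrier A" and h: "h \<in> cont_funs X" "\<And>y. y \<notin> V \<Longrightarrow> h y = 0"
    and V: "\<And>n y. n \<in> supp a \<Longrightarrow> n \<noteq> 0 \<Longrightarrow> y \<in> V \<Longrightarrow> \<tau> (- n) y \<notin> V"
  shows "(monomial h 0 \<otimes>\<^bsub>A\<^esub> a) \<otimes>\<^bsub>A\<^esub> monomial h 0 = monomial (\<lambda>y. h y * h y * a 0 y) 0"
proof (intro ext)
  fix n y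
  have "monomial h 0 \<otimes>\<^bsub>A\<^esub> a \<in> carrier A" using a h by simp
  then have eq: "((monomial h 0 \<otimes>\<^bsub>A\<^esub> a) \<otimes>\<^bsub>A\<^esub> monomial h 0) n y = h y * a n y * h (\<tau> (- n) y)"
    by (simp add: monomial_mult_right monomial_mult_left[OF h(1)])
  show "((monomial h 0 \<otimes>\<^bsub>A\<^esub> a) \<otimes>\<^bsub>A\<^esub> monomial h 0) n y = monomial (\<lambda>y. h y * h y * a 0 y) 0 n y"
  proof (cases "n = 0")
    case True
    then show ?thesis unfolding eq by (simp add: monomial_def)
  next
    case False
    have "h y * a n y * h (\<tau> (- n) y) = 0"
    proof (rule ccontr)
      assume "h y * a n y * h (\<tau> (- n) y) \<noteq> 0"
      then have "y \<in> V" "\<tau> (- n) y \<in> V" "n \<in> supp a" using h(2) by auto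
      then show False using V False by blast
    qed
    then show ?thesis unfolding eq using False by (simp add: monomial_def)
  qed
qed

text \<open>Near a non-periodic point the element \<open>h b h\<close> of the ideal is so close to \<open>h\<^sup>2\<close> that
\<open>1 - h\<^sup>2 + h b h\<close> has a right inverse; multiplying by a function \<open>k\<close> with \<open>k h = k\<close> from the left removes
the part \<open>1 - h\<^sup>2\<close>, which need not belong to the ideal.\<close>

lemma free_imp_ideals_meet:
  assumes free: "topologically_free X \<sigma>" and I: "ideal I cp.C" and ne: "I \<noteq> {\<zero>\<^bsub>cp.C\<^esub>}"
  shows "I \<inter> canonical_copy X \<sigma> \<noteq> {\<zero>\<^bsub>cp.C\<^esub>}"
proof -
  interpret I: ideal I cp.C by (rule I)
  obtain s x where s: "s \<in> cp.Cau" and sI: "cp.cls s \<in> I" and x: "x \<in> non_periodic_points X \<sigma>"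
    and sx: "coef s 0 x = 1"
    using normalised_element_of_ideal[OF free I ne] by metis
  have xS: "x \<in> S" using x by (simp add: non_periodic_points_def)
  note sA [simp] = cp.cauchy_carrier[OF s]
  have e: "(1 / 8 :: real) > 0" by simp
  obtain J1 where J1: "\<And>i j. \<lbrakk>i \<ge> J1; j \<ge> J1\<rbrakk> \<Longrightarrow> P (s i \<ominus>\<^bsub>A\<^esub> s j) < 1 / 8"
    using e by (rule cp.cauchyD[OF s]) blast
  obtain J2 where J2: "\<And>j n y. j \<ge> J2 \<Longrightarrow> cmod (s j n y - coef s n y) \<le> 1 / 8"
    using coef_uniform[OF s e] by metis
  define J where "J = max J1 J2"
  define a where "a = s J"
  have a [simp]: "a \<in> carrier A" by (simp add: a_def)
  have a0: "a 0 \<in> cont_funs X" using carrierD[OF a] by simp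
  have ax: "cmod (a 0 x - 1) \<le> 1 / 8" using J2[of J 0 x] sx by (simp add: a_def J_def)
  define V0 where "V0 = {y \<in> S. a 0 y \<in> ball 1 (1 / 4)}"
  have "openin X V0" unfolding V0_def
    by (rule openin_continuous_map_preimage[OF cont_funs_cont[OF a0]]) simp
  have "x \<in> V0" using ax xS by (simp add: V0_def dist_norm norm_minus_commute)
  have "finite (uminus ` (supp a - {0}))" "0 \<notin> uminus ` (supp a - {0})"
    using carrierD(2)[OF a] by auto
  then obtain V1 where V1: "openin X V1" "x \<in> V1"
    "\<And>n y. n \<in> uminus ` (supp a - {0}) \<Longrightarrow> y \<in> V1 \<Longrightarrow> \<tau> n y \<notin> V1"
    using displaced_neighbourhood_finite[OF x] by metis
  define V where "V = V0 \<inter> V1"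
  have V: "openin X V" "x \<in> V" using \<open>openin X V0\<close> \<open>x \<in> V0\<close> V1 by (auto simp: V_def)
  obtain h k where h: "h \<in> cont_funs X" "\<And>y. y \<notin> V \<Longrightarrow> h y = 0" "\<And>y. cmod (h y) \<le> 1"
    and k: "k \<in> cont_funs X" "k x \<noteq> 0" "\<And>y. k y * h y = k y"
    using bump_pair[OF V] by metis
  define H where "H = monomial h 0"
  define G where "G = monomial k 0"
  have HG [simp]: "H \<in> carrier A" "G \<in> carrier A" using h k by (auto simp: H_def G_def)
  have HH: "H \<otimes>\<^bsub>A\<^esub> H = monomial (\<lambda>y. h y * h y) 0" using h by (simp add: H_def monomial_mult)
  have HaH: "(H \<otimes>\<^bsub>A\<^esub> a) \<otimes>\<^bsub>A\<^esub> H = monomial (\<lambda>y. h y * h y * a 0 y) 0"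
    unfolding H_def
  proof (rule cut_down_to_diagonal[OF a h(1,2)])
    fix n z assume "n \<in> supp a" "n \<noteq> 0" "z \<in> V"
    then have "- n \<in> uminus ` (supp a - {0})" "z \<in> V1" by (auto simp: V_def)
    then show "\<tau> (- n) z \<notin> V" using V1(3) unfolding V_def by blast
  qed
  have PH: "P H \<le> 1" unfolding H_def by (rule seminorm_monomial_le[OF cstar_seminorm_P h(1,3)])
  have near_a: "P (H \<otimes>\<^bsub>A\<^esub> H \<ominus>\<^bsub>A\<^esub> (H \<otimes>\<^bsub>A\<^esub> a) \<otimes>\<^bsub>A\<^esub> H) \<le> 1 / 4"
  proof -
    have "H \<otimes>\<^bsub>A\<^esub> H \<ominus>\<^bsub>A\<^esub> (H \<otimes>\<^bsub>A\<^esub> a) \<otimes>\<^bsub>A\<^esub> H = monomial (\<lambda>y. h y * h y - h y * h y * a 0 y) 0"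
      unfolding HH HaH using h a0 by (simp add: minus_A) (auto simp: monomial_def fun_eq_iff)
    moreover have "P (monomial (\<lambda>y. h y * h y - h y * h y * a 0 y) 0) \<le> 1 / 4"
    proof (rule seminorm_monomial_le[OF cstar_seminorm_P])
      show "(\<lambda>y. h y * h y - h y * h y * a 0 y) \<in> cont_funs X" using h a0 by simp
      fix y
      show "cmod (h y * h y - h y * h y * a 0 y) \<le> 1 / 4"
      proof (cases "y \<in> V")
        case True
        have "cmod (h y * h y - h y * h y * a 0 y) = cmod (h y) * cmod (h y) * cmod (1 - a 0 y)"
          by (simp add: norm_mult[symmetric] algebra_simps)
        also have "\<dots> \<le> 1 * 1 * (1 / 4)"
          using True h(3)[of y] by (intro mult_mono) (auto simp: V_def V0_def dist_norm)
        finally show ?thesis by simp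
      qed (simp add: h)
    qed
    ultimately show ?thesis by simp
  qed
  \<comment> \<open>for \<open>j \<ge> J\<close> the distance to the unit is at most \<open>1/4\<close> (from \<open>a\<^sub>0 \<approx> 1\<close> on \<open>V\<close>) plus \<open>1/8\<close> (from \<open>s j \<approx> a\<close>)\<close>
  define y where "y = (\<lambda>j. (\<one>\<^bsub>A\<^esub> \<ominus>\<^bsub>A\<^esub> H \<otimes>\<^bsub>A\<^esub> H) \<oplus>\<^bsub>A\<^esub> (H \<otimes>\<^bsub>A\<^esub> s j) \<otimes>\<^bsub>A\<^esub> H)"
  have y: "y \<in> cp.Cau" unfolding y_def
    by (intro cp.add_cauchy cp.mult_cauchy cp.const_cauchy s) simp_all
  have near: "P (\<one>\<^bsub>A\<^esub> \<ominus>\<^bsub>A\<^esub> y j) \<le> 3 / 8" if j: "j \<ge> J" for j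
  proof -
    have c: "(H \<otimes>\<^bsub>A\<^esub> s j) \<otimes>\<^bsub>A\<^esub> H \<in> carrier A" "H \<otimes>\<^bsub>A\<^esub> H \<in> carrier A" "(H \<otimes>\<^bsub>A\<^esub> a) \<otimes>\<^bsub>A\<^esub> H \<in> carrier A" by simp_all
    have eq: "\<one>\<^bsub>A\<^esub> \<ominus>\<^bsub>A\<^esub> y j = H \<otimes>\<^bsub>A\<^esub> H \<ominus>\<^bsub>A\<^esub> (H \<otimes>\<^bsub>A\<^esub> s j) \<otimes>\<^bsub>A\<^esub> H"
      using cp.cauchy_carrier[OF y, of j] unfolding y_def
      by (simp add: minus_A[OF c(1)] minus_A[OF c(2)] minus_A add_A)
    have "P (H \<otimes>\<^bsub>A\<^esub> H \<ominus>\<^bsub>A\<^esub> (H \<otimes>\<^bsub>A\<^esub> s j) \<otimes>\<^bsub>A\<^esub> H)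
      \<le> P (H \<otimes>\<^bsub>A\<^esub> H \<ominus>\<^bsub>A\<^esub> (H \<otimes>\<^bsub>A\<^esub> a) \<otimes>\<^bsub>A\<^esub> H) + P ((H \<otimes>\<^bsub>A\<^esub> a) \<otimes>\<^bsub>A\<^esub> H \<ominus>\<^bsub>A\<^esub> (H \<otimes>\<^bsub>A\<^esub> s j) \<otimes>\<^bsub>A\<^esub> H)"
      by (rule cp.p_triangle) simp_all
    moreover have "P ((H \<otimes>\<^bsub>A\<^esub> a) \<otimes>\<^bsub>A\<^esub> H \<ominus>\<^bsub>A\<^esub> (H \<otimes>\<^bsub>A\<^esub> s j) \<otimes>\<^bsub>A\<^esub> H) \<le> 1 / 8"
    proof -
      have eq: "(H \<otimes>\<^bsub>A\<^esub> a) \<otimes>\<^bsub>A\<^esub> H \<ominus>\<^bsub>A\<^esub> (H \<otimes>\<^bsub>A\<^esub> s j) \<otimes>\<^bsub>A\<^esub> H = (H \<otimes>\<^bsub>A\<^esub> (a \<ominus>\<^bsub>A\<^esub> s j)) \<otimes>\<^bsub>A\<^esub> H"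
        by (simp add: cp.minus_eq cp.l_distr cp.r_distr cp.l_minus cp.r_minus)
      have "P ((H \<otimes>\<^bsub>A\<^esub> (a \<ominus>\<^bsub>A\<^esub> s j)) \<otimes>\<^bsub>A\<^esub> H) \<le> P (H \<otimes>\<^bsub>A\<^esub> (a \<ominus>\<^bsub>A\<^esub> s j)) * P H"
        by (rule cp.p_mult) simp_all
      moreover have "P (H \<otimes>\<^bsub>A\<^esub> (a \<ominus>\<^bsub>A\<^esub> s j)) * P H \<le> P (H \<otimes>\<^bsub>A\<^esub> (a \<ominus>\<^bsub>A\<^esub> s j)) * 1"
        by (intro mult_left_mono PH P_nonneg) simp
      moreover have "P (H \<otimes>\<^bsub>A\<^esub> (a \<ominus>\<^bsub>A\<^esub> s j)) \<le> P H * P (a \<ominus>\<^bsub>A\<^esub> s j)"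
        by (rule cp.p_mult) simp_all
      moreover have "P H * P (a \<ominus>\<^bsub>A\<^esub> s j) \<le> 1 * P (a \<ominus>\<^bsub>A\<^esub> s j)"
        by (intro mult_right_mono PH P_nonneg) simp
      moreover have "P (a \<ominus>\<^bsub>A\<^esub> s j) < 1 / 8"
        unfolding a_def by (rule J1) (use j in \<open>auto simp: J_def\<close>)
      ultimately show ?thesis unfolding eq by linarith
    qed
    ultimately show ?thesis unfolding eq using near_a by linarith
  qed
  obtain t where t: "t \<in> cp.Cau" "cp.cls y \<otimes>\<^bsub>cp.C\<^esub> cp.cls t = \<one>\<^bsub>cp.C\<^esub>"
    using cp.right_inverse_near_one[OF y near] by auto
  have Gy: "G \<otimes>\<^bsub>A\<^esub> y j = ((G \<otimes>\<^bsub>A\<^esub> H) \<otimes>\<^bsub>A\<^esub> s j) \<otimes>\<^bsub>A\<^esub> H" for j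
  proof -
    have "G \<otimes>\<^bsub>A\<^esub> (H \<otimes>\<^bsub>A\<^esub> H) = G"
    proof -
      have "k z * (h z * h z) = k z" for z by (metis k(3) mult.assoc)
      then have "(\<lambda>z. k z * (h z * h z)) = k" by auto
      then show ?thesis using k(1) unfolding HH G_def by (simp add: monomial_mult)
    qed
    then have "G \<otimes>\<^bsub>A\<^esub> (\<one>\<^bsub>A\<^esub> \<ominus>\<^bsub>A\<^esub> H \<otimes>\<^bsub>A\<^esub> H) = \<zero>\<^bsub>A\<^esub>"
      by (simp add: cp.minus_eq cp.r_distr cp.r_minus cp.r_neg)
    then show ?thesis by (simp add: y_def cp.r_distr cp.m_assoc)
  qed
  have "cp.cls (\<lambda>_. G) \<otimes>\<^bsub>cp.C\<^esub> cp.cls y = cp.cls (\<lambda>j. ((G \<otimes>\<^bsub>A\<^esub> H) \<otimes>\<^bsub>A\<^esub> s j) \<otimes>\<^bsub>A\<^esub> H)"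
    using y by (simp add: cp.mult_cls Gy)
  also have "\<dots> = (cp.cls (\<lambda>_. G \<otimes>\<^bsub>A\<^esub> H) \<otimes>\<^bsub>cp.C\<^esub> cp.cls s) \<otimes>\<^bsub>cp.C\<^esub> cp.cls (\<lambda>_. H)"
    using s by (simp add: cp.mult_cls)
  also have "\<dots> \<in> I" by (intro I.I_r_closed I.I_l_closed sI) simp_all
  finally have "(cp.cls (\<lambda>_. G) \<otimes>\<^bsub>cp.C\<^esub> cp.cls y) \<otimes>\<^bsub>cp.C\<^esub> cp.cls t \<in> I"
    by (rule I.I_r_closed[OF _ cp.cls_in_C[OF t(1)]])
  moreover have "(cp.cls (\<lambda>_. G) \<otimes>\<^bsub>cp.C\<^esub> cp.cls y) \<otimes>\<^bsub>cp.C\<^esub> cp.cls t = cp.cls (\<lambda>_. G)"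
  proof -
    have G: "cp.cls (\<lambda>_. G) \<in> carrier cp.C" by simp
    show ?thesis
      unfolding cp.C.m_assoc[OF G cp.cls_in_C[OF y] cp.cls_in_C[OF t(1)]] t(2) by (rule cp.C.r_one[OF G])
  qed
  ultimately have "cp.cls (\<lambda>_. G) \<in> I" by simp
  moreover have "cp.cls (\<lambda>_. G) \<in> canonical_copy X \<sigma>" using k by (auto simp: canonical_copy_eq G_def)
  moreover have "cp.cls (\<lambda>_. G) \<noteq> \<zero>\<^bsub>cp.C\<^esub>" unfolding G_def by (rule cls_const_monomial_nonzero[OF k(1,2)])
  ultimately show ?thesis by blast
qed

section \<open>Periodic points with interior\<close>

text \<open>A nonempty open set without non-periodic points is covered by the countably many closed sets of
fixed points of \<open>\<tau> n\<close>, \<open>n \<ge> 1\<close>, so one of them has interior by Baire's theorem.\<close>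

lemma not_free_periodic_function:
  assumes "\<not> topologically_free X \<sigma>"
  obtains n f x where "n \<noteq> 0" "f \<in> cont_funs X" "f x \<noteq> 0" "\<And>y. f y \<noteq> 0 \<Longrightarrow> \<tau> n y = y"
proof -
  obtain T where T: "openin X T" "T \<noteq> {}" "non_periodic_points X \<sigma> \<inter> T = {}"
    using assms unfolding topologically_free_def dense_intersects_open by blast
  define F where "F n = {y \<in> S. \<tau> (int n) y = y}" for n
  have closed: "closedin X (F n)" for n
    unfolding F_def using closedin_continuous_maps_eq[OF Hausdorff_X \<tau>_continuous continuous_map_id, of "int n"] by simp
  have cover: "T \<subseteq> \<Union> (F ` {1..})"
  proof
    fix y assume "y \<in> T"
    then have yS: "y \<in> S" using T openin_subset by blast
    then obtain n where "n > 0" "(\<sigma> ^^ n) y = y"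
      using T(3) \<open>y \<in> T\<close> by (auto simp: non_periodic_points_def)
    then show "y \<in> \<Union> (F ` {1..})" using yS by (auto simp: F_def int_iterate_def intro!: bexI[of _ n])
  qed
  have "\<exists>n\<ge>1. X interior_of (F n) \<noteq> {}"
  proof (rule ccontr)
    assume *: "\<not> (\<exists>n\<ge>1. X interior_of (F n) \<noteq> {})"
    have "X interior_of \<Union> (F ` {1..}) = {}"
    proof (rule Baire_category_alt)
      show "completely_metrizable_space X \<or> locally_compact_space X \<and> regular_space X"
        using compact_X Hausdorff_X compact_imp_locally_compact_space compact_Hausdorff_imp_regular_space by blast
    qed (use * closed in auto)
    then show False using interior_of_maximal[OF cover T(1)] T(2) by blast
  qed
  then obtain n x where n: "n \<ge> 1" and x: "x \<in> X interior_of (F n)" by blast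
  obtain g where g: "continuous_map X euclideanreal g" "g x = 1" "\<And>y. y \<in> S - X interior_of (F n) \<Longrightarrow> g y = 0"
    using bump_function[OF openin_interior_of x] by metis
  have xS: "x \<in> S" using x interior_of_subset_topspace by fastforce
  show ?thesis
  proof (rule that[of "int n"])
    show "(\<lambda>y. if y \<in> S then complex_of_real (g y) else 0) \<in> cont_funs X" by (rule cont_funs_of_real[OF g(1)])
    show "(if x \<in> S then complex_of_real (g x) else 0) \<noteq> 0" using g xS by simp
    show "\<tau> (int n) y = y" if "(if y \<in> S then complex_of_real (g y) else 0) \<noteq> 0" for y
      using that g(3)[of y] interior_of_subset[of X "F n"] by (auto simp: F_def split: if_splits)
  qed (use n in simp)
qed

text \<open>The kernel of the action on functions on the space is a nonzero ideal that contains
\<open>f - f \<delta>\<^sup>n\<close> but, the action being faithful on functions, no nonzero function.\<close>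

lemma ideals_meet_imp_free:
  assumes meet: "\<And>I. ideal I cp.C \<Longrightarrow> I \<noteq> {\<zero>\<^bsub>cp.C\<^esub>} \<Longrightarrow> I \<inter> canonical_copy X \<sigma> \<noteq> {\<zero>\<^bsub>cp.C\<^esub>}"
  shows "topologically_free X \<sigma>"
proof (rule ccontr)
  assume "\<not> topologically_free X \<sigma>"
  then obtain n f x where n: "n \<noteq> 0" and f: "f \<in> cont_funs X" "f x \<noteq> 0" "\<And>y. f y \<noteq> 0 \<Longrightarrow> \<tau> n y = y"
    by (rule not_free_periodic_function) blast
  define I where "I = cp.cls ` {s \<in> cp.Cau. (\<lambda>j. rep_norm (s j)) \<longlonglongrightarrow> 0}"
  have I: "ideal I cp.C" and mem: "\<And>a. a \<in> carrier A \<Longrightarrow> cp.cls (\<lambda>_. a) \<in> I \<longleftrightarrow> rep_norm a = 0"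
    unfolding I_def using cp.kernel_ideal[OF cstar_seminorm_rep_norm le_P[OF cstar_seminorm_rep_norm]] by auto
  define d where "d = monomial f 0 \<ominus>\<^bsub>A\<^esub> monomial f n"
  have d: "d \<in> carrier A" using f by (simp add: d_def)
  have "cp.cls (\<lambda>_. d) \<in> I" using mem[OF d] rep_norm_fixed[OF f(1,3)] by (simp add: d_def)
  moreover have "coef (\<lambda>_. d) 0 x \<noteq> 0"
    using f n by (simp add: coef_const d_def minus_A) (simp add: monomial_def)
  then have "cp.cls (\<lambda>_. d) \<noteq> \<zero>\<^bsub>cp.C\<^esub>" using d cls_nonzero_iff[of "\<lambda>_. d"] by auto
  ultimately have "I \<noteq> {\<zero>\<^bsub>cp.C\<^esub>}" by auto
  moreover have "I \<inter> canonical_copy X \<sigma> = {\<zero>\<^bsub>cp.C\<^esub>}"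
  proof
    show "I \<inter> canonical_copy X \<sigma> \<subseteq> {\<zero>\<^bsub>cp.C\<^esub>}"
    proof
      fix b assume "b \<in> I \<inter> canonical_copy X \<sigma>"
      then obtain g where g: "g \<in> cont_funs X" "b = cp.cls (\<lambda>_. monomial g 0)" "b \<in> I"
        by (auto simp: canonical_copy_eq)
      then have "rep_norm (monomial g 0) = 0" using mem[of "monomial g 0"] by simp
      then have "g y = 0" for y using le_rep_norm_monomial[OF g(1), of y 0] by simp
      then have "monomial g 0 = \<zero>\<^bsub>A\<^esub>" by (auto simp: zero_A monomial_def fun_eq_iff)
      then show "b \<in> {\<zero>\<^bsub>cp.C\<^esub>}" using g(2) by (simp add: cp.zero_C)
    qed
    have "monomial (\<lambda>_. 0) 0 = \<zero>\<^bsub>A\<^esub>" by (auto simp: monomial_def zero_A)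
    then have "\<zero>\<^bsub>cp.C\<^esub> \<in> canonical_copy X \<sigma>"
      unfolding canonical_copy_eq cp.zero_C by (intro image_eqI[of _ _ "\<lambda>_. 0"]) auto
    moreover have "\<zero>\<^bsub>cp.C\<^esub> \<in> I" by (rule additive_subgroup.zero_closed[OF ideal.axioms(1)[OF I]])
    ultimately show "{\<zero>\<^bsub>cp.C\<^esub>} \<subseteq> I \<inter> canonical_copy X \<sigma>" by simp
  qed
  ultimately show False using meet[OF I] by blast
qed

section \<open>Maximal commutativity of the continuous functions\<close>

text \<open>The copy of \<open>C(X)\<close> is closed: the coefficient at 0 of a limit of functions is continuous, and the
other coefficients vanish.\<close>

lemma canonical_copy_closure: "canonical_copy X \<sigma> = cp.closure_in_C ((\<lambda>f. monomial f 0) ` cont_funs X)"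
proof
  show "canonical_copy X \<sigma> \<subseteq> cp.closure_in_C ((\<lambda>f. monomial f 0) ` cont_funs X)"
    unfolding canonical_copy_eq by (auto intro!: cp.closure_in_C_I)
  show "cp.closure_in_C ((\<lambda>f. monomial f 0) ` cont_funs X) \<subseteq> canonical_copy X \<sigma>"
  proof
    fix b assume "b \<in> cp.closure_in_C ((\<lambda>f. monomial f 0) ` cont_funs X)"
    then obtain s where s: "s \<in> cp.Cau" "\<And>j. s j \<in> (\<lambda>f. monomial f 0) ` cont_funs X" "b = cp.cls s"
      by (rule cp.closure_in_C_E) blast
    have c0: "coef s 0 \<in> cont_funs X" by (rule coef_cont[OF s(1)])
    have "s j n x = 0" if "n \<noteq> 0" for j n x using s(2)[of j] that by (auto simp: monomial_def)
    then have "coef s n x = 0" if "n \<noteq> 0" for n x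
      using coef_tendsto[OF s(1), of n x] that by (simp add: LIMSEQ_const_iff)
    then have "coef s = coef (\<lambda>_. monomial (coef s 0) 0)"
      by (auto simp: coef_const monomial_def fun_eq_iff)
    then have "b = cp.cls (\<lambda>_. monomial (coef s 0) 0)"
      using s(1,3) c0 by (simp add: cls_eq_iff_coef)
    then show "b \<in> canonical_copy X \<sigma>" using c0 by (auto simp: canonical_copy_eq)
  qed
qed

lemma abelian_closure:
  assumes "B \<subseteq> carrier A" "\<zero>\<^bsub>A\<^esub> \<in> B"
    and "\<And>a b. \<lbrakk>a \<in> B; b \<in> B\<rbrakk> \<Longrightarrow> a \<oplus>\<^bsub>A\<^esub> b \<in> B"
    and "\<And>c a. a \<in> B \<Longrightarrow> c \<odot>\<^bsub>A\<^esub> a \<in> B"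
    and "\<And>a b. \<lbrakk>a \<in> B; b \<in> B\<rbrakk> \<Longrightarrow> a \<otimes>\<^bsub>A\<^esub> b \<in> B"
    and "\<And>a. a \<in> B \<Longrightarrow> star A a \<in> B"
    and comm: "\<And>a b. \<lbrakk>a \<in> B; b \<in> B\<rbrakk> \<Longrightarrow> a \<otimes>\<^bsub>A\<^esub> b = b \<otimes>\<^bsub>A\<^esub> a"
  shows "abelian_cstar_subalgebra cp.C (cp.closure_in_C B)"
proof -
  have "cstar_subalgebra cp.C (cp.closure_in_C B)"
    by (rule cp.cstar_subalgebra_closure) (use assms in auto)
  moreover have "a \<otimes>\<^bsub>cp.C\<^esub> b = b \<otimes>\<^bsub>cp.C\<^esub> a" if ab: "a \<in> cp.closure_in_C B" "b \<in> cp.closure_in_C B" for a b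
  proof -
    obtain s where s: "s \<in> cp.Cau" "\<And>j. s j \<in> B" "a = cp.cls s"
      using ab(1) by (rule cp.closure_in_C_E) blast
    obtain t where t: "t \<in> cp.Cau" "\<And>j. t j \<in> B" "b = cp.cls t"
      using ab(2) by (rule cp.closure_in_C_E) blast
    have "(\<lambda>j. s j \<otimes>\<^bsub>A\<^esub> t j) = (\<lambda>j. t j \<otimes>\<^bsub>A\<^esub> s j)" using comm s t by auto
    then show ?thesis using s t by (simp add: cp.mult_cls)
  qed
  ultimately show ?thesis by (simp add: abelian_cstar_subalgebra_def)
qed

lemma canonical_copy_abelian: "abelian_cstar_subalgebra cp.C (canonical_copy X \<sigma>)"
  unfolding canonical_copy_closure
proof (rule abelian_closure)
  show "\<zero>\<^bsub>A\<^esub> \<in> (\<lambda>f. monomial f 0) ` cont_funs X"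
    by (rule image_eqI[of _ _ "\<lambda>_. 0"]) (auto simp: monomial_def zero_A)
  fix a assume "a \<in> (\<lambda>f. monomial f 0) ` cont_funs X"
  then obtain f where f: "f \<in> cont_funs X" "a = monomial f 0" by auto
  have "c \<odot>\<^bsub>A\<^esub> a = monomial (\<lambda>x. c * f x) 0" for c
    unfolding f by (auto simp: smult_A monomial_def fun_eq_iff)
  then show "c \<odot>\<^bsub>A\<^esub> a \<in> (\<lambda>f. monomial f 0) ` cont_funs X" for c using f by auto
  show "star A a \<in> (\<lambda>f. monomial f 0) ` cont_funs X"
    using f star_monomial[of f 0] by auto
  fix b assume "b \<in> (\<lambda>f. monomial f 0) ` cont_funs X"
  then obtain g where g: "g \<in> cont_funs X" "b = monomial g 0" by auto
  have "a \<oplus>\<^bsub>A\<^esub> b = monomial (\<lambda>x. f x + g x) 0"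
    unfolding f g by (auto simp: add_A monomial_def fun_eq_iff)
  then show "a \<oplus>\<^bsub>A\<^esub> b \<in> (\<lambda>f. monomial f 0) ` cont_funs X" using f g by auto
  show "a \<otimes>\<^bsub>A\<^esub> b \<in> (\<lambda>f. monomial f 0) ` cont_funs X" using f g by (auto simp: monomial_mult)
  show "a \<otimes>\<^bsub>A\<^esub> b = b \<otimes>\<^bsub>A\<^esub> a" using f g by (simp add: monomial_mult mult.commute)
qed auto

text \<open>Commuting with functions forces the coefficients at \<open>n \<noteq> 0\<close> to vanish at non-periodic points, hence
everywhere by density and continuity.\<close>

lemma free_imp_maximal_abelian:
  assumes free: "topologically_free X \<sigma>"
  shows "maximal_abelian_cstar_subalgebra cp.C (canonical_copy X \<sigma>)"
  unfolding maximal_abelian_cstar_subalgebra_def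
proof (intro conjI allI impI)
  show "abelian_cstar_subalgebra cp.C (canonical_copy X \<sigma>)" by (rule canonical_copy_abelian)
  fix B assume "abelian_cstar_subalgebra cp.C B \<and> canonical_copy X \<sigma> \<subseteq> B"
  then have sub: "B \<subseteq> carrier cp.C" and comm: "\<And>a b. a \<in> B \<Longrightarrow> b \<in> B \<Longrightarrow> a \<otimes>\<^bsub>cp.C\<^esub> b = b \<otimes>\<^bsub>cp.C\<^esub> a"
    and B: "canonical_copy X \<sigma> \<subseteq> B"
    by (auto simp: abelian_cstar_subalgebra_def cstar_subalgebra_def)
  have "b \<in> canonical_copy X \<sigma>" if b: "b \<in> B" for b
  proof -
    obtain s where s: "s \<in> cp.Cau" "b = cp.cls s" using b sub by (blast elim: cp.carrier_C_E)
    have comm_coef: "f x * coef s n x = coef s n x * f (\<tau> (- n) x)" if f: "f \<in> cont_funs X" for f n x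
    proof -
      have "cp.cls (\<lambda>_. monomial f 0) \<in> B" using B f by (auto simp: canonical_copy_eq)
      from comm[OF this b] have "cp.cls (\<lambda>j. monomial f 0 \<otimes>\<^bsub>A\<^esub> s j) = cp.cls (\<lambda>j. s j \<otimes>\<^bsub>A\<^esub> monomial f 0)"
        using f s by (simp add: cp.mult_cls)
      then have "coef (\<lambda>j. monomial f 0 \<otimes>\<^bsub>A\<^esub> s j) n x = coef (\<lambda>j. s j \<otimes>\<^bsub>A\<^esub> monomial f 0) n x"
        using f s by (subst (asm) cls_eq_iff_coef) auto
      then show ?thesis using f s by (simp add: coef_mult_left coef_mult_right)
    qed
    have zero: "coef s n x = 0" if n: "n \<noteq> 0" and x: "x \<in> non_periodic_points X \<sigma>" for n x
    proof -
      have xS: "x \<in> S" using x by (simp add: non_periodic_points_def)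
      have "\<tau> (- n) x \<noteq> x" using \<tau>_nonperiodic[OF x, of "- n"] n by simp
      then obtain V where V: "openin X V" "x \<in> V" "\<And>y. y \<in> V \<Longrightarrow> \<tau> (- n) y \<notin> V"
        using displaced_neighbourhood[OF xS] by metis
      obtain h k where h: "k \<in> cont_funs X" "k x \<noteq> 0" "\<And>y. y \<notin> V \<Longrightarrow> h y = 0" "\<And>y. k y * h y = k y"
        using bump_pair[OF V(1,2)] by metis
      have "k (\<tau> (- n) x) = 0" using h(3)[OF V(3)[OF V(2)]] h(4)[of "\<tau> (- n) x"] by simp
      then show ?thesis using comm_coef[OF h(1), of x n] h(2) by simp
    qed
    have zero_all: "coef s n x = 0" if n: "n \<noteq> 0" for n x
    proof (rule ccontr)
      assume ne: "coef s n x \<noteq> 0"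
      define W where "W = {y \<in> S. coef s n y \<in> - {0}}"
      have "openin X W" unfolding W_def
        by (rule openin_continuous_map_preimage[OF cont_funs_cont[OF coef_cont[OF s(1)]]]) (simp add: open_Compl)
      moreover have "x \<in> W" using ne cont_funs_off[OF coef_cont[OF s(1)]] by (auto simp: W_def)
      ultimately obtain y where "y \<in> non_periodic_points X \<sigma>" "coef s n y \<noteq> 0"
        using free unfolding topologically_free_def dense_intersects_open W_def by blast
      then show False using zero[OF n] by blast
    qed
    have c0: "coef s 0 \<in> cont_funs X" by (rule coef_cont[OF s(1)])
    have "coef s = coef (\<lambda>_. monomial (coef s 0) 0)"
      using zero_all by (auto simp: coef_const monomial_def fun_eq_iff)
    then have "b = cp.cls (\<lambda>_. monomial (coef s 0) 0)"
      using s c0 by (simp add: cls_eq_iff_coef)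
    then show ?thesis using c0 by (auto simp: canonical_copy_eq)
  qed
  then show "B = canonical_copy X \<sigma>" using B by blast
qed

text \<open>The elements of \<open>A\<close> that commute with all functions, described by their coefficients: \<open>a\<^sub>n\<close> is
supported on fixed points of \<open>\<tau> n\<close>.\<close>

definition isotropy_algebra :: "(int \<Rightarrow> 'x \<Rightarrow> complex) set" where
  "isotropy_algebra = {a \<in> carrier A. \<forall>n x. a n x \<noteq> 0 \<longrightarrow> \<tau> n x = x}"

text \<open>On this algebra the twist by \<open>\<tau>\<close> disappears, so that the product is a pointwise convolution.\<close>

lemma isotropy_mult:
  assumes a: "a \<in> isotropy_algebra"
  shows "(a \<otimes>\<^bsub>A\<^esub> b) n x = (\<Sum>k\<in>supp a. a k x * b (n - k) x)"
proof -
  have aA: "a \<in> carrier A" using a by (simp add: isotropy_algebra_def)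
  have "a k x * b (n - k) (\<tau> (- k) x) = a k x * b (n - k) x" for k
  proof (cases "a k x = 0")
    case False
    then have "\<tau> k x = x" "x \<in> S" using a carrier_off[OF aA] by (auto simp: isotropy_algebra_def)
    then show ?thesis using \<tau>_fixed_neg[of x k] by simp
  qed simp
  then show ?thesis unfolding mult_A[OF aA] conv_def by (simp only:)
qed

text \<open>The substitution \<open>k \<mapsto> n - k\<close> in the convolution.\<close>

lemma isotropy_commute:
  assumes a: "a \<in> isotropy_algebra" and b: "b \<in> isotropy_algebra"
  shows "a \<otimes>\<^bsub>A\<^esub> b = b \<otimes>\<^bsub>A\<^esub> a"
proof (intro ext)
  fix n x
  have fin: "finite (supp a)" "finite (supp b)"
    using a b carrierD by (auto simp: isotropy_algebra_def)
  define K where "K = supp a \<union> (\<lambda>k. n - k) ` supp b"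
  have K: "finite K" using fin by (simp add: K_def)
  have "(a \<otimes>\<^bsub>A\<^esub> b) n x = (\<Sum>k\<in>K. a k x * b (n - k) x)"
    unfolding isotropy_mult[OF a] by (rule sum.mono_neutral_left[OF K]) (auto simp: K_def)
  also have "\<dots> = (\<Sum>k\<in>(\<lambda>k. n - k) ` supp b. a k x * b (n - k) x)"
  proof (rule sum.mono_neutral_right[OF K])
    show "\<forall>k\<in>K - (\<lambda>k. n - k) ` supp b. a k x * b (n - k) x = 0"
    proof
      fix k assume k: "k \<in> K - (\<lambda>k. n - k) ` supp b"
      have "n - k \<notin> supp b"
      proof
        assume "n - k \<in> supp b"
        then have "n - (n - k) \<in> (\<lambda>k. n - k) ` supp b" by (rule imageI)
        with k show False by simp
      qed
      then show "a k x * b (n - k) x = 0" by simp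
    qed
  qed (auto simp: K_def)
  also have "\<dots> = (\<Sum>k\<in>supp b. b k x * a (n - k) x)"
    by (subst sum.reindex) (auto simp: inj_on_def mult.commute)
  finally show "(a \<otimes>\<^bsub>A\<^esub> b) n x = (b \<otimes>\<^bsub>A\<^esub> a) n x" unfolding isotropy_mult[OF b] .
qed

lemma isotropy_closure_abelian: "abelian_cstar_subalgebra cp.C (cp.closure_in_C isotropy_algebra)"
proof (rule abelian_closure)
  show "isotropy_algebra \<subseteq> carrier A" by (auto simp: isotropy_algebra_def)
  have "\<zero>\<^bsub>A\<^esub> \<in> carrier A" by simp
  then show "\<zero>\<^bsub>A\<^esub> \<in> isotropy_algebra" unfolding isotropy_algebra_def by (simp add: zero_A)
  fix a assume a: "a \<in> isotropy_algebra"
  then have aA: "a \<in> carrier A" and a': "\<And>n x. a n x \<noteq> 0 \<Longrightarrow> \<tau> n x = x"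
    by (auto simp: isotropy_algebra_def)
  show "c \<odot>\<^bsub>A\<^esub> a \<in> isotropy_algebra" for c
    using smult_closed_A[OF aA, of c] a' unfolding isotropy_algebra_def by (simp add: smult_A)
  have "\<tau> n x = x" if "star A a n x \<noteq> 0" for n x
  proof -
    have xS: "x \<in> S" and ne: "a (- n) (\<tau> (- n) x) \<noteq> 0"
      using that by (auto simp: star_A_apply split: if_splits)
    have "\<tau> n (\<tau> (- n) (\<tau> (- n) x)) = \<tau> n (\<tau> (- n) x)" using a'[OF ne] by simp
    then show ?thesis using xS \<tau>_fixed_neg[OF xS, of n] by simp
  qed
  then show "star A a \<in> isotropy_algebra"
    using star_closed_A[OF aA] by (simp add: isotropy_algebra_def)
  fix b assume b: "b \<in> isotropy_algebra"
  then have bA: "b \<in> carrier A" and b': "\<And>n x. b n x \<noteq> 0 \<Longrightarrow> \<tau> n x = x"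
    by (auto simp: isotropy_algebra_def)
  have "\<tau> n x = x" if "(a \<oplus>\<^bsub>A\<^esub> b) n x \<noteq> 0" for n x
    using that a'[of n x] b'[of n x] by (cases "a n x = 0") (auto simp: add_A)
  then show "a \<oplus>\<^bsub>A\<^esub> b \<in> isotropy_algebra"
    using add_closed[OF aA bA] by (simp add: isotropy_algebra_def)
  have "\<tau> n x = x" if ne: "(a \<otimes>\<^bsub>A\<^esub> b) n x \<noteq> 0" for n x
  proof -
    obtain k where k: "a k x * b (n - k) x \<noteq> 0"
      using ne unfolding isotropy_mult[OF a] by (rule sum.not_neutral_contains_not_neutral)
    then have "x \<in> S" using carrier_off[OF aA] by auto
    then have "\<tau> n x = \<tau> k (\<tau> (n - k) x)" by (simp add: \<tau>_add)
    then show ?thesis using a'[of k x] b'[of "n - k" x] k by simp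
  qed
  then show "a \<otimes>\<^bsub>A\<^esub> b \<in> isotropy_algebra"
    using aA bA by (simp add: isotropy_algebra_def)
  show "a \<otimes>\<^bsub>A\<^esub> b = b \<otimes>\<^bsub>A\<^esub> a" by (rule isotropy_commute[OF a b])
qed

text \<open>If the system is not topologically free, the closure of the isotropy algebra is an abelian
C*-subalgebra that contains \<open>C(X)\<close> and the monomial \<open>f \<delta>\<^sup>n\<close>, whose coefficient at \<open>n\<close> is nonzero.\<close>

lemma maximal_abelian_imp_free:
  assumes max: "maximal_abelian_cstar_subalgebra cp.C (canonical_copy X \<sigma>)"
  shows "topologically_free X \<sigma>"
proof (rule ccontr)
  assume "\<not> topologically_free X \<sigma>"
  then obtain n f x where n: "n \<noteq> 0" and f: "f \<in> cont_funs X" "f x \<noteq> 0" "\<And>y. f y \<noteq> 0 \<Longrightarrow> \<tau> n y = y"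
    by (rule not_free_periodic_function) blast
  have iso: "monomial g m \<in> isotropy_algebra" if "g \<in> cont_funs X" "\<And>y. g y \<noteq> 0 \<Longrightarrow> \<tau> m y = y" for g m
    using that monomial_closed[of g m] by (auto simp: isotropy_algebra_def monomial_def)
  have "canonical_copy X \<sigma> \<subseteq> cp.closure_in_C isotropy_algebra"
    unfolding canonical_copy_eq by (auto intro!: cp.closure_in_C_I iso)
  then have eq: "cp.closure_in_C isotropy_algebra = canonical_copy X \<sigma>"
    using max isotropy_closure_abelian unfolding maximal_abelian_cstar_subalgebra_def by blast
  have "cp.cls (\<lambda>_. monomial f n) \<in> cp.closure_in_C isotropy_algebra"
    using f by (intro cp.closure_in_C_I iso) auto
  then obtain g where g: "g \<in> cont_funs X" "cp.cls (\<lambda>_. monomial f n) = cp.cls (\<lambda>_. monomial g 0)"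
    unfolding eq canonical_copy_eq by auto
  then have "monomial f n = monomial g 0"
    using f by (simp add: cls_eq_iff_coef coef_const)
  then have "monomial f n n x = monomial g 0 n x" by simp
  then show False using n f(2) by (simp add: monomial_def)
qed

end

theorem theorem5p2:
  fixes X :: "'x topology" and \<sigma> :: "'x \<Rightarrow> 'x"
  assumes "top_dyn_sys X \<sigma>"
  shows "(topologically_free X \<sigma> \<longleftrightarrow>
           (\<forall>I. ideal I (crossed_product X \<sigma>) \<and> I \<noteq> {\<zero>\<^bsub>crossed_product X \<sigma>\<^esub>} \<longrightarrow>
              I \<inter> canonical_copy X \<sigma> \<noteq> {\<zero>\<^bsub>crossed_product X \<sigma>\<^esub>}))
       \<and> (topologically_free X \<sigma> \<longleftrightarrow>
           maximal_abelian_cstar_subalgebra (crossed_product X \<sigma>) (canonical_copy X \<sigma>))"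
proof -
  interpret dynamical_system X \<sigma> by (rule dynamical_system.intro[OF assms])
  show ?thesis
    unfolding crossed_product_eq
  proof (intro conjI iffI allI impI)
    fix I assume "topologically_free X \<sigma>" "ideal I cp.C \<and> I \<noteq> {\<zero>\<^bsub>cp.C\<^esub>}"
    then show "I \<inter> canonical_copy X \<sigma> \<noteq> {\<zero>\<^bsub>cp.C\<^esub>}"
      by (simp add: free_imp_ideals_meet)
  next
    assume "\<forall>I. ideal I cp.C \<and> I \<noteq> {\<zero>\<^bsub>cp.C\<^esub>} \<longrightarrow> I \<inter> canonical_copy X \<sigma> \<noteq> {\<zero>\<^bsub>cp.C\<^esub>}"
    then show "topologically_free X \<sigma>"
      by (intro ideals_meet_imp_free) simp
  qed (rule free_imp_maximal_abelian maximal_abelian_imp_free, assumption)+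
qed

end
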